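(* Let $n\ge 2$, let $M(n)=\mathbb{R}^n\rtimes SO(n)$ be the Euclidean motion group, and let $K_1=SO(n-1)$. For $r>0$ and $\lambda\in\widehat{K_1}$ let $T_{r,\lambda}$ be the unitary representation of $M(n)$ on $H(K,\lambda)$ described in the context. (i) Let $\theta$ be a non-negative locally integrable function on $[0,\infty)$ and let $f$ be a compactly supported continuous function on $M(n)$ such that for every $\lambda\in\widehat{K_1}$ there is a constant $C_\lambda>0$ with $$\|\widehat f(T_{r,\lambda})\|_{HS}\le C_\lambda e^{-\theta(r)}\quad\text{for all } r\in(0,\infty).$$ If $I=\int_0^\infty\frac{\theta(r)}{1+r^2}\,dr=\infty$, then $f=0$ on $M(n)$. (ii) Conversely, if $\theta:[0,\infty)\to[0,\infty)$ is a non-decreasing function such that $I=\int_0^\infty\frac{\theta(r)}{1+r^2}\,dr$ is finite, then there exists a non-zero $f\in C_c(M(n))$ such that for every $\lambda\in\widehat{K_1}$ there is a constant $C_\lambda>0$ with $$\|\widehat f(T_{r,\lambda})\|_{HS}\le C_\lambda e^{-\theta(r)}\quad\text{for all } r\in(0,\infty).$$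
   Context: $M(n)$ is the semidirect product of $\mathbb{R}^n$ with $K=SO(n)$, with group law $(x_1,k_1)(x_2,k_2)=(x_1+k_1\cdot x_2,\,k_1k_2)$ and Haar measure $dx\,dk$, where $dx$ is Lebesgue measure on $\mathbb{R}^n$ and $dk$ is the normalized Haar measure on $K$. $C_c(M(n))$ is the space of complex-valued compactly supported continuous functions on $M(n)$. Representations: for $r>0$ let $\xi=(0,\dots,0,r)\in\mathbb{R}^n$. The stabilizer of $\xi$ in $K$ is $K_1=\left\{\begin{pmatrix}A&0\\0&1\end{pmatrix}:A\in SO(n-1)\right\}\cong SO(n-1)$. $\widehat{K_1}$ denotes the set of equivalence classes of irreducible unitary representations of $K_1$. For $\lambda\in\widehat{K_1}$ acting on $\mathbb{C}^{d_\lambda}$, let $H(K,\lambda)$ be the Hilbert space of measurable $\psi:K\to\mathbb{C}^{d_\lambda}$ (modulo almost everywhere equality) with $\psi(uk)=\lambda(u)\psi(k)$ for $u\in K_1$, $k\in K$, and $\int_K\|\psi(k)\|^2_{\mathbb{C}^{d_\lambda}}dk<\infty$, with inner product $\langle\psi_1,\psi_2\rangle=d_\lambda\int_K\langle\psi_1(k),\psi_2(k)\rangle_{\mathbb{C}^{d_\lambda}}dk$. The representation $T_{r,\lambda}$ of $M(n)$ on $H(K,\lambda)$ is $$\big(T_{r,\lambda}(x,k)\psi\big)(k_0)=e^{i\langle k_0^{-1}\cdot\xi,\,x\rangle}\psi(k_0k),\qquad x\in\mathbb{R}^n,\ k,k_0\in K.$$ The group Fourier transform of $f\in L^1(M(n))$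 at a unitary representation $\pi$ of $M(n)$ is the operator $\widehat f(\pi)=\int_K\int_{\mathbb{R}^n}f(x,k)\,\pi(x,k)\,dx\,dk$. $\|\cdot\|_{HS}$ denotes the Hilbert–Schmidt norm. *)

theory Defs
  imports
    "Jordan_Normal_Form.Schur_Decomposition"
    "Jordan_Normal_Form.VS_Connect"
    "HOL-Analysis.Analysis"
begin

section \<open>The Euclidean motion group\<close>

type_synonym 'n rvec = "(real, 'n) Finite_Cartesian_Product.vec"
type_synonym 'n sqmat = "'n rvec ^ 'n"

definition SO :: "'n::finite sqmat set" where
  "SO = {k. rotation_matrix k}"

definition motion_group :: "('n::finite rvec \<times> 'n sqmat) monoid" where
  "motion_group =
    \<lparr> carrier = UNIV \<times> SO,
      monoid.mult = (\<lambda>(x1, k1) (x2, k2). (x1 + k1 *v x2, k1 ** k2)),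
      one = (0, Finite_Cartesian_Product.mat 1) \<rparr>"

text \<open>The closure is taken in the ambient vector space, of which the motion group is a closed
  subset. Values of \<open>f\<close> outside the motion group are irrelevant.\<close>

definition Cc_motion :: "('n::finite rvec \<times> 'n sqmat \<Rightarrow> complex) set" where
  "Cc_motion = {f. continuous_on (carrier motion_group) f \<and>
     compact (closure {p \<in> carrier motion_group. f p \<noteq> 0})}"

text \<open>Normalized (left) Haar measure of a compact group \<open>G\<close> of matrices. It exists, is unique and
  is bi-invariant.\<close>

definition normalized_haar_measure :: "'n::finite sqmat set \<Rightarrow> 'n sqmat measure \<Rightarrow> bool" where
  "normalized_haar_measure G \<mu> \<longleftrightarrow>
     sets \<mu> = sets (restrict_space borel G) \<and>
     emeasure \<mu> G = 1 \<and>
     (\<forall>g\<in>G. distr \<mu> \<mu> (\<lambda>k. g ** k) = \<mu>)"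

section \<open>The stabilizer of \<open>(0, \<dots>, 0, r)\<close>\<close>

text \<open>The coordinates are indexed by a finite linear order, so that there is a last one.\<close>

definition last_index :: "'n::{finite,linorder}" where
  "last_index = Max UNIV"

definition xi :: "real \<Rightarrow> 'n::{finite,linorder} rvec" where
  "xi r = axis last_index r"

text \<open>The block matrices with blocks \<open>A \<in> SO(n-1)\<close> and \<open>1\<close>: those elements of \<open>SO(n)\<close>
  whose last row and last column are the ones of the identity.\<close>

definition K1 :: "'n::{finite,linorder} sqmat set" where
  "K1 = {k \<in> SO. \<forall>i. vec_nth (vec_nth k i) last_index = (if i = last_index then 1 else 0) \<and>
                    vec_nth (vec_nth k last_index) i = (if i = last_index then 1 else 0)}"

lemma K1_eq_stabilizer:
  assumes "r > 0"
  shows "K1 = {k \<in> SO. k *v xi r = xi r}"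
proof -
  have col: "k *v xi r = xi r \<longleftrightarrow>
     (\<forall>i. vec_nth (vec_nth k i) last_index = (if i = last_index then 1 else 0))"
    for k :: "'n::{finite,linorder} sqmat"
  proof -
    have "vec_nth (k *v xi r) i = r * vec_nth (vec_nth k i) last_index" for i
      by (simp add: xi_def matrix_vector_mult_def axis_def if_distrib cong: if_cong)
    moreover have "vec_nth (xi r :: 'n rvec) i = r * (if i = last_index then 1 else 0)" for i
      by (simp add: xi_def axis_def)
    ultimately show ?thesis
      using assms by (auto simp: vec_eq_iff)
  qed
  have row: "vec_nth (vec_nth k last_index) i = (if i = last_index then 1 else 0)"
    if "k \<in> SO" and c: "\<forall>i. vec_nth (vec_nth k i) last_index = (if i = last_index then 1 else 0)"
    for k :: "'n::{finite,linorder} sqmat" and i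
  proof -
    have "orthogonal_matrix k"
      using that by (simp add: SO_def rotation_matrix_def)
    then have o: "(transpose k ** k) = Finite_Cartesian_Product.mat 1"
      by (simp add: orthogonal_matrix_def)
    have "vec_nth (vec_nth (transpose k ** k) last_index) i = vec_nth (vec_nth k last_index) i"
      unfolding matrix_matrix_mult_def transpose_def
      using c by (simp add: if_distrib[of "\<lambda>x. x * _"] cong: if_cong)
    then show ?thesis
      unfolding o by (auto simp: Finite_Cartesian_Product.mat_def split: if_splits)
  qed
  show ?thesis
    unfolding K1_def using col row by blast
qed

section \<open>Irreducible unitary representations on \<open>\<complex>\<^sup>d\<close>\<close>

text \<open>All irreducible unitary representations of a compact group are finite-dimensional, so up to
  equivalence they are given by unitary matrices. The values of \<open>lam\<close> outside \<open>G\<close> are irrelevant.\<close>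

definition unitary_matrix_rep ::
    "'n::finite sqmat set \<Rightarrow> nat \<Rightarrow> ('n sqmat \<Rightarrow> complex Matrix.mat) \<Rightarrow> bool" where
  "unitary_matrix_rep G d lam \<longleftrightarrow>
     (\<forall>u\<in>G. lam u \<in> carrier_mat d d \<and> mat_adjoint (lam u) * lam u = 1\<^sub>m d) \<and>
     (\<forall>u\<in>G. \<forall>v\<in>G. lam (u ** v) = lam u * lam v) \<and>
     (\<forall>i<d. \<forall>j<d. continuous_on G (\<lambda>u. index_mat (lam u) (i, j)))"

definition irreducible_unitary_rep ::
    "'n::finite sqmat set \<Rightarrow> nat \<Rightarrow> ('n sqmat \<Rightarrow> complex Matrix.mat) \<Rightarrow> bool" where
  "irreducible_unitary_rep G d lam \<longleftrightarrow>
     unitary_matrix_rep G d lam \<and> d > 0 \<and>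
     (\<forall>W. VectorSpace.subspace class_ring W (module_vec TYPE(complex) d) \<and>
          (\<forall>u\<in>G. \<forall>w\<in>W. lam u *\<^sub>v w \<in> W)
          \<longrightarrow> W = {0\<^sub>v d} \<or> W = carrier_vec d)"

section \<open>The representations \<open>T\<^bsub>r,\<lambda>\<^esub>\<close>\<close>

text \<open>Elements of \<open>H(K, \<lambda>)\<close> are represented by functions; functions that agree almost everywhere
  are not identified, so the inner product is only positive semidefinite, and a function is zero
  as an element of \<open>H(K, \<lambda>)\<close> iff its inner product with itself is 0.\<close>

definition H_space ::
    "'n::{finite,linorder} sqmat measure \<Rightarrow> nat \<Rightarrow> ('n sqmat \<Rightarrow> complex Matrix.mat)
      \<Rightarrow> ('n sqmat \<Rightarrow> complex Matrix.vec) set" where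
  "H_space \<mu> d lam = {\<psi>.
     (\<forall>k\<in>SO. \<psi> k \<in> carrier_vec d) \<and>
     (\<forall>i<d. (\<lambda>k. vec_index (\<psi> k) i) \<in> borel_measurable \<mu>) \<and>
     (\<forall>u\<in>K1. \<forall>k\<in>SO. \<psi> (u ** k) = lam u *\<^sub>v \<psi> k) \<and>
     integrable \<mu> (\<lambda>k. Re (\<psi> k \<bullet>c \<psi> k))}"

definition H_inner ::
    "'n::finite sqmat measure \<Rightarrow> nat \<Rightarrow> ('n sqmat \<Rightarrow> complex Matrix.vec)
      \<Rightarrow> ('n sqmat \<Rightarrow> complex Matrix.vec) \<Rightarrow> complex" where
  "H_inner \<mu> d \<psi>1 \<psi>2 = of_nat d * (LINT k|\<mu>. \<psi>1 k \<bullet>c \<psi>2 k)"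

text \<open>\<open>\<lambda>\<close> enters \<open>T\<^bsub>r,\<lambda>\<^esub>\<close> only through the space on which it acts.\<close>

definition T_rep ::
    "real \<Rightarrow> 'n::{finite,linorder} rvec \<times> 'n sqmat
      \<Rightarrow> ('n sqmat \<Rightarrow> complex Matrix.vec) \<Rightarrow> ('n sqmat \<Rightarrow> complex Matrix.vec)" where
  "T_rep r = (\<lambda>(x, k) \<psi> k0.
     exp (\<i> * complex_of_real (inner (matrix_inv k0 *v xi r) x)) \<cdot>\<^sub>v \<psi> (k0 ** k))"

section \<open>Group Fourier transform and Hilbert--Schmidt norm\<close>

text \<open>In the following, \<open>H\<close> is the carrier of a Hilbert space with inner product \<open>ip\<close>, again up to
  vectors of norm 0. The operator-valued integral defining the Fourier transform at a
  representation \<open>\<pi>\<close> on \<open>H\<close> is understood in the weak sense; this determines its values up to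
  vectors of norm 0.\<close>

definition group_fourier ::
    "'n::finite sqmat measure \<Rightarrow> 'h set \<Rightarrow> ('h \<Rightarrow> 'h \<Rightarrow> complex)
      \<Rightarrow> ('n rvec \<times> 'n sqmat \<Rightarrow> complex)
      \<Rightarrow> ('n rvec \<times> 'n sqmat \<Rightarrow> 'h \<Rightarrow> 'h) \<Rightarrow> 'h \<Rightarrow> 'h" where
  "group_fourier \<mu> H ip f \<pi> \<psi> = (SOME \<eta>. \<eta> \<in> H \<and>
     (\<forall>\<phi>\<in>H. ip \<eta> \<phi> = (LINT k|\<mu>. LINT x|lborel. f (x, k) * ip (\<pi> (x, k) \<psi>) \<phi>)))"

definition orthonormal_basis :: "'h set \<Rightarrow> ('h \<Rightarrow> 'h \<Rightarrow> complex) \<Rightarrow> 'h set \<Rightarrow> bool" where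
  "orthonormal_basis H ip E \<longleftrightarrow>
     E \<subseteq> H \<and>
     (\<forall>e\<in>E. \<forall>e'\<in>E. ip e e' = (if e = e' then 1 else 0)) \<and>
     (\<forall>\<psi>\<in>H. (\<forall>e\<in>E. ip \<psi> e = 0) \<longrightarrow> ip \<psi> \<psi> = 0)"

text \<open>The norm is \<open>\<infinity>\<close> if the operator is not Hilbert--Schmidt. The sum does not depend on
  the choice of the orthonormal basis.\<close>

definition hs_norm_sq :: "'h set \<Rightarrow> ('h \<Rightarrow> 'h \<Rightarrow> complex) \<Rightarrow> ('h \<Rightarrow> 'h) \<Rightarrow> ennreal" where
  "hs_norm_sq H ip A =
     (\<Sum>\<^sub>\<infinity>e\<in>(SOME E. orthonormal_basis H ip E). ennreal (Re (ip (A e) (A e))))"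

definition hs_norm :: "'h set \<Rightarrow> ('h \<Rightarrow> 'h \<Rightarrow> complex) \<Rightarrow> ('h \<Rightarrow> 'h) \<Rightarrow> ennreal" where
  "hs_norm H ip A =
     (if hs_norm_sq H ip A = \<infinity> then \<infinity> else ennreal (sqrt (enn2real (hs_norm_sq H ip A))))"

definition fourier_hs_norm ::
    "'n::{finite,linorder} sqmat measure
      \<Rightarrow> ('n rvec \<times> 'n sqmat \<Rightarrow> complex) \<Rightarrow> real
      \<Rightarrow> nat \<Rightarrow> ('n sqmat \<Rightarrow> complex Matrix.mat) \<Rightarrow> ennreal" where
  "fourier_hs_norm \<mu> f r d lam =
     hs_norm (H_space \<mu> d lam) (H_inner \<mu> d)
       (group_fourier \<mu> (H_space \<mu> d lam) (H_inner \<mu> d) f (T_rep r))"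

end

theory Submission
  imports Defs "HOL-Complex_Analysis.Conformal_Mappings" "HOL-Probability.Probability_Measure"
begin

text \<open>
  On the representation space the Fourier transform of \<open>f\<close> is an integral operator: substituting
  \<open>k0\<inverse> k\<close> for \<open>k\<close> in the integral that defines it yields the kernel
  \<open>M\<^sub>r(k0, k) = \<integral> f(x, k0\<inverse> k) exp (i \<langle>k0\<inverse> \<xi>\<^sub>r, x\<rangle>) dx\<close>, in which \<open>r\<close>
  enters only through the exponential.

  Uniqueness. A matrix coefficient \<open>\<langle>M\<^sub>r e, \<phi>\<rangle>\<close> is, as a function of \<open>r\<close>, the Fourier integral of an
  integrable function with a bounded phase, so it extends to an entire function of exponential
  type. For a vector \<open>e\<close> of the orthonormal basis in which the Hilbert--Schmidt norm is computed it
  is bounded by a multiple of \<open>exp (- \<theta> r)\<close> on the positive half-line. After multiplication by an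
  exponential the function is bounded in the upper half-plane, where the logarithm of its modulus
  lies below its Poisson integral. If the integral of \<open>\<theta> r / (1 + r\<^sup>2)\<close> diverges, that Poisson
  integral is \<open>- \<infinity>\<close>, and the coefficient vanishes for all \<open>r\<close> (\<open>fourier_laplace_zero\<close>). Since the
  basis does not depend on \<open>r\<close>, the adjoint of \<open>M\<^sub>r\<close> maps every \<open>\<phi>\<close> to a vector orthogonal to the
  whole basis, that is, to a null vector (\<open>adjoint_kernel_orthogonal\<close>). The entries of the tensor
  powers of \<open>k\<close> transform under the stabilizer by unitary representations, which split into
  irreducible ones (\<open>monomials_by_irreducibles\<close>). So the kernel is orthogonal to all monomials in
  the entries of \<open>k0\<close>, and it is zero by the Stone--Weierstrass theorem. Because the rotations act
  transitively on spheres, this says that the Euclidean Fourier transform of each \<open>f(\<cdot>, k)\<close> is zero.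

  Existence. For \<open>f(x, k) = g x\<close> the kernel depends on \<open>k0\<close> alone, so the operator factors through
  \<open>\<psi> \<mapsto> \<integral> \<psi>\<close>, and Bessel's inequality bounds its Hilbert--Schmidt norm by a multiple of the maximum
  of the Fourier transform of \<open>g\<close> on the sphere of radius \<open>r\<close> (\<open>hs_norm_right_invariant_le\<close>). The
  function \<open>g\<close> arises from a tent function by averaging over infinitely many segments parallel to
  the coordinate axes. A segment of length \<open>\<rho>\<close> contributes a factor of modulus at most \<open>1\<close> and at
  most \<open>2 / (\<rho> \<bar>\<eta>\<^sub>i\<bar>)\<close> to the Fourier transform. With lengths
  \<open>\<rho>\<^sub>k = c \<integral>\<^bsub>t \<ge> 1, \<theta> t > k\<^esub> t\<^bsup>-2\<^esup> dt\<close> the total length is finite, because it is controlled by the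
  integral of \<open>\<theta> t / (1 + t\<^sup>2)\<close>, and at a frequency of norm \<open>y \<ge> 1\<close> at least \<open>\<theta> y\<close> of the factors
  are at most \<open>1 / e\<close> (\<open>bump_with_prescribed_decay\<close>).
\<close>

section \<open>A log-integral uniqueness theorem for functions of exponential type\<close>

text \<open>
  Integrals over a period do not depend on where the period starts. The error is uniform in the
  starting point \<open>s\<close> because it only involves the modulus of continuity of \<open>v\<close>.
\<close>
lemma riemann_sum_periodic:
  fixes v :: "real \<Rightarrow> real"
  assumes cont: "continuous_on UNIV v" and per: "\<And>u. v (u + pi) = v u" and "e > 0"
  shows "\<exists>N>0. \<forall>s\<in>{0..pi}. \<bar>(\<Sum>j<N. v (s + pi * real j / real N)) * (pi / real N) - integral {-pi/2..pi/2} v\<bar> \<le> e"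
proof -
  have int: "v integrable_on {a..b}" for a b
    using cont by (intro integrable_continuous_interval) (auto intro: continuous_on_subset)
  have shift: "integral {-pi/2..pi/2} v = integral {s..s+pi} v" if s: "s \<in> {0..pi}" for s
  proof -
    have s': "-pi/2 \<le> s" "pi/2 \<le> s + pi" using s pi_gt_zero by auto
    have "(v has_integral integral {pi/2..s+pi} v) {pi/2..s+pi}" using int by blast
    from has_integral_affinity[OF this[unfolded interval_cbox], of 1 pi]
    have "((\<lambda>x. v (x + pi)) has_integral integral {pi/2..s+pi} v) ((\<lambda>x. x - pi) ` {pi/2..s+pi})"
      by simp
    moreover have "(\<lambda>x. x - pi) ` {pi/2..s+pi} = {-pi/2..s}"
      by (simp add: image_minus_const_atLeastAtMost')
    ultimately have "integral {-pi/2..s} v = integral {pi/2..s+pi} v"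
      by (simp add: per integral_unique)
    moreover have "integral {-pi/2..s} v + integral {s..s+pi} v = integral {-pi/2..s+pi} v"
      using s' by (intro Henstock_Kurzweil_Integration.integral_combine int) auto
    moreover have "integral {-pi/2..pi/2} v + integral {pi/2..s+pi} v = integral {-pi/2..s+pi} v"
      using s' by (intro Henstock_Kurzweil_Integration.integral_combine int) auto
    ultimately show ?thesis by linarith
  qed
  have "uniformly_continuous_on {0..2*pi} v"
    using cont by (intro compact_uniformly_continuous) (auto intro: continuous_on_subset)
  moreover have "e/pi > 0" using assms by simp
  ultimately obtain d where d: "d > 0"
    "\<And>x y. x \<in> {0..2*pi} \<Longrightarrow> y \<in> {0..2*pi} \<Longrightarrow> dist x y < d \<Longrightarrow> dist (v x) (v y) < e/pi"
    unfolding uniformly_continuous_on_def by (metis dist_commute)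
  obtain N :: nat where N: "real N > pi / d" using reals_Archimedean2 by blast
  have N0: "N > 0" using N d pi_gt_zero by (metis divide_pos_pos less_trans of_nat_0_less_iff)
  have step: "\<bar>(\<Sum>j<m. v (s + pi * real j / real N)) * (pi / real N) - integral {s..s+pi*real m/real N} v\<bar> \<le> e * real m / real N"
    if s: "s \<in> {0..pi}" and m: "m \<le> N" for m s
    using m
  proof (induction m)
    case 0
    then show ?case by simp
  next
    case (Suc m)
    define p where "p = s + pi * real m / real N"
    define q where "q = s + pi * real (Suc m) / real N"
    have pq: "q = p + pi / real N" using N0 by (simp add: p_def q_def field_simps)
    have pN: "pi / real N > 0" using N0 by simp
    have sp: "s \<le> p" unfolding p_def using N0 by simp
    have "real (Suc m) / real N \<le> 1" using Suc.prems N0 by simp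
    then have "pi * (real (Suc m) / real N) \<le> pi * 1" by (intro mult_left_mono) auto
    then have q2: "q \<le> 2*pi" unfolding q_def using s by auto
    have "integral {s..p} v + integral {p..q} v = integral {s..q} v"
      using sp pq pN by (intro Henstock_Kurzweil_Integration.integral_combine int) auto
    moreover have "\<bar>integral {p..q} (\<lambda>x. v x - v p)\<bar> \<le> (e/pi) * (q - p)"
    proof -
      have "norm (integral {p..q} (\<lambda>x. v x - v p)) \<le> (e/pi) * (q - p)"
      proof (rule integral_bound)
        show "continuous_on {p..q} (\<lambda>x. v x - v p)"
          using cont by (intro continuous_intros) (auto intro: continuous_on_subset)
        fix t assume t: "t \<in> {p..q}"
        have "dist t p \<le> pi / real N" using t pq by (auto simp: dist_real_def)
        also have "pi / real N < d" using N d N0 by (simp add: field_simps)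
        finally have "dist (v t) (v p) < e/pi" using t sp s q2 by (intro d) auto
        then show "norm (v t - v p) \<le> e/pi" by (simp add: dist_norm)
      qed (use pq pN in auto)
      then show ?thesis by simp
    qed
    moreover have "integral {p..q} (\<lambda>x. v x - v p) = integral {p..q} v - v p * (pi/real N)"
      using pq pN int[of p q] by (subst Henstock_Kurzweil_Integration.integral_diff) auto
    moreover have "(e/pi) * (q - p) = e / real N" using pq by simp
    moreover have "\<bar>(\<Sum>j<m. v (s + pi * real j / real N)) * (pi / real N) - integral {s..p} v\<bar> \<le> e * real m / real N"
      using Suc unfolding p_def by simp
    moreover have "(\<Sum>j<Suc m. v (s + pi * real j / real N)) * (pi / real N) = (\<Sum>j<m. v (s + pi * real j / real N)) * (pi / real N) + v p * (pi/real N)"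
      by (simp add: p_def distrib_right add_divide_distrib)
    moreover have "\<bar>a' - i2\<bar> \<le> E1 + E2"
      if "i0 + i1 = i2" "\<bar>i3\<bar> \<le> E3" "i3 = i1 - w" "E3 = E2" "\<bar>a - i0\<bar> \<le> E1" "a' = a + w"
      for a a' i0 i1 i2 i3 w E1 E2 E3 :: real
      using that by linarith
    ultimately have "\<bar>(\<Sum>j<Suc m. v (s + pi * real j / real N)) * (pi / real N) - integral {s..q} v\<bar>
        \<le> e * real m / real N + e / real N"
      by blast
    then show ?case unfolding q_def[symmetric]
      by (simp add: add_divide_distrib distrib_left add.commute)
  qed
  show ?thesis
  proof (intro exI[of _ N] conjI ballI N0)
    fix s assume s: "s \<in> {0..pi}"
    show "\<bar>(\<Sum>j<N. v (s + pi * real j / real N)) * (pi / real N) - integral {-pi/2..pi/2} v\<bar> \<le> e"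
      using step[OF s, of N] N0 shift[OF s] by simp
  qed
qed

text \<open>
  This is the sub-mean value property of \<open>ln \<bar>h\<bar>\<close>, with a continuous majorant in place of the
  logarithm, which may take the value \<open>- \<infinity>\<close>. The product of \<open>N\<close> rotated copies of \<open>h\<close> has the value
  \<open>h(0)\<^sup>N\<close> at the centre, and on the circle the logarithm of its modulus is at most a sum of \<open>N\<close>
  equidistant values of \<open>v\<close>. Thus the maximum principle compares \<open>ln \<bar>h(0)\<bar>\<close> with Riemann sums of
  \<open>v\<close>. The parametrization by the half angle is the one that fits the Cayley transform below.
\<close>
lemma disc_log_mean:
  fixes h :: "complex \<Rightarrow> complex" and v :: "complex \<Rightarrow> real"
  assumes hol: "h holomorphic_on ball 0 1" and ch: "continuous_on (cball 0 1) h"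
    and cv: "continuous_on (sphere 0 1) v"
    and le: "\<And>w. norm w = 1 \<Longrightarrow> norm (h w) \<le> exp (v w)"
    and nz: "h 0 \<noteq> 0"
  shows "pi * ln (norm (h 0)) \<le> integral {-pi/2..pi/2} (\<lambda>u. v (cis (2*u)))"
proof (rule field_le_epsilon)
  fix e :: real assume e: "e > 0"
  define V where "V = (\<lambda>u. v (cis (2*u)))"
  have cV: "continuous_on UNIV V" unfolding V_def
    by (intro continuous_on_compose2[OF cv] continuous_intros) (auto simp: )
  have per: "V (u + pi) = V u" for u
    unfolding V_def by (simp add: distrib_left cis_mult[symmetric])
  obtain N where N: "N > 0" and
    R: "\<And>s. s\<in>{0..pi} \<Longrightarrow> \<bar>(\<Sum>j<N. V (s + pi * real j / real N)) * (pi / real N) - integral {-pi/2..pi/2} V\<bar> \<le> e"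
    using riemann_sum_periodic[OF cV per e] by blast
  \<comment> \<open>The arguments of the factors run through the vertices of a regular polygon.\<close>
  define H where "H = (\<lambda>w. \<Prod>j<N. h (cis (2 * (pi * real j / real N)) * w))"
  have "H holomorphic_on ball 0 1" unfolding H_def
    by (intro holomorphic_intros holomorphic_on_compose_gen[OF _ hol, unfolded o_def])
       (auto simp: norm_mult)
  moreover have "continuous_on (cball 0 1) H" unfolding H_def
    by (intro continuous_intros continuous_on_compose2[OF ch]) (auto simp: norm_mult)
  moreover have "norm (H w) \<le> exp ((integral {-pi/2..pi/2} V + e) * (real N / pi))" if w: "norm w = 1" for w
  proof -
    obtain t where t: "0 \<le> t" "t < 2*pi" "w = cis t"
      using w complex_unit_circle
      by (metis Arg2pi_ge_0 Arg2pi_lt_2pi Arg2pi_eq cis_conv_exp mult_1 norm_one of_real_1)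
    have s: "t/2 \<in> {0..pi}" using t by auto
    have "norm (H w) = (\<Prod>j<N. norm (h (cis (2 * (pi * real j / real N)) * w)))"
      unfolding H_def by (simp add: prod_norm)
    also have "\<dots> \<le> (\<Prod>j<N. exp (V (t/2 + pi * real j / real N)))"
    proof (intro prod_mono conjI)
      fix j assume "j \<in> {..<N}"
      have "cis (2 * (pi * real j / real N)) * w = cis (2 * (t/2 + pi * real j / real N))"
        using t by (simp add: cis_mult add.commute distrib_left)
      then show "norm (h (cis (2 * (pi * real j / real N)) * w)) \<le> exp (V (t/2 + pi * real j / real N))"
        using le[of "cis (2 * (t/2 + pi * real j / real N))"] by (simp add: V_def)
    qed auto
    also have "\<dots> = exp (\<Sum>j<N. V (t/2 + pi * real j / real N))" by (simp add: exp_sum)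
    also have "\<dots> \<le> exp ((integral {-pi/2..pi/2} V + e) * (real N / pi))"
    proof -
      have "(\<Sum>j<N. V (t/2 + pi * real j / real N)) * (pi / real N) \<le> integral {-pi/2..pi/2} V + e"
        using R[OF s] by linarith
      then have "(\<Sum>j<N. V (t/2 + pi * real j / real N)) * (pi / real N) * (real N / pi) \<le> (integral {-pi/2..pi/2} V + e) * (real N / pi)"
        by (intro mult_right_mono) auto
      then show ?thesis using N by simp
    qed
    finally show ?thesis .
  qed
  ultimately have "norm (H 0) \<le> exp ((integral {-pi/2..pi/2} V + e) * (real N / pi))"
    using maximum_modulus_frontier[of H "cball 0 1" "exp ((integral {-pi/2..pi/2} V + e) * (real N / pi))" 0]
    by (auto simp: frontier_cball interior_cball)
  moreover have "norm (H 0) = norm (h 0) ^ N" by (simp add: H_def norm_power)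
  ultimately have "ln (norm (h 0) ^ N) \<le> (integral {-pi/2..pi/2} V + e) * (real N / pi)"
    using nz by (metis exp_le_cancel_iff exp_ln zero_less_norm_iff zero_less_power)
  then have "real N * ln (norm (h 0)) \<le> (integral {-pi/2..pi/2} V + e) * (real N / pi)"
    using nz by (simp add: ln_realpow)
  then have "real N * (pi * ln (norm (h 0))) \<le> real N * (integral {-pi/2..pi/2} V + e)"
    by (simp add: field_simps)
  then show "pi * ln (norm (h 0)) \<le> integral {-pi/2..pi/2} (\<lambda>u. v (cis (2*u))) + e"
    using N unfolding V_def by simp
qed


text \<open>
  The point \<open>-1\<close> is the image of infinity under the Cayley transform, and continuity there cannot be
  expected. The inequality holds on circles of radius less than 1, and dominated convergence moves
  it to the unit circle; truncating \<open>ln \<bar>h\<bar>\<close> at \<open>ln d\<close> supplies the lower bound for the domination.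
\<close>
lemma disc_log_mean_bounded:
  fixes h :: "complex \<Rightarrow> complex"
  assumes hol: "h holomorphic_on ball 0 1" and ch: "continuous_on (cball 0 1 - {-1}) h"
    and le: "\<And>w. w \<in> cball 0 1 - {-1} \<Longrightarrow> norm (h w) \<le> M"
    and nz: "h 0 \<noteq> 0" and d: "0 < d" "d \<le> M"
  shows "(\<lambda>u. ln (max (norm (h (cis (2*u)))) d)) integrable_on {-pi/2<..<pi/2}"
    and "pi * ln (norm (h 0)) \<le> integral {-pi/2<..<pi/2} (\<lambda>u. ln (max (norm (h (cis (2*u)))) d))"
proof -
  define S where "S = {-pi/2<..<pi/2}"
  \<comment> \<open>Radii increasing to 1.\<close>
  define r where "r = (\<lambda>n. 1 - inverse (real (n + 2)))"
  have r: "0 < r n" "r n < 1" for n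
    unfolding r_def by (auto simp: field_simps)
  have rlim: "r \<longlonglongrightarrow> 1"
    unfolding r_def using tendsto_diff[OF tendsto_const LIMSEQ_ignore_initial_segment[OF lim_inverse_n, of 2], of 1]
    by simp
  define v where "v = (\<lambda>n w. ln (max (norm (h (of_real (r n) * w))) d))"
  define g where "g = (\<lambda>u. ln (max (norm (h (cis (2*u)))) d))"
  have ball: "of_real (r n) * w \<in> ball 0 1" if "norm w \<le> 1" for n and w :: complex
  proof -
    have "r n * norm w \<le> r n * 1" using r[of n] that by (intro mult_left_mono) auto
    then have "r n * norm w < 1" using r[of n] by linarith
    then show ?thesis using r[of n] by (auto simp: norm_mult)
  qed
  have ball': "ball 0 1 \<subseteq> cball 0 1 - {-1::complex}" by auto
  have hc: "continuous_on (cball 0 1) (\<lambda>w. h (of_real (r n) * w))" for n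
  proof (rule continuous_on_compose2[OF ch])
    show "continuous_on (cball 0 1) (\<lambda>w::complex. of_real (r n) * w)" by (intro continuous_intros)
    show "(\<lambda>w::complex. of_real (r n) * w) ` cball 0 1 \<subseteq> cball 0 1 - {-1}"
      using ball ball' by (intro image_subsetI subsetD[OF ball']) auto
  qed
  have vc: "continuous_on (cball 0 1) (v n)" for n
    unfolding v_def using d by (intro continuous_intros hc) auto
  have main: "pi * ln (norm (h 0)) \<le> integral {-pi/2..pi/2} (\<lambda>u. v n (cis (2*u)))" for n
  proof -
    have "pi * ln (norm ((\<lambda>w. h (of_real (r n) * w)) 0)) \<le> integral {-pi/2..pi/2} (\<lambda>u. v n (cis (2*u)))"
    proof (rule disc_log_mean)
      show "(\<lambda>w. h (of_real (r n) * w)) holomorphic_on ball 0 1"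
        using ball by (intro holomorphic_on_compose_gen[OF _ hol, unfolded o_def] holomorphic_intros) auto
      show "continuous_on (sphere 0 1) (v n)" using vc by (rule continuous_on_subset) auto
      show "norm (h (of_real (r n) * w)) \<le> exp (v n w)" for w
        using d unfolding v_def by simp
    qed (use nz hc in auto)
    then show ?thesis by simp
  qed
  have icv: "(\<lambda>u. v n (cis (2*u))) integrable_on {-pi/2..pi/2}" for n
    by (intro integrable_continuous_interval continuous_on_compose2[OF vc] continuous_intros) auto
  have iv: "(\<lambda>u. v n (cis (2*u))) integrable_on S" for n
    using icv[of n] unfolding S_def integrable_on_Icc_iff_Ioo by simp
  have S1: "cis (2*u) \<noteq> -1" if "u \<in> S" for u
  proof
    assume "cis (2*u) = -1"
    then have "cos (2*u) = -1" by (metis cis.sel(1) one_complex.sel(1) uminus_complex.sel(1))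
    then have "cos u = 0" by (simp add: cos_double_cos)
    moreover have "cos u > 0" using that unfolding S_def by (intro cos_gt_zero_pi) auto
    ultimately show False by simp
  qed
  have dom: "(\<lambda>_. max \<bar>ln d\<bar> \<bar>ln M\<bar>) integrable_on S"
      unfolding S_def by (metis integrable_const_ivl integrable_on_Icc_iff_Ioo)
  have bd: "norm (v n (cis (2*u))) \<le> max \<bar>ln d\<bar> \<bar>ln M\<bar>" for n u
    proof -
      have "norm (h (of_real (r n) * cis (2*u))) \<le> M" using ball[of "cis (2*u)" n] ball' by (intro le) auto
      then have "ln d \<le> v n (cis (2*u))" "v n (cis (2*u)) \<le> ln M"
        unfolding v_def using d by (auto simp: )
      then show ?thesis by auto
    qed
  have lim: "(\<lambda>n. v n (cis (2*u))) \<longlonglongrightarrow> g u" if u: "u \<in> S" for u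
    proof -
      have "(\<lambda>n. of_real (r n) * cis (2*u)) \<longlonglongrightarrow> of_real 1 * cis (2*u)"
        by (intro tendsto_intros rlim)
      moreover have "of_real (r n) * cis (2*u) \<in> cball 0 1 - {-1}" for n
        using ball[of "cis (2*u)" n] ball' by auto
      ultimately have "(\<lambda>n. h (of_real (r n) * cis (2*u))) \<longlonglongrightarrow> h (cis (2*u))"
        using ch S1[OF u] unfolding continuous_on_sequentially o_def by auto
      then show ?thesis unfolding v_def g_def
        using d by (intro tendsto_intros) auto
    qed
  have "g integrable_on S" "(\<lambda>n. integral S (\<lambda>u. v n (cis (2*u)))) \<longlonglongrightarrow> integral S g"
    by (rule dominated_convergence[OF iv dom bd lim]; assumption)+
  moreover have "integral S (\<lambda>u. v n (cis (2*u))) = integral {-pi/2..pi/2} (\<lambda>u. v n (cis (2*u)))" for n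
    unfolding S_def by (metis integral_open_interval_real)
  ultimately have "g integrable_on S" "pi * ln (norm (h 0)) \<le> integral S g"
    using main by (auto intro: LIMSEQ_le_const)
  then show "(\<lambda>u. ln (max (norm (h (cis (2*u)))) d)) integrable_on {-pi/2<..<pi/2}"
    "pi * ln (norm (h 0)) \<le> integral {-pi/2<..<pi/2} (\<lambda>u. ln (max (norm (h (cis (2*u)))) d))"
    unfolding g_def S_def .
qed

text \<open>
  The Cayley transform \<open>w \<mapsto> i b (1 - w) / (1 + w)\<close> maps the centre of the disc to \<open>i b\<close> and the
  boundary point \<open>cis (2 u)\<close> to \<open>b tan u\<close>. The substitution \<open>t = b tan u\<close> turns the mean over the
  circle into the Poisson integral at \<open>i b\<close>. Only a part of the boundary is kept on the left, which
  is legitimate since the integrand is non-negative.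
\<close>
lemma half_plane_log_integral:
  fixes H :: "complex \<Rightarrow> complex"
  assumes hol: "H holomorphic_on UNIV" and le: "\<And>z. Im z \<ge> 0 \<Longrightarrow> norm (H z) \<le> M"
    and b: "b > 0" and nz: "H (\<i> * of_real b) \<noteq> 0" and d: "0 < d" "d \<le> M" and T: "T \<ge> 0"
  shows "integral {0..T} (\<lambda>t. (b / (b\<^sup>2 + t\<^sup>2)) * (ln M - ln (max (norm (H (of_real t))) d)))
      \<le> pi * (ln M - ln (norm (H (\<i> * of_real b))))"
proof -
  define Z where "Z = (\<lambda>w. \<i> * of_real b * (1 - w) / (1 + w))"
  define h where "h = H \<circ> Z"
  have ne: "1 + w \<noteq> 0" if "w \<noteq> -1" for w :: complex using that
    by (metis add.commute eq_neg_iff_add_eq_0)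
  have Im: "Im (Z w) \<ge> 0" if "norm w \<le> 1" for w
  proof -
    have "Im (Z w) = b * Re ((1 - w) / (1 + w))"
    proof -
      have "Z w = \<i> * (of_real b * ((1 - w) / (1 + w)))" unfolding Z_def by simp
      then show ?thesis by (simp del: times_divide_eq_right)
    qed
    also have "Re ((1 - w) / (1 + w)) = (1 - (norm w)\<^sup>2) / (norm (1 + w))\<^sup>2"
      unfolding cmod_power2 Re_divide by (simp add: algebra_simps power2_eq_square)
    also have "b * \<dots> \<ge> 0" using b that by (simp add: power_le_one)
    finally show ?thesis .
  qed
  have holZ: "Z holomorphic_on (- {-1})"
    unfolding Z_def by (intro holomorphic_intros) (auto dest: ne)
  have holh: "h holomorphic_on (- {-1})"
    unfolding h_def using holZ hol by (rule holomorphic_on_compose_gen) auto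
  have h0: "h 0 = H (\<i> * of_real b)" by (simp add: h_def Z_def)
  have hcis: "h (cis (2*u)) = H (of_real (b * tan u))" if u: "u \<in> {-pi/2<..<pi/2}" for u
  proof -
    have c: "cos u > 0" using u by (intro cos_gt_zero_pi) auto
    have eq: "cis (2*u) = cis u * cis u" by (simp add: cis_mult)
    have one: "1 = cis u * cnj (cis u)" by (simp add: cis_cnj cis_mult)
    have "1 - cis (2*u) = cis u * (cnj (cis u) - cis u)" unfolding eq right_diff_distrib using one by simp
    moreover have "1 + cis (2*u) = cis u * (cnj (cis u) + cis u)" unfolding eq distrib_left using one by simp
    moreover have "cnj (cis u) - cis u = - (2 * \<i> * of_real (sin u))" "cnj (cis u) + cis u = 2 * of_real (cos u)"
      by (auto simp: complex_eq_iff)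
    ultimately have "Z (cis (2*u)) = \<i> * of_real b * (cis u * (- (2 * \<i> * of_real (sin u)))) / (cis u * (2 * of_real (cos u)))"
      unfolding Z_def by simp
    also have "\<dots> = of_real b * of_real (sin u) / of_real (cos u)" using c
      by (simp add: field_simps)
    finally show ?thesis by (simp add: h_def tan_def)
  qed
  define g where "g = (\<lambda>u. ln (max (norm (h (cis (2*u)))) d))"
  define p where "p = (\<lambda>t. ln M - ln (max (norm (H (of_real t))) d))"
  have 1: "h holomorphic_on ball 0 1" using holh by (rule holomorphic_on_subset) auto
  have 2: "continuous_on (cball 0 1 - {-1}) h"
    using holomorphic_on_imp_continuous_on[OF holh] by (rule continuous_on_subset) auto
  have 3: "norm (h w) \<le> M" if "w \<in> cball 0 1 - {-1}" for w
    using that le Im by (auto simp: h_def)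
  have 4: "h 0 \<noteq> 0" using h0 nz by simp
  have gi: "g integrable_on {-pi/2<..<pi/2}" and gle: "pi * ln (norm (h 0)) \<le> integral {-pi/2<..<pi/2} g"
    unfolding g_def by (rule disc_log_mean_bounded[OF 1 2 3 4 d]; assumption)+
  have p0: "p t \<ge> 0" for t
  proof -
    have "norm (H (of_real t)) \<le> M" by (rule le) auto
    then show ?thesis unfolding p_def using d by simp
  qed
  have pg: "p (b * tan u) = ln M - g u" if "u \<in> {-pi/2<..<pi/2}" for u
    using hcis[OF that] unfolding p_def g_def by simp
  have Hc: "continuous_on UNIV H" using hol by (rule holomorphic_on_imp_continuous_on)
  have pc: "continuous_on UNIV p"
    unfolding p_def using d by (intro continuous_intros continuous_on_compose2[OF Hc]) auto
  define a where "a = arctan (T / b)"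
  have a: "0 \<le> a" "a < pi/2" unfolding a_def using T b arctan_ubound[of "T/b"] by auto
  have "cos u \<noteq> 0" if "u \<in> {0..a}" for u
    using that a cos_gt_zero_pi[of u] by auto
  then have tanc: "continuous_on {0..a} (\<lambda>u. b * tan u)"
    by (intro continuous_intros) auto
  have fc: "continuous_on {0..a} (\<lambda>u. p (b * tan u))"
    by (rule continuous_on_compose2[OF pc tanc]) auto
  have "((\<lambda>t. (b / (b\<^sup>2 + t\<^sup>2)) *\<^sub>R p (b * tan (arctan (t/b)))) has_integral
      (integral {arctan (0/b)..arctan (T/b)} (\<lambda>u. p (b * tan u)))) {0..T}"
  proof (rule has_integral_substitution[where c = 0 and d = a and f = "\<lambda>u. p (b * tan u)"
        and g = "\<lambda>t. arctan (t/b)" and g' = "\<lambda>t. b / (b\<^sup>2 + t\<^sup>2)"])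
    show "(\<lambda>t. arctan (t/b)) ` {0..T} \<subseteq> {0..a}"
      using b T unfolding a_def by (auto simp: arctan_monotone' divide_right_mono)
    show "((\<lambda>t. arctan (t / b)) has_real_derivative b / (b\<^sup>2 + t\<^sup>2)) (at t within {0..T})" for t
    proof -
      have "inverse (1 + (t/b)\<^sup>2) * (1 / b) = b / (b\<^sup>2 + t\<^sup>2)"
        using b by (simp add: field_simps power2_eq_square)
      moreover have "((\<lambda>t. arctan (t / b)) has_real_derivative inverse (1 + (t/b)\<^sup>2) * (1 / b)) (at t within {0..T})"
        by (rule derivative_eq_intros refl | use b in simp)+
      ultimately show ?thesis by simp
    qed
  qed (use T b fc a in \<open>auto simp: arctan_monotone'\<close>)
  then have eq: "integral {0..T} (\<lambda>t. (b / (b\<^sup>2 + t\<^sup>2)) * p t) = integral {0..a} (\<lambda>u. p (b * tan u))"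
    using b by (auto simp: tan_arctan a_def dest!: integral_unique)
  have "integral {0..a} (\<lambda>u. p (b * tan u)) = integral {0..a} (\<lambda>u. ln M - g u)"
    using a pg by (intro Henstock_Kurzweil_Integration.integral_cong) auto
  also have "\<dots> \<le> integral {-pi/2<..<pi/2} (\<lambda>u. ln M - g u)"
  proof (rule integral_subset_le)
    show "{0..a} \<subseteq> {-pi/2<..<pi/2}" using a by auto
    have "(\<lambda>u. ln M - g u) integrable_on {-pi/2<..<pi/2}"
      by (intro integrable_diff gi) (metis integrable_const_ivl integrable_on_Icc_iff_Ioo)
    then show "(\<lambda>u. ln M - g u) integrable_on {-pi/2<..<pi/2}" .
    have "continuous_on {0..a} (\<lambda>u. ln M - g u)"
      using fc by (rule continuous_on_eq) (use a pg in auto)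
    then show "(\<lambda>u. ln M - g u) integrable_on {0..a}" by (rule integrable_continuous_interval)
    show "\<forall>u\<in>{-pi/2<..<pi/2}. 0 \<le> ln M - g u" using pg p0 by metis
  qed
  also have "\<dots> = pi * ln M - integral {-pi/2<..<pi/2} g"
    by (subst Henstock_Kurzweil_Integration.integral_diff[OF _ gi])
      (auto simp: integral_open_interval_real[symmetric] integrable_on_Icc_iff_Ioo[symmetric])
  also have "\<dots> \<le> pi * (ln M - ln (norm (H (\<i> * of_real b))))"
    using gle h0 by (simp add: right_diff_distrib)
  finally show ?thesis using eq unfolding p_def by simp
qed


text \<open>
  If \<open>H (i b)\<close> were not zero, the Poisson integral of \<open>ln (K / \<bar>H\<bar>)\<close> at \<open>i b\<close> would be finite. It
  dominates the one of \<open>\<theta>\<close>, whose density is comparable to \<open>1 / (1 + t\<^sup>2)\<close> for each fixed \<open>b\<close>. Hence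
  \<open>H\<close> vanishes on the positive imaginary axis and therefore everywhere.
\<close>
lemma log_integral_uniqueness:
  fixes H :: "complex \<Rightarrow> complex" and \<theta> :: "real \<Rightarrow> real"
  assumes hol: "H holomorphic_on UNIV" and bnd: "\<And>z. Im z \<ge> 0 \<Longrightarrow> norm (H z) \<le> M"
    and nn: "\<And>r. r \<ge> 0 \<Longrightarrow> \<theta> r \<ge> 0" and loc: "\<And>R. \<theta> absolutely_integrable_on {0..R}"
    and decay: "\<And>r. r > 0 \<Longrightarrow> norm (H (of_real r)) \<le> C * exp (- \<theta> r)"
    and inf: "(\<integral>\<^sup>+r\<in>{0..}. ennreal (\<theta> r / (1 + r\<^sup>2)) \<partial>lebesgue) = \<infinity>"
  shows "H z = 0"
proof -
  define K where "K = max (max M C) 1"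
  have K: "K \<ge> M" "K \<ge> C" "K \<ge> 1" unfolding K_def by auto
  define \<theta>' where "\<theta>' = (\<lambda>t. if t > 0 then \<theta> t else 0)"
  have \<theta>': "\<theta>' t \<ge> 0" for t unfolding \<theta>'_def using nn by auto
  have zero: "H (\<i> * of_real b) = 0" if b: "b > 0" for b
  proof (rule ccontr)
    assume nz: "H (\<i> * of_real b) \<noteq> 0"
    define D where "D = pi * (ln K - ln (norm (H (\<i> * of_real b))))"
    define q where "q = (\<lambda>t. b / (b\<^sup>2 + t\<^sup>2))"
    have q0: "q t > 0" for t unfolding q_def using b by (simp add: add_pos_nonneg)
    define f where "f = (\<lambda>(n::nat) t. ennreal (q t * min (\<theta>' t) (real n)) * indicator {0..real n} t)"
    have le: "integral\<^sup>N lebesgue (f n) \<le> ennreal D" for n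
    proof -
      \<comment> \<open>At this level the truncated logarithm is at most \<open>ln K - min (\<theta> t) n\<close>.\<close>
      define d where "d = K * exp (- real n)"
      have d: "0 < d" "d \<le> K" unfolding d_def using K by auto
      define p where "p = (\<lambda>t. q t * (ln K - ln (max (norm (H (of_real t))) d)))"
      have I: "integral {0..real n} p \<le> D" unfolding p_def D_def q_def
        by (rule half_plane_log_integral[OF hol _ b nz d]) (use bnd K in \<open>auto intro: order_trans\<close>)
      have "norm (H (of_real t)) \<le> K" for t :: real
        using bnd[of "of_real t"] K by auto
      then have p0: "p t \<ge> 0" for t
        unfolding p_def using q0[of t] d by (intro mult_nonneg_nonneg) auto
      have fp: "q t * min (\<theta>' t) (real n) \<le> p t" for t
      proof (cases "t > 0")
        case True
        have "norm (H (of_real t)) \<le> K * exp (- min (\<theta>' t) (real n))"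
        proof -
          have "norm (H (of_real t)) \<le> C * exp (- \<theta> t)" by (rule decay[OF True])
          also have "\<dots> \<le> K * exp (- min (\<theta>' t) (real n))"
            using K True by (intro mult_mono) (auto simp: \<theta>'_def)
          finally show ?thesis .
        qed
        moreover have "d \<le> K * exp (- min (\<theta>' t) (real n))"
          unfolding d_def using K by (intro mult_left_mono) auto
        ultimately have "ln (max (norm (H (of_real t))) d) \<le> ln (K * exp (- min (\<theta>' t) (real n)))"
          using d K by (subst ln_le_cancel_iff) auto
        also have "\<dots> = ln K - min (\<theta>' t) (real n)" using K by (simp add: ln_mult)
        finally show ?thesis unfolding p_def using q0[of t] by (intro mult_left_mono) auto
      next
        case False
        then show ?thesis using p0[of t] by (simp add: \<theta>'_def)
      qed
      have Hc: "continuous_on UNIV H" using hol by (rule holomorphic_on_imp_continuous_on)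
      have "continuous_on {0..real n} p"
        unfolding p_def q_def using d b
        by (intro continuous_intros continuous_on_compose2[OF Hc]) (auto simp: add_pos_nonneg less_imp_neq[symmetric])
      then have "(p has_integral integral {0..real n} p) {0..real n}"
        by (intro integrable_integral integrable_continuous_interval)
      then have "integral\<^sup>N lborel (\<lambda>t. ennreal (p t) * indicator {0..real n} t) = ennreal (integral {0..real n} p)"
        by (intro nn_integral_has_integral_lebesgue' p0)
      moreover have "integral\<^sup>N lebesgue (\<lambda>t. ennreal (p t) * indicator {0..real n} t)
          = integral\<^sup>N lborel (\<lambda>t. ennreal (p t) * indicator {0..real n} t)"
        by (rule nn_integral_completion)
      moreover have "integral\<^sup>N lebesgue (f n) \<le> integral\<^sup>N lebesgue (\<lambda>t. ennreal (p t) * indicator {0..real n} t)"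
        unfolding f_def using fp by (intro nn_integral_mono mult_right_mono ennreal_leI) auto
      ultimately show ?thesis using I by (metis ennreal_leI order_trans)
    qed
    have meas: "f n \<in> borel_measurable lebesgue" for n
    proof -
      have M0: "(\<lambda>t. indicator {0..real n} t *\<^sub>R \<theta> t) \<in> borel_measurable lebesgue"
        using loc[of "real n"] unfolding set_integrable_def by (rule borel_measurable_integrable)
      then have "(\<lambda>t. indicator {0<..} t * (indicator {0..real n} t *\<^sub>R \<theta> t)) \<in> borel_measurable lebesgue"
        by (intro borel_measurable_times borel_measurable_indicator sets_completionI_sets) auto
      moreover have "q \<in> borel_measurable lebesgue" unfolding q_def
        by (intro measurable_completion) measurable
      ultimately have "(\<lambda>t. ennreal (q t * min (indicator {0<..} t * (indicator {0..real n} t *\<^sub>R \<theta> t)) (real n)) * indicator {0..real n} t)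
          \<in> borel_measurable lebesgue"
        by (intro borel_measurable_times_ennreal measurable_compose[OF _ measurable_ennreal]
            borel_measurable_times borel_measurable_min borel_measurable_indicator borel_measurable_const
            sets_completionI_sets) (use M0 in auto)
      moreover have "(\<lambda>t. ennreal (q t * min (indicator {0<..} t * (indicator {0..real n} t *\<^sub>R \<theta> t)) (real n)) * indicator {0..real n} t) = f n"
        by (auto simp: f_def fun_eq_iff \<theta>'_def indicator_def)
      ultimately show ?thesis by simp
    qed
    have inc: "incseq f"
      unfolding incseq_def le_fun_def f_def
      by (auto intro!: mult_mono ennreal_leI mult_left_mono simp: q0 less_imp_le indicator_def)
    have "(\<integral>\<^sup>+r\<in>{0..}. ennreal (\<theta> r / (1 + r\<^sup>2)) \<partial>lebesgue) = (\<integral>\<^sup>+r\<in>{0..}. ennreal (\<theta>' r / (1 + r\<^sup>2)) \<partial>lebesgue)"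
    proof (rule nn_integral_cong_AE)
      have "AE t in lebesgue. t \<noteq> (0::real)"
        by (intro AE_completion AE_lborel_singleton)
      then show "AE t in lebesgue. ennreal (\<theta> t / (1 + t\<^sup>2)) * indicator {0..} t = ennreal (\<theta>' t / (1 + t\<^sup>2)) * indicator {0..} t"
        by eventually_elim (auto simp: \<theta>'_def indicator_def)
    qed
    also have "\<dots> \<le> (\<integral>\<^sup>+r. ennreal ((1 + b\<^sup>2) / b) * (SUP n. f n r) \<partial>lebesgue)"
    proof (rule nn_integral_mono)
      fix r :: real
      \<comment> \<open>From this index on, neither truncation is effective at \<open>r\<close>.\<close>
      obtain n :: nat where n: "real n \<ge> max r (\<theta>' r)" using real_arch_simple by blast
      have "f n r \<le> (SUP n. f n r)" by (rule SUP_upper) auto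
      moreover have "f n r = ennreal (q r * \<theta>' r) * indicator {0..} r"
        using n by (auto simp: f_def indicator_def min_def)
      moreover have "ennreal (\<theta>' r / (1 + r\<^sup>2)) \<le> ennreal ((1 + b\<^sup>2) / b) * ennreal (q r * \<theta>' r)"
      proof -
        have "b\<^sup>2 + r\<^sup>2 \<le> (1 + b\<^sup>2) * (1 + r\<^sup>2)" by (simp add: algebra_simps)
        moreover have "0 < b\<^sup>2 + r\<^sup>2" "0 < 1 + r\<^sup>2" using b by (auto simp: add_pos_nonneg)
        ultimately have "1 / (1 + r\<^sup>2) \<le> (1 + b\<^sup>2) / (b\<^sup>2 + r\<^sup>2)" by (simp add: field_simps)
        also have "\<dots> = (1 + b\<^sup>2) / b * q r" using b by (simp add: q_def)
        finally have "\<theta>' r * (1 / (1 + r\<^sup>2)) \<le> \<theta>' r * ((1 + b\<^sup>2) / b * q r)"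
          using \<theta>' by (intro mult_left_mono)
        then have "\<theta>' r / (1 + r\<^sup>2) \<le> (1 + b\<^sup>2) / b * (q r * \<theta>' r)" by (simp add: mult_ac)
        then show ?thesis using b q0[of r] \<theta>'[of r]
          by (subst ennreal_mult[symmetric]) (auto intro: ennreal_leI)
      qed
      ultimately show "ennreal (\<theta>' r / (1 + r\<^sup>2)) * indicator {0..} r \<le> ennreal ((1 + b\<^sup>2) / b) * (SUP n. f n r)"
        by (smt (verit, ccfv_threshold) indicator_simps mult.right_neutral mult_zero_right mult_left_mono order_trans zero_le)
    qed
    also have "\<dots> = ennreal ((1 + b\<^sup>2) / b) * (SUP n. integral\<^sup>N lebesgue (f n))"
      using meas by (simp add: nn_integral_cmult nn_integral_monotone_convergence_SUP[OF inc])
    also have "\<dots> \<le> ennreal ((1 + b\<^sup>2) / b) * ennreal D"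
      using le by (intro mult_left_mono SUP_least) auto
    also have "\<dots> < \<infinity>" by (simp add: ennreal_mult_less_top)
    finally show False using inf by simp
  qed
  have "(0::complex) islimpt (\<lambda>b. \<i> * of_real b) ` {0<..}"
    unfolding islimpt_approachable
  proof (intro allI impI)
    fix e :: real assume "e > 0"
    then show "\<exists>x'\<in>(\<lambda>b. \<i> * complex_of_real b) ` {0<..}. x' \<noteq> 0 \<and> dist x' 0 < e"
      by (intro bexI[of _ "\<i> * of_real (e/2)"] conjI imageI) (auto simp: norm_mult)
  qed
  then show ?thesis
    by (rule analytic_continuation[OF hol open_UNIV connected_UNIV, rotated 2]) (use zero in auto)
qed

text \<open>
  As \<open>s\<close> is bounded, the exponential series may be integrated term by term for every \<open>z\<close>, which
  gives an everywhere convergent power series.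
\<close>
lemma holomorphic_fourier_laplace:
  fixes w :: "'a \<Rightarrow> complex" and s :: "'a \<Rightarrow> real"
  assumes w: "integrable m w" and s: "s \<in> borel_measurable m" and R: "\<And>x. \<bar>s x\<bar> \<le> R"
  shows "(\<lambda>z. LINT x|m. exp (\<i> * z * of_real (s x)) * w x) holomorphic_on UNIV"
proof -
  define a where "a = (\<lambda>n. LINT x|m. ((\<i> * of_real (s x)) ^ n / fact n) * w x)"
  have wm: "w \<in> borel_measurable m" using w by auto
  have R0: "R \<ge> 0" using R[of undefined] by linarith
  have sums: "(\<lambda>n. a n * z ^ n) sums (LINT x|m. exp (\<i> * z * of_real (s x)) * w x)" for z
  proof -
    define f where "f = (\<lambda>n x. ((\<i> * z * of_real (s x)) ^ n / fact n) * w x)"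
    define c where "c = norm z * R"
    have fn: "norm (f n x) \<le> (c ^ n / fact n) * norm (w x)" for n x
    proof -
      have "norm (\<i> * z * of_real (s x)) ^ n \<le> c ^ n"
        unfolding c_def using R by (intro power_mono) (auto simp: norm_mult intro!: mult_left_mono)
      then have "norm (\<i> * z * of_real (s x)) ^ n / fact n \<le> c ^ n / fact n"
        by (intro divide_right_mono) auto
      then have "norm (\<i> * z * of_real (s x)) ^ n / fact n * norm (w x) \<le> c ^ n / fact n * norm (w x)"
        by (intro mult_right_mono) auto
      then show ?thesis unfolding f_def by (simp add: norm_mult norm_divide norm_power)
    qed
    have fm: "f n \<in> borel_measurable m" for n unfolding f_def using s wm by measurable
    have fi: "integrable m (f n)" for n
      by (rule Bochner_Integration.integrable_bound[of _ "\<lambda>x. (c ^ n / fact n) * norm (w x)"])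
        (use w fm order_trans[OF fn abs_ge_self] in \<open>auto simp: abs_mult intro!: AE_I2\<close>)
    have sc: "summable (\<lambda>n. c ^ n / fact n)" using summable_exp[of c] by (simp add: field_simps)
    have "(\<lambda>n. integral\<^sup>L m (f n)) sums (LINT x|m. (\<Sum>n. f n x))"
    proof (rule sums_integral[OF fi])
      show "AE x in m. summable (\<lambda>n. norm (f n x))"
        by (intro AE_I2 summable_comparison_test'[OF summable_mult2[OF sc]]) (use fn in auto)
      show "summable (\<lambda>n. LINT x|m. norm (f n x))"
      proof (rule summable_comparison_test'[OF summable_mult2[OF sc]])
        fix n
        have "(LINT x|m. norm (f n x)) \<le> (LINT x|m. (c ^ n / fact n) * norm (w x))"
          using fi w fn by (intro integral_mono integrable_mult_right integrable_norm) auto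
        also have "\<dots> = c ^ n / fact n * (LINT x|m. norm (w x))" by simp
        finally show "norm (LINT x|m. norm (f n x)) \<le> c ^ n / fact n * (LINT x|m. norm (w x))" by simp
      qed
    qed
    moreover have "(\<Sum>n. f n x) = exp (\<i> * z * of_real (s x)) * w x" for x
    proof -
      have "(\<lambda>n. f n x) sums (exp (\<i> * z * of_real (s x)) * w x)"
        unfolding f_def using exp_converges[of "\<i> * z * of_real (s x)"]
        by (intro sums_mult2) (simp add: scaleR_conv_of_real field_simps)
      then show ?thesis by (rule sums_unique[symmetric])
    qed
    moreover have "integral\<^sup>L m (f n) = a n * z ^ n" for n
    proof -
      have "f n = (\<lambda>x. (((\<i> * of_real (s x)) ^ n / fact n) * w x) * z ^ n)"
        unfolding f_def by (simp add: fun_eq_iff power_mult_distrib)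
      then show ?thesis unfolding a_def by simp
    qed
    ultimately show ?thesis by simp
  qed
  have "(\<lambda>z. LINT x|m. exp (\<i> * z * of_real (s x)) * w x) holomorphic_on ball 0 r" for r
    by (rule power_series_holomorphic[of _ _ a]) (use sums in simp)
  then have "(\<lambda>z. LINT x|m. exp (\<i> * z * of_real (s x)) * w x) field_differentiable at z" for z
    by (rule holomorphic_on_imp_differentiable_at[of _ "ball 0 (norm z + 1)"]) auto
  then show ?thesis
    unfolding holomorphic_on_def by (simp add: field_differentiable_at_within)
qed

text \<open>
  The factor \<open>exp (i z R)\<close> shifts the frequencies \<open>s x\<close> into \<open>[0, 2 R]\<close>. This makes the integral
  bounded in the upper half-plane and leaves its modulus on the real axis unchanged.
\<close>
lemma fourier_laplace_zero:
  fixes w :: "'a \<Rightarrow> complex" and s \<theta> :: "_ \<Rightarrow> real"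
  assumes w: "integrable m w" and s: "s \<in> borel_measurable m" and R: "\<And>x. \<bar>s x\<bar> \<le> R"
    and nn: "\<And>r. r \<ge> 0 \<Longrightarrow> \<theta> r \<ge> 0" and loc: "\<And>R. \<theta> absolutely_integrable_on {0..R}"
    and decay: "\<And>r. r > 0 \<Longrightarrow> norm (LINT x|m. exp (\<i> * of_real (r * s x)) * w x) \<le> C * exp (- \<theta> r)"
    and inf: "(\<integral>\<^sup>+r\<in>{0..}. ennreal (\<theta> r / (1 + r\<^sup>2)) \<partial>lebesgue) = \<infinity>"
  shows "(LINT x|m. exp (\<i> * of_real (r * s x)) * w x) = 0"
proof -
  define H where "H = (\<lambda>z. LINT x|m. exp (\<i> * z * of_real (s x + R)) * w x)"
  have hol: "H holomorphic_on UNIV" unfolding H_def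
  proof (rule holomorphic_fourier_laplace[OF w])
    show "(\<lambda>x. s x + R) \<in> borel_measurable m" using s by measurable
    show "\<bar>s x + R\<bar> \<le> 2 * R" for x using R[of x] by (simp add: abs_le_iff)
  qed
  have Hr: "H (of_real r) = exp (\<i> * of_real (r * R)) * (LINT x|m. exp (\<i> * of_real (r * s x)) * w x)" for r
  proof -
    have "\<i> * of_real r * of_real (s x + R) = \<i> * of_real (r * R) + \<i> * of_real (r * s x)" for x
      by (simp add: distrib_left mult.assoc add.commute)
    then have "exp (\<i> * of_real r * of_real (s x + R)) * w x
        = exp (\<i> * of_real (r * R)) * (exp (\<i> * of_real (r * s x)) * w x)" for x
      by (simp only: exp_add mult.assoc)
    then show ?thesis unfolding H_def by (simp only: integral_mult_right_zero)
  qed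
  have "H (of_real r) = 0"
  proof (rule log_integral_uniqueness[OF hol _ nn loc _ inf])
    fix z :: complex assume z: "Im z \<ge> 0"
    show "norm (H z) \<le> (LINT x|m. norm (w x))"
      unfolding H_def
    proof (rule order_trans[OF integral_norm_bound])
      have "norm (exp (\<i> * z * of_real (s x + R)) * w x) \<le> norm (w x)" for x
      proof -
        have "Im z * (s x + R) \<ge> 0" using z R[of x] by (intro mult_nonneg_nonneg) auto
        then have "norm (exp (\<i> * z * of_real (s x + R))) \<le> 1" by (simp add: norm_exp_eq_Re)
        then show ?thesis by (simp add: norm_mult mult_left_le_one_le)
      qed
      then show "(LINT x|m. norm (exp (\<i> * z * of_real (s x + R)) * w x)) \<le> (LINT x|m. norm (w x))"
        using w by (intro integral_mono') auto
    qed
  next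
    fix r :: real assume "r > 0"
    then show "norm (H (of_real r)) \<le> C * exp (- \<theta> r)"
      unfolding Hr using decay[of r] by (simp add: norm_mult)
  qed
  then show ?thesis unfolding Hr by simp
qed

section \<open>Compactly supported functions with prescribed Fourier decay\<close>

text \<open>
  The constants \<open>L\<close> and \<open>B\<close> are recorded because averaging preserves them; a limit of iterated
  averages inherits them.
\<close>
definition bump :: "real \<Rightarrow> real \<Rightarrow> real \<Rightarrow> ('a::euclidean_space \<Rightarrow> real) \<Rightarrow> bool" where
  "bump R L B g \<longleftrightarrow> L-lipschitz_on UNIV g \<and> (\<forall>x. norm x > R \<longrightarrow> g x = 0) \<and> (\<forall>x. \<bar>g x\<bar> \<le> B)"

definition fourier :: "('a::euclidean_space \<Rightarrow> real) \<Rightarrow> 'a \<Rightarrow> complex" where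
  "fourier g \<eta> = (LINT x|lborel. of_real (g x) * exp (\<i> * of_real (\<eta> \<bullet> x)))"

abbreviation unit_interval :: "real measure" where
  "unit_interval \<equiv> restrict_space lborel {0..1}"

definition average :: "'a \<Rightarrow> ('a::euclidean_space \<Rightarrow> real) \<Rightarrow> 'a \<Rightarrow> real" where
  "average v g x = (LINT s|unit_interval. g (x + s *\<^sub>R v))"

text \<open>
  The Fourier transform of the uniform distribution on the unit interval.
\<close>
definition multiplier :: "real \<Rightarrow> complex" where
  "multiplier t = (LINT s|unit_interval. exp (- (\<i> * of_real (s * t))))"

lemma prob_space_unit_interval: "prob_space unit_interval"
  by (rule prob_spaceI) (simp add: emeasure_restrict_space)

interpretation unit_interval: prob_space unit_interval
  by (rule prob_space_unit_interval)

lemma borel_measurable_unit_interval: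
  "f \<in> borel_measurable borel \<Longrightarrow> f \<in> borel_measurable unit_interval"
  by (rule measurable_restrict_space1) simp

lemma bump_continuous: "bump R L B g \<Longrightarrow> continuous_on UNIV g"
  using lipschitz_on_continuous_on unfolding bump_def by blast

lemma integrable_cball_indicator: "integrable lborel (\<lambda>x::'a::euclidean_space. B * indicator (cball 0 R) x :: real)"
  using emeasure_bounded_finite[of "cball (0::'a) R"] by (intro integrable_mult_right integrable_real_indicator) auto

lemma bump_integrand:
  assumes g: "bump R L B g"
  shows "integrable lborel (\<lambda>x. of_real (g x) * exp (\<i> * of_real (\<eta> \<bullet> x)))"
    and "norm (of_real (g x) * exp (\<i> * of_real (\<eta> \<bullet> x))) \<le> B * indicator (cball 0 R) x"
proof -
  have gc: "continuous_on UNIV g" by (rule bump_continuous[OF g])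
  show le: "norm (of_real (g x) * exp (\<i> * of_real (\<eta> \<bullet> x))) \<le> B * indicator (cball 0 R) x" for x
    using g unfolding bump_def by (auto simp: norm_mult indicator_def not_le)
  show "integrable lborel (\<lambda>x. of_real (g x) * exp (\<i> * of_real (\<eta> \<bullet> x)))"
  proof (rule Bochner_Integration.integrable_bound[OF integrable_cball_indicator])
    show "(\<lambda>x. complex_of_real (g x) * exp (\<i> * complex_of_real (\<eta> \<bullet> x))) \<in> borel_measurable lborel"
      using gc by (auto intro!: borel_measurable_continuous_onI continuous_intros)
  qed (auto intro!: AE_I2 order_trans[OF le] abs_ge_self)
qed

lemma integrable_average:
  assumes g: "bump R L B g"
  shows "integrable unit_interval (\<lambda>s. g (x + s *\<^sub>R v))"
proof (rule unit_interval.integrable_const_bound[of _ B])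
  have gc: "continuous_on UNIV g" by (rule bump_continuous[OF g])
  show "(\<lambda>s. g (x + s *\<^sub>R v)) \<in> borel_measurable unit_interval"
    by (intro borel_measurable_unit_interval borel_measurable_continuous_onI continuous_on_compose2[OF gc] continuous_intros) auto
qed (use g in \<open>auto simp: bump_def\<close>)

text \<open>
  Averaging over a segment changes a Lipschitz function by at most \<open>L * norm v\<close>. As the Lipschitz
  constant does not grow, iterated averages converge uniformly when the lengths are summable.
\<close>
lemma bump_average:
  assumes g: "bump R L B g"
  shows "bump (R + norm v) L B (average v g)" "\<bar>average v g x - g x\<bar> \<le> L * norm v"
proof -
  note int = integrable_average[OF g]
  have L: "L \<ge> 0" "\<And>x y. \<bar>g x - g y\<bar> \<le> L * dist x y"
    using g unfolding bump_def lipschitz_on_def by (auto simp: dist_real_def)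
  have sp: "s \<in> {0..1}" if "s \<in> space unit_interval" for s using that by (simp add: space_restrict_space)
  have lip: "\<bar>average v g x - average v g y\<bar> \<le> L * dist x y" for x y
  proof -
    have "\<bar>average v g x - average v g y\<bar> = \<bar>LINT s|unit_interval. g (x + s *\<^sub>R v) - g (y + s *\<^sub>R v)\<bar>"
      unfolding average_def using int by simp
    also have "\<dots> \<le> (LINT s|unit_interval. \<bar>g (x + s *\<^sub>R v) - g (y + s *\<^sub>R v)\<bar>)"
      by (rule integral_abs_bound)
    also have "\<dots> \<le> (LINT s|unit_interval. L * dist x y)"
    proof (rule integral_mono)
      fix s show "\<bar>g (x + s *\<^sub>R v) - g (y + s *\<^sub>R v)\<bar> \<le> L * dist x y"
        using L(2)[of "x + s *\<^sub>R v" "y + s *\<^sub>R v"] by (simp add: dist_norm)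
    qed (use int in auto)
    also have "\<dots> = L * dist x y" using unit_interval.prob_space by simp
    finally show ?thesis .
  qed
  have "average v g x = 0" if x: "norm x > R + norm v" for x
  proof -
    have "g (x + s *\<^sub>R v) = 0" if "s \<in> space unit_interval" for s
    proof -
      have "norm x \<le> norm (x + s *\<^sub>R v) + norm (s *\<^sub>R v)"
        by (metis add_diff_cancel norm_triangle_ineq4)
      moreover have "norm (s *\<^sub>R v) \<le> norm v" using sp[OF that] by (simp add: mult_left_le_one_le)
      ultimately show ?thesis using x g unfolding bump_def by auto
    qed
    then show ?thesis unfolding average_def
      by (subst Bochner_Integration.integral_cong[of _ unit_interval _ "\<lambda>_. 0"]) auto
  qed
  moreover have "\<bar>average v g x\<bar> \<le> B" for x
  proof -
    have "\<bar>average v g x\<bar> \<le> (LINT s|unit_interval. \<bar>g (x + s *\<^sub>R v)\<bar>)"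
      unfolding average_def by (rule integral_abs_bound)
    also have "\<dots> \<le> (LINT s|unit_interval. B)"
      using g int by (intro integral_mono) (auto simp: bump_def)
    also have "\<dots> = B" using unit_interval.prob_space by simp
    finally show ?thesis .
  qed
  ultimately show "bump (R + norm v) L B (average v g)"
    unfolding bump_def lipschitz_on_def using L lip by (auto simp: dist_real_def)
  have "\<bar>average v g x - g x\<bar> = \<bar>LINT s|unit_interval. g (x + s *\<^sub>R v) - g x\<bar>"
    unfolding average_def using int unit_interval.prob_space by simp
  also have "\<dots> \<le> (LINT s|unit_interval. \<bar>g (x + s *\<^sub>R v) - g x\<bar>)"
    by (rule integral_abs_bound)
  also have "\<dots> \<le> (LINT s|unit_interval. L * norm v)"
  proof (rule integral_mono)
    fix s assume s: "s \<in> space unit_interval"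
    have "\<bar>g (x + s *\<^sub>R v) - g x\<bar> \<le> L * norm (s *\<^sub>R v)"
      using L(2)[of "x + s *\<^sub>R v" "x"] by (simp add: dist_norm)
    also have "\<dots> \<le> L * norm v"
      using L(1) sp[OF s] by (intro mult_left_mono) (auto simp: mult_left_le_one_le)
    finally show "\<bar>g (x + s *\<^sub>R v) - g x\<bar> \<le> L * norm v" .
  qed (use int in auto)
  also have "\<dots> = L * norm v" using unit_interval.prob_space by simp
  finally show "\<bar>average v g x - g x\<bar> \<le> L * norm v" .
qed

lemma multiplier_0: "multiplier 0 = 1"
  using unit_interval.prob_space by (simp add: multiplier_def)

lemma norm_multiplier_le_1: "norm (multiplier t) \<le> 1"
proof -
  have "norm (multiplier t) \<le> (LINT s|unit_interval. norm (exp (- (\<i> * complex_of_real (s * t)))))"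
    unfolding multiplier_def by (rule integral_norm_bound)
  also have "\<dots> = 1" using unit_interval.prob_space by (simp add: norm_exp_eq_Re)
  finally show ?thesis .
qed

lemma norm_multiplier_le: "norm (multiplier t) * \<bar>t\<bar> \<le> 2"
proof (cases "t = 0")
  case False
  define F where "F = (\<lambda>s. (\<i> / of_real t) * exp (- (\<i> * of_real (s * t))))"
  have "multiplier t = (LBINT s:{0..1}. exp (- (\<i> * of_real (s * t))))"
    unfolding multiplier_def set_lebesgue_integral_def by (subst integral_restrict_space) auto
  also have "\<dots> = F 1 - F 0"
    unfolding set_lebesgue_integral_def
  proof (rule integral_FTC_atLeastAtMost)
    show "(F has_vector_derivative exp (- (\<i> * complex_of_real (s * t)))) (at s within {0..1})" for s
    proof -
      have "((\<lambda>z. (\<i> / of_real t) * exp (- (\<i> * (z * of_real t)))) has_field_derivative exp (- (\<i> * (of_real s * of_real t)))) (at (of_real s))"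
        by (rule derivative_eq_intros refl | use False in \<open>simp add: field_simps\<close>)+
      from has_vector_derivative_real_field[OF this] show ?thesis
        by (auto simp: F_def o_def intro: has_vector_derivative_at_within)
    qed
  qed (auto intro!: continuous_intros)
  finally have "norm (multiplier t) \<le> norm (F 1) + norm (F 0)" using norm_triangle_ineq4 by metis
  also have "\<dots> = 2 / \<bar>t\<bar>" by (simp add: F_def norm_mult norm_divide norm_exp_eq_Re)
  finally show ?thesis using False by (simp add: field_simps)
qed auto

text \<open>
  The average is a convolution with the uniform distribution on a segment, so its transform is a
  product.
\<close>
lemma fourier_average:
  assumes g: "bump R L B g"
  shows "fourier (average v g) \<eta> = fourier g \<eta> * multiplier (\<eta> \<bullet> v)"
proof -
  have gc: "continuous_on UNIV g" by (rule bump_continuous[OF g])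
  interpret P: pair_sigma_finite unit_interval "lborel :: 'a measure" ..
  define e where "e = (\<lambda>x. exp (\<i> * of_real (\<eta> \<bullet> x)))"
  define f where "f = (\<lambda>s x. of_real (g (x + s *\<^sub>R v)) * e x)"
  have id: "(\<lambda>s. s) \<in> borel_measurable unit_interval" by (rule borel_measurable_unit_interval) simp
  have e1: "norm (e x) = 1" for x by (simp add: e_def norm_exp_eq_Re)
  have fm: "(\<lambda>(s, x). f s x) \<in> borel_measurable (unit_interval \<Otimes>\<^sub>M lborel)"
  proof -
    have "(\<lambda>p. (fst p, snd p)) \<in> (unit_interval \<Otimes>\<^sub>M lborel) \<rightarrow>\<^sub>M (borel \<Otimes>\<^sub>M borel)"
      by (intro measurable_Pair measurable_compose[OF measurable_fst id]
          measurable_compose[OF measurable_snd measurable_ident_sets[OF sets_lborel]])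
    moreover have "continuous_on UNIV (\<lambda>p. f (fst p) (snd p))" unfolding f_def e_def
      by (intro continuous_intros continuous_on_compose2[OF gc]) auto
    then have "(\<lambda>p. f (fst p) (snd p)) \<in> borel_measurable (borel \<Otimes>\<^sub>M borel)"
      unfolding borel_prod by (rule borel_measurable_continuous_onI)
    ultimately have "(\<lambda>p. f (fst (fst p, snd p)) (snd (fst p, snd p))) \<in> borel_measurable (unit_interval \<Otimes>\<^sub>M lborel)"
      by (rule measurable_compose)
    then have "(\<lambda>p. f (fst p) (snd p)) \<in> borel_measurable (unit_interval \<Otimes>\<^sub>M lborel)" by simp
    then show ?thesis by (simp add: case_prod_unfold)
  qed
  have shift: "(LINT x|lborel. f s x) = fourier g \<eta> * exp (- (\<i> * of_real (s * (\<eta> \<bullet> v))))" for s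
  proof -
    have fs: "f s ((- s *\<^sub>R v) + x) = of_real (g x) * e x * exp (- (\<i> * of_real (s * (\<eta> \<bullet> v))))" for x
    proof -
      have "\<i> * complex_of_real (\<eta> \<bullet> ((- s *\<^sub>R v) + x)) = \<i> * of_real (\<eta> \<bullet> x) + - (\<i> * of_real (s * (\<eta> \<bullet> v)))"
        by (simp add: inner_add_right algebra_simps)
      then have "e ((- s *\<^sub>R v) + x) = e x * exp (- (\<i> * of_real (s * (\<eta> \<bullet> v))))"
        unfolding e_def by (simp only: exp_add)
      moreover have "(- s *\<^sub>R v) + x + s *\<^sub>R v = x" by simp
      ultimately show ?thesis unfolding f_def by (simp only: mult.assoc)
    qed
    have "(LINT x|lborel. f s x) = (LINT x|lborel. f s ((- s *\<^sub>R v) + x))"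
    proof -
      have "f s \<in> borel_measurable borel" unfolding f_def e_def
        by (intro borel_measurable_continuous_onI continuous_intros continuous_on_compose2[OF gc]) auto
      then have "(LINT x|distr lborel borel ((+) (- s *\<^sub>R v)). f s x) = (LINT x|lborel. f s ((- s *\<^sub>R v) + x))"
        by (intro integral_distr) auto
      then show ?thesis by (simp only: lborel_distr_plus)
    qed
    also have "\<dots> = (LINT x|lborel. of_real (g x) * e x * exp (- (\<i> * of_real (s * (\<eta> \<bullet> v)))))"
      by (simp only: fs)
    finally show ?thesis by (simp add: fourier_def e_def)
  qed
  have fi: "integrable (unit_interval \<Otimes>\<^sub>M lborel) (\<lambda>(s, x). f s x)"
  proof (rule Bochner_Integration.integrable_bound[OF _ fm])
    let ?S = "{0..1} \<times> cball (0::'a) (R + norm v)"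
    show "integrable (unit_interval \<Otimes>\<^sub>M lborel) (\<lambda>p. B * indicator ?S p)"
    proof (intro integrable_mult_right integrable_real_indicator)
      have I: "{0..1} \<in> sets unit_interval" by (metis sets.top space_restrict_space2 space_restrict_space sets_lborel atLeastAtMost_borel)
      show "?S \<in> sets (unit_interval \<Otimes>\<^sub>M lborel)" using I by (intro pair_measureI) auto
      have "emeasure (unit_interval \<Otimes>\<^sub>M lborel) ?S = emeasure unit_interval {0..1} * emeasure lborel (cball (0::'a) (R + norm v))"
        using I by (intro lborel.emeasure_pair_measure_Times) auto
      also have "\<dots> < \<infinity>"
        using emeasure_bounded_finite[of "cball (0::'a) (R + norm v)"]
        by (simp add: ennreal_mult_less_top emeasure_restrict_space)
      finally show "emeasure (unit_interval \<Otimes>\<^sub>M lborel) ?S < \<infinity>" .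
    qed
    show "AE p in unit_interval \<Otimes>\<^sub>M lborel. norm (case p of (s, x) \<Rightarrow> f s x) \<le> norm (B * indicator ?S p)"
    proof (rule AE_I2, clarify)
      fix s x assume "(s, x) \<in> space (unit_interval \<Otimes>\<^sub>M (lborel::'a measure))"
      then have s: "s \<in> {0..1}" by (simp add: space_pair_measure space_restrict_space)
      have "norm x \<le> norm (x + s *\<^sub>R v) + norm (s *\<^sub>R v)"
        by (metis add_diff_cancel norm_triangle_ineq4)
      moreover have "norm (s *\<^sub>R v) \<le> norm v" using s by (simp add: mult_left_le_one_le)
      ultimately have "g (x + s *\<^sub>R v) = 0" if "norm x > R + norm v" using that g unfolding bump_def by auto
      moreover have "\<bar>g (x + s *\<^sub>R v)\<bar> \<le> B" using g unfolding bump_def by auto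
      ultimately show "norm (f s x) \<le> norm (B * indicator ?S (s, x))"
        using s by (auto simp: f_def norm_mult e1 indicator_def not_le)
    qed
  qed
  have "fourier (average v g) \<eta> = (LINT x|lborel. LINT s|unit_interval. f s x)"
    unfolding fourier_def average_def f_def by (simp add: integral_complex_of_real e_def)
  also have "\<dots> = (LINT s|unit_interval. LINT x|lborel. f s x)"
    using P.Fubini_integral[OF fi] by simp
  also have "\<dots> = fourier g \<eta> * multiplier (\<eta> \<bullet> v)"
    unfolding shift multiplier_def by simp
  finally show ?thesis .
qed

text \<open>
  An infinite convolution: the partial averages form a Cauchy sequence with supports in a fixed
  ball, so their Fourier transforms converge. Each further factor has modulus at most 1, which
  leaves the bound by the first \<open>N\<close> factors intact in the limit.
\<close>
lemma iterated_average_limit: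
  fixes h :: "'a::euclidean_space \<Rightarrow> real" and v :: "nat \<Rightarrow> 'a"
  assumes h: "bump R L B h" and v: "summable (\<lambda>k. norm (v k))"
  shows "\<exists>g R'. bump R' L B g \<and> fourier g 0 = fourier h 0 \<and>
    (\<forall>\<eta> N. norm (fourier g \<eta>) \<le> norm (fourier h \<eta>) * (\<Prod>k<N. norm (multiplier (\<eta> \<bullet> v k))))"
proof -
  define G where "G = rec_nat h (\<lambda>k g. average (v k) g)"
  have G0: "G 0 = h" and GS: "G (Suc k) = average (v k) (G k)" for k by (simp_all add: G_def)
  have Gb: "bump (R + (\<Sum>j<k. norm (v j))) L B (G k)" for k
    by (induction k) (use h bump_average in \<open>auto simp: G0 GS add.assoc[symmetric]\<close>)
  define R' where "R' = R + (\<Sum>j. norm (v j))"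
  have Gb': "bump R' L B (G k)" for k
  proof -
    have "(\<Sum>j<k. norm (v j)) \<le> (\<Sum>j. norm (v j))" using v by (intro sum_le_suminf) auto
    then show ?thesis using Gb[of k] unfolding bump_def R'_def by auto
  qed
  have "convergent (\<lambda>k. G k x)" for x
  proof -
    have "summable (\<lambda>k. G (Suc k) x - G k x)"
    proof (rule summable_comparison_test'[OF summable_mult[OF v]])
      show "norm (G (Suc k) x - G k x) \<le> L * norm (v k)" for k
        using bump_average(2)[OF Gb] by (simp add: GS)
    qed
    then have "(\<lambda>n. \<Sum>k<n. G (Suc k) x - G k x) \<longlonglongrightarrow> (\<Sum>k. G (Suc k) x - G k x)" by (rule summable_LIMSEQ)
    moreover have "(\<Sum>k<n. G (Suc k) x - G k x) = G n x - G 0 x" for n by (induction n) auto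
    ultimately have "(\<lambda>n. (G n x - G 0 x) + G 0 x) \<longlonglongrightarrow> (\<Sum>k. G (Suc k) x - G k x) + G 0 x"
      by (intro tendsto_add tendsto_const) simp
    then show ?thesis by (auto simp: convergent_def)
  qed
  then obtain g where g: "(\<lambda>k. G k x) \<longlonglongrightarrow> g x" for x
    unfolding convergent_def by metis
  have gb: "bump R' L B g"
    unfolding bump_def lipschitz_on_def
  proof (intro conjI ballI allI impI)
    show "0 \<le> L" using h by (auto simp: bump_def lipschitz_on_def)
    show "dist (g x) (g y) \<le> L * dist x y" for x y
      using Gb' by (intro LIMSEQ_le_const2[OF tendsto_dist[OF g g]]) (auto simp: bump_def lipschitz_on_def)
    show "g x = 0" if "R' < norm x" for x
    proof -
      have "G k x = 0" for k using Gb'[of k] that by (auto simp: bump_def)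
      then show ?thesis using g[of x] by (simp add: LIMSEQ_const_iff)
    qed
    show "\<bar>g x\<bar> \<le> B" for x
      using Gb' by (intro LIMSEQ_le_const2[OF tendsto_rabs[OF g]]) (auto simp: bump_def)
  qed
  have lim: "(\<lambda>k. fourier (G k) \<eta>) \<longlonglongrightarrow> fourier g \<eta>" for \<eta>
    unfolding fourier_def
  proof (rule integral_dominated_convergence[where w = "\<lambda>x. B * indicator (cball 0 R') x"])
    show "integrable lborel (\<lambda>x::'a. B * indicator (cball 0 R') x)" by (rule integrable_cball_indicator)
    show "AE x in lborel. (\<lambda>k. complex_of_real (G k x) * exp (\<i> * complex_of_real (\<eta> \<bullet> x))) \<longlonglongrightarrow> complex_of_real (g x) * exp (\<i> * complex_of_real (\<eta> \<bullet> x))"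
      by (intro AE_I2 tendsto_intros g)
  qed (use bump_integrand[OF Gb'] bump_integrand[OF gb] in \<open>auto simp del: norm_mult intro!: borel_measurable_integrable\<close>)
  have GF: "fourier (G k) \<eta> = fourier h \<eta> * (\<Prod>j<k. multiplier (\<eta> \<bullet> v j))" for k \<eta>
    by (induction k) (simp_all add: G0 GS fourier_average[OF Gb'])
  have "fourier g 0 = fourier h 0"
    using lim[of 0] by (simp add: GF multiplier_0 LIMSEQ_const_iff)
  moreover have "norm (fourier g \<eta>) \<le> norm (fourier h \<eta>) * (\<Prod>k<N. norm (multiplier (\<eta> \<bullet> v k)))" for \<eta> N
  proof (rule LIMSEQ_le_const2[OF tendsto_norm[OF lim]], intro exI allI impI)
    fix k assume "k \<ge> N"
    then have "(\<Prod>j<k. norm (multiplier (\<eta> \<bullet> v j))) \<le> (\<Prod>j<N. norm (multiplier (\<eta> \<bullet> v j)))"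
    proof (induction k rule: dec_induct)
      case (step k)
      have "(\<Prod>j<Suc k. norm (multiplier (\<eta> \<bullet> v j))) \<le> (\<Prod>j<k. norm (multiplier (\<eta> \<bullet> v j))) * 1"
        unfolding prod.lessThan_Suc by (intro mult_left_mono norm_multiplier_le_1 prod_nonneg) auto
      then show ?case using step.IH by simp
    qed simp
    then show "norm (fourier (G k) \<eta>) \<le> norm (fourier h \<eta>) * (\<Prod>k<N. norm (multiplier (\<eta> \<bullet> v k)))"
      unfolding GF norm_mult prod_norm[symmetric] by (intro mult_left_mono) auto
  qed
  ultimately show ?thesis using gb by blast
qed


lemma nn_integral_inverse_square:
  assumes "a > 0"
  shows "(\<integral>\<^sup>+t\<in>{a..}. ennreal (1 / t\<^sup>2) \<partial>lborel) = ennreal (1 / a)"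
proof -
  have "(\<integral>\<^sup>+t. ennreal (1 / t\<^sup>2) * indicator {a..} t \<partial>lborel) = 0 - (- (1 / a))"
  proof (rule nn_integral_FTC_atLeast)
    show "((\<lambda>t. - (1 / t)) has_real_derivative 1 / t\<^sup>2) (at t)" if "a \<le> t" for t
      by (rule derivative_eq_intros refl | use that assms in \<open>simp add: power2_eq_square\<close>)+
    show "((\<lambda>t::real. - (1 / t)) \<longlongrightarrow> 0) at_top"
      using tendsto_minus[OF tendsto_inverse_0_at_top[OF filterlim_ident]] by (simp add: inverse_eq_divide)
  qed auto
  then show ?thesis by simp
qed

text \<open>
  Take \<open>\<rho> k = c \<integral> t\<^bsup>-2\<^esup> dt\<close> over the half-line where \<open>t \<ge> 1\<close> and \<open>\<theta> t > k\<close>. Summing over \<open>k\<close> under the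
  integral counts the \<open>k\<close> below \<open>\<theta> t\<close>, so the total is at most \<open>c \<integral>\<^sub>1\<^sup>\<infinity> (\<theta> t + 1) t\<^bsup>-2\<^esup> dt\<close>. If \<open>k < \<theta> y\<close>,
  monotonicity puts \<open>[y, \<infinity>)\<close> into that half-line, so \<open>\<rho> k \<ge> c / y\<close>.
\<close>
lemma widths_from_log_integral:
  fixes \<theta> :: "real \<Rightarrow> real"
  assumes nn: "\<And>r. r \<ge> 0 \<Longrightarrow> \<theta> r \<ge> 0" and mono: "mono_on {0..} \<theta>" and c: "c \<ge> 0"
    and fin: "(\<integral>\<^sup>+r\<in>{0..}. ennreal (\<theta> r / (1 + r\<^sup>2)) \<partial>lebesgue) < \<infinity>"
  shows "\<exists>\<rho>::nat \<Rightarrow> real. (\<forall>k. \<rho> k \<ge> 0) \<and> summable \<rho> \<and> (\<forall>k y. y \<ge> 1 \<and> real k < \<theta> y \<longrightarrow> c \<le> \<rho> k * y)"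
proof -
  define S where "S = (\<lambda>k::nat. {t. t \<ge> 1 \<and> real k < \<theta> t})"
  have S: "S k \<in> sets borel" for k
  proof -
    have "\<theta> \<in> borel_measurable (restrict_space borel {0..})"
      by (rule borel_measurable_mono_on_fnc[OF mono])
    then have "{t \<in> space (restrict_space borel {0..}). real k < \<theta> t} \<in> sets (restrict_space borel {0..})"
      by measurable
    then have "{t \<in> {0..}. real k < \<theta> t} \<in> sets borel"
      by (simp add: space_restrict_space sets_restrict_space_iff)
    then have "{t \<in> {0..}. real k < \<theta> t} \<inter> {1..} \<in> sets borel" by (intro sets.Int) auto
    also have "{t \<in> {0..}. real k < \<theta> t} \<inter> {1..} = S k" unfolding S_def by auto
    finally show ?thesis .
  qed
  have "(\<lambda>t. \<theta> t / (1 + t\<^sup>2)) \<in> borel_measurable (restrict_space borel {0..})"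
    by (intro borel_measurable_divide borel_measurable_mono_on_fnc[OF mono] measurable_restrict_space1) measurable
  then have "(\<lambda>t. (\<theta> t / (1 + t\<^sup>2)) * indicator {0..} t) \<in> borel_measurable borel"
    by (subst (asm) borel_measurable_restrict_space_iff) (auto simp: mult.commute)
  then have "(\<lambda>t. ennreal ((\<theta> t / (1 + t\<^sup>2)) * indicator {0..} t)) \<in> borel_measurable lborel" by measurable
  also have "(\<lambda>t. ennreal ((\<theta> t / (1 + t\<^sup>2)) * indicator {0..} t)) = (\<lambda>t. ennreal (\<theta> t / (1 + t\<^sup>2)) * indicator {0..} t)"
    by (auto simp: fun_eq_iff indicator_def)
  finally have meas: "(\<lambda>t. ennreal (\<theta> t / (1 + t\<^sup>2)) * indicator {0..} t) \<in> borel_measurable lborel" .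
  define nu where "nu = (\<lambda>k. \<integral>\<^sup>+t. ennreal (1 / t\<^sup>2) * indicator (S k) t \<partial>lborel)"
  have sum_nu: "(\<Sum>k. nu k) < \<infinity>"
  proof -
    have "(\<Sum>k. nu k) = (\<integral>\<^sup>+t. (\<Sum>k. ennreal (1 / t\<^sup>2) * indicator (S k) t) \<partial>lborel)"
      unfolding nu_def using S
      by (intro nn_integral_suminf[symmetric] borel_measurable_times_ennreal borel_measurable_indicator) auto
    also have "\<dots> \<le> (\<integral>\<^sup>+t. 2 * (ennreal (\<theta> t / (1 + t\<^sup>2)) * indicator {0..} t) + ennreal (1 / t\<^sup>2) * indicator {1..} t \<partial>lborel)"
    proof (rule nn_integral_mono)
      fix t :: real
      show "(\<Sum>k. ennreal (1 / t\<^sup>2) * indicator (S k) t) \<le> 2 * (ennreal (\<theta> t / (1 + t\<^sup>2)) * indicator {0..} t) + ennreal (1 / t\<^sup>2) * indicator {1..} t"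
      proof (cases "t \<ge> 1")
        case True
        have th: "\<theta> t \<ge> 0" using nn True by auto
        have "(\<Sum>k<n. ennreal (1 / t\<^sup>2) * indicator (S k) t) \<le> ennreal (1 / t\<^sup>2) * ennreal (\<theta> t + 1)" for n
        proof -
          have "card {k\<in>{..<n}. t \<in> S k} \<le> card {..nat \<lfloor>\<theta> t\<rfloor>}"
            by (rule card_mono) (auto simp: S_def le_nat_iff le_floor_iff)
          then have "real (card {k\<in>{..<n}. t \<in> S k}) \<le> real (Suc (nat \<lfloor>\<theta> t\<rfloor>))"
            unfolding card_atMost by (rule of_nat_mono)
          also have "\<dots> \<le> \<theta> t + 1" using of_nat_floor[OF th] by simp
          finally have cb: "of_nat (card {k\<in>{..<n}. t \<in> S k}) \<le> ennreal (\<theta> t + 1)"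
            unfolding ennreal_of_nat_eq_real_of_nat by (rule ennreal_leI)
          have "(\<Sum>k<n. ennreal (1 / t\<^sup>2) * indicator (S k) t) = ennreal (1 / t\<^sup>2) * (\<Sum>k<n. indicator (S k) t)"
            by (simp add: sum_distrib_left)
          also have "(\<Sum>k<n. indicator (S k) t :: ennreal) = of_nat (card {k\<in>{..<n}. t \<in> S k})"
            by (simp add: indicator_def sum.If_cases Int_def)
          also have "ennreal (1 / t\<^sup>2) * of_nat (card {k\<in>{..<n}. t \<in> S k}) \<le> ennreal (1 / t\<^sup>2) * ennreal (\<theta> t + 1)"
            by (rule mult_left_mono[OF cb]) simp
          finally show ?thesis .
        qed
        then have "(\<Sum>k. ennreal (1 / t\<^sup>2) * indicator (S k) t) \<le> ennreal (1 / t\<^sup>2) * ennreal (\<theta> t + 1)"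
          unfolding suminf_eq_SUP by (intro SUP_least) auto
        also have "\<dots> = ennreal (\<theta> t / t\<^sup>2 + 1 / t\<^sup>2)"
          using th by (simp add: ennreal_mult[symmetric] add_divide_distrib del: ennreal_plus)
        also have "\<dots> \<le> ennreal (2 * (\<theta> t / (1 + t\<^sup>2)) + 1 / t\<^sup>2)"
        proof (intro ennreal_leI add_right_mono)
          have "1 \<le> t\<^sup>2" using True by (simp add: one_le_power)
          then have "2 / (2 * t\<^sup>2) \<le> 2 / (1 + t\<^sup>2)" by (intro divide_left_mono mult_pos_pos) auto
          then have "1 / t\<^sup>2 \<le> 2 / (1 + t\<^sup>2)" by simp
          then have "\<theta> t * (1 / t\<^sup>2) \<le> \<theta> t * (2 / (1 + t\<^sup>2))" using th by (rule mult_left_mono)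
          then show "\<theta> t / t\<^sup>2 \<le> 2 * (\<theta> t / (1 + t\<^sup>2))" by (simp add: mult.commute)
        qed
        also have "\<dots> = 2 * (ennreal (\<theta> t / (1 + t\<^sup>2)) * indicator {0..} t) + ennreal (1 / t\<^sup>2) * indicator {1..} t"
        proof -
          have "ennreal (2 * a + b) = 2 * ennreal a + ennreal b" if "a \<ge> 0" "b \<ge> 0" for a b
            using that by (simp add: ennreal_plus ennreal_mult')
          from this[of "\<theta> t / (1 + t\<^sup>2)" "1 / t\<^sup>2"] show ?thesis using True th by simp
        qed
        finally show ?thesis .
      qed (simp add: S_def)
    qed
    also have "\<dots> = 2 * (\<integral>\<^sup>+t\<in>{0..}. ennreal (\<theta> t / (1 + t\<^sup>2)) \<partial>lborel)
        + (\<integral>\<^sup>+t\<in>{1..}. ennreal (1 / t\<^sup>2) \<partial>lborel)"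
      using meas by (simp add: nn_integral_add nn_integral_cmult)
    also have "(\<integral>\<^sup>+t\<in>{1..}. ennreal (1 / t\<^sup>2) \<partial>lborel) = ennreal (1 / 1)"
      by (rule nn_integral_inverse_square) simp
    also have "2 * (\<integral>\<^sup>+t\<in>{0..}. ennreal (\<theta> t / (1 + t\<^sup>2)) \<partial>lborel) + ennreal (1 / 1) < \<infinity>"
      using fin unfolding nn_integral_completion by (simp add: ennreal_mult_less_top)
    finally show ?thesis .
  qed
  define \<rho> where "\<rho> = (\<lambda>k. c * enn2real (nu k))"
  have nu_fin: "nu k \<noteq> \<infinity>" for k
    using sum_nu ennreal_suminf_lessD by (metis less_irrefl infinity_ennreal_def)
  have "summable (\<lambda>k. enn2real (nu k))"
  proof (rule summable_suminf_not_top)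
    have "(\<Sum>k. ennreal (enn2real (nu k))) = (\<Sum>k. nu k)"
      using nu_fin by (intro suminf_cong) (simp add: less_top)
    then show "(\<Sum>k. ennreal (enn2real (nu k))) \<noteq> top_class.top" using sum_nu by simp
  qed auto
  then have "summable \<rho>" unfolding \<rho>_def by (rule summable_mult)
  moreover have "c \<le> \<rho> k * y" if y: "y \<ge> 1" "real k < \<theta> y" for k y
  proof -
    have "{y..} \<subseteq> S k"
      using y mono_onD[OF mono, of y] unfolding S_def by force
    then have "(\<integral>\<^sup>+t\<in>{y..}. ennreal (1 / t\<^sup>2) \<partial>lborel) \<le> nu k"
      unfolding nu_def by (intro nn_integral_mono mult_left_mono) (auto simp: indicator_def)
    then have "ennreal (1 / y) \<le> nu k" using y by (simp add: nn_integral_inverse_square)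
    then have "1 / y \<le> enn2real (nu k)"
      using nu_fin[of k] by (metis enn2real_ennreal enn2real_mono divide_nonneg_nonneg infinity_ennreal_def less_top order_trans y(1) zero_le_one)
    then have "c * (1 / y * y) \<le> c * (enn2real (nu k) * y)"
      using c y by (intro mult_left_mono mult_right_mono) auto
    then show ?thesis using y by (simp add: \<rho>_def mult.assoc)
  qed
  ultimately show ?thesis using c by (intro exI[of _ \<rho>]) (auto simp: \<rho>_def)
qed

lemma bump_tent: "bump 1 1 1 (\<lambda>x::'a::euclidean_space. max 0 (1 - norm x))"
proof -
  have "\<bar>max 0 (1 - norm x) - max 0 (1 - norm y)\<bar> \<le> norm (x - y)" for x y :: 'a
    using norm_triangle_ineq3[of x y] by linarith
  then show ?thesis by (auto simp: bump_def lipschitz_on_def dist_norm)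
qed

lemma fourier_tent: "fourier (\<lambda>x::'a::euclidean_space. max 0 (1 - norm x)) 0 \<noteq> 0"
proof -
  have "0 < 1/2 * measure lborel (ball (0::'a) (1/2))"
    using content_ball_pos[of "1/2" "0::'a"] by simp
  also have "\<dots> = (LINT x|lborel. 1/2 * indicator (ball (0::'a) (1/2)) x :: real)" by simp
  also have "\<dots> \<le> (LINT x|lborel. max 0 (1 - norm (x::'a)))"
  proof (rule integral_mono)
    show "integrable lborel (\<lambda>x::'a. 1/2 * indicator (ball (0::'a) (1/2)) x :: real)"
      using emeasure_bounded_finite[of "ball (0::'a) (1/2)"] by (intro integrable_mult_right integrable_real_indicator) auto
    show "integrable lborel (\<lambda>x::'a. max 0 (1 - norm x))"
      using bump_integrand(1)[OF bump_tent, of 0] by (simp add: complex_of_real_integrable_eq)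
  qed (auto simp: indicator_def)
  finally show ?thesis by (simp add: fourier_def integral_complex_of_real)
qed

text \<open>
  The segments are taken in all coordinate directions, one direction after the other, because some
  coordinate of \<open>\<eta>\<close> is comparable to its norm; the factors for that coordinate give the decay.
\<close>
lemma bump_with_prescribed_decay:
  fixes \<theta> :: "real \<Rightarrow> real"
  assumes nn: "\<And>r. r \<ge> 0 \<Longrightarrow> \<theta> r \<ge> 0" and mono: "mono_on {0..} \<theta>"
    and fin: "(\<integral>\<^sup>+r\<in>{0..}. ennreal (\<theta> r / (1 + r\<^sup>2)) \<partial>lebesgue) < \<infinity>"
  shows "\<exists>(g :: 'a::euclidean_space \<Rightarrow> real) R L B C. bump R L B g \<and> (\<exists>x. g x \<noteq> 0) \<and> C > 0 \<and>
     (\<forall>\<eta>. norm (fourier g \<eta>) \<le> C * exp (- \<theta> (norm \<eta>)))"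
proof -
  \<comment> \<open>With \<open>\<bar>\<eta> \<bullet> b\<bar> \<ge> norm \<eta> / DIM\<close> for some \<open>b\<close>, this constant makes the multipliers at most \<open>1 / e\<close>.\<close>
  define c where "c = 2 * exp 1 * real DIM('a)"
  have c: "c \<ge> 0" by (simp add: c_def)
  obtain \<rho> :: "nat \<Rightarrow> real" where \<rho>: "\<And>k. \<rho> k \<ge> 0" "summable \<rho>" "\<And>k y. y \<ge> 1 \<Longrightarrow> real k < \<theta> y \<Longrightarrow> c \<le> \<rho> k * y"
    using widths_from_log_integral[OF nn mono c fin] by blast
  define h where "h = (\<lambda>x::'a. max 0 (1 - norm x))"
  have "\<exists>g R. bump R 1 1 g \<and> fourier g 0 = fourier h 0 \<and> (\<forall>\<eta>. norm (fourier g \<eta>) \<le> norm (fourier h \<eta>)) \<and>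
     (\<forall>b\<in>S. \<forall>\<eta> N. norm (fourier g \<eta>) \<le> norm (fourier h \<eta>) * (\<Prod>k<N. norm (multiplier (\<eta> \<bullet> (\<rho> k *\<^sub>R b)))))"
    if "finite S" "S \<subseteq> Basis" for S
    using that
  proof (induction S rule: finite_induct)
    case empty
    then show ?case using bump_tent unfolding h_def by blast
  next
    case (insert b S)
    then obtain g R where g: "bump R 1 1 g" "fourier g 0 = fourier h 0" "\<And>\<eta>. norm (fourier g \<eta>) \<le> norm (fourier h \<eta>)"
     "\<And>b \<eta> N. b \<in> S \<Longrightarrow> norm (fourier g \<eta>) \<le> norm (fourier h \<eta>) * (\<Prod>k<N. norm (multiplier (\<eta> \<bullet> (\<rho> k *\<^sub>R b))))"
      by auto
    have "summable (\<lambda>k. norm (\<rho> k *\<^sub>R b))" using \<rho> insert by simp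
    from iterated_average_limit[OF g(1) this] obtain g' R' where
      g': "bump R' 1 1 g'" "fourier g' 0 = fourier g 0"
       "\<And>\<eta> N. norm (fourier g' \<eta>) \<le> norm (fourier g \<eta>) * (\<Prod>k<N. norm (multiplier (\<eta> \<bullet> (\<rho> k *\<^sub>R b))))"
      by blast
    have le: "norm (fourier g' \<eta>) \<le> norm (fourier g \<eta>)" for \<eta> using g'(3)[of \<eta> 0] by simp
    show ?case
    proof (intro exI[of _ g'] exI[of _ R'] conjI ballI allI)
      show "norm (fourier g' \<eta>) \<le> norm (fourier h \<eta>)" for \<eta> using le g(3) order_trans by blast
      fix b' \<eta> N assume "b' \<in> insert b S"
      then show "norm (fourier g' \<eta>) \<le> norm (fourier h \<eta>) * (\<Prod>k<N. norm (multiplier (\<eta> \<bullet> (\<rho> k *\<^sub>R b'))))"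
      proof
        assume "b' = b"
        moreover have "norm (fourier g \<eta>) * (\<Prod>k<N. norm (multiplier (\<eta> \<bullet> (\<rho> k *\<^sub>R b))))
            \<le> norm (fourier h \<eta>) * (\<Prod>k<N. norm (multiplier (\<eta> \<bullet> (\<rho> k *\<^sub>R b))))"
          by (intro mult_right_mono g prod_nonneg) auto
        ultimately show ?thesis using g'(3)[of \<eta> N] by simp
      next
        assume "b' \<in> S" then show ?thesis using g(4) le order_trans by blast
      qed
    qed (use g g' in auto)
  qed
  from this[OF finite_Basis order_refl] obtain g R where g: "bump R 1 1 g" "fourier g 0 = fourier h 0"
     "\<And>\<eta>. norm (fourier g \<eta>) \<le> norm (fourier h \<eta>)"
     "\<And>b \<eta> N. b \<in> Basis \<Longrightarrow> norm (fourier g \<eta>) \<le> norm (fourier h \<eta>) * (\<Prod>k<N. norm (multiplier (\<eta> \<bullet> (\<rho> k *\<^sub>R b))))"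
    by blast
  define A where "A = (LINT x|lborel. 1 * indicator (cball 0 1) (x::'a) :: real)"
  have hb: "bump 1 1 1 h" unfolding h_def by (rule bump_tent)
  have hA: "norm (fourier h \<eta>) \<le> A" for \<eta>
    unfolding fourier_def A_def
  proof (rule order_trans[OF integral_norm_bound integral_mono])
    show "integrable lborel (\<lambda>x::'a. 1 * indicator (cball 0 1) x :: real)" by (rule integrable_cball_indicator)
  qed (use bump_integrand[OF hb] in auto)
  have A0: "A \<ge> 0" using hA[of 0] norm_ge_zero order_trans by blast
  have "norm (fourier g \<eta>) \<le> (A + 1) * exp (\<theta> 1) * exp (- \<theta> (norm \<eta>))" for \<eta>
  proof (cases "norm \<eta> \<ge> 1")
    case False
    then have "\<theta> (norm \<eta>) \<le> \<theta> 1" by (intro mono_onD[OF mono]) auto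
    then have "(A + 1) * 1 \<le> (A + 1) * (exp (\<theta> 1) * exp (- \<theta> (norm \<eta>)))"
      using A0 by (intro mult_left_mono) (auto simp: exp_add[symmetric])
    then show ?thesis using g(3)[of \<eta>] hA[of \<eta>] by (simp add: mult.assoc)
  next
    case True
    obtain b where b: "b \<in> Basis" "norm \<eta> \<le> real DIM('a) * \<bar>\<eta> \<bullet> b\<bar>"
    proof (rule ccontr)
      assume "\<not> thesis"
      then have "\<And>b. b \<in> Basis \<Longrightarrow> \<bar>\<eta> \<bullet> b\<bar> < norm \<eta> / real DIM('a)"
        using that by (force simp: field_simps not_le)
      then have "(\<Sum>b\<in>Basis. \<bar>\<eta> \<bullet> b\<bar>) < (\<Sum>b\<in>(Basis::'a set). norm \<eta> / real DIM('a))"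
        by (intro sum_strict_mono) auto
      then show False using norm_le_l1[of \<eta>] by simp
    qed
    define N where "N = nat \<lceil>\<theta> (norm \<eta>)\<rceil>"
    have "norm (multiplier (\<eta> \<bullet> (\<rho> k *\<^sub>R b))) \<le> exp (-1)" if "k < N" for k
    proof -
      have "real k < \<theta> (norm \<eta>)" using that unfolding N_def by linarith
      then have "c \<le> \<rho> k * norm \<eta>" using \<rho>(3) True by blast
      also have "\<dots> \<le> \<rho> k * (real DIM('a) * \<bar>\<eta> \<bullet> b\<bar>)" using \<rho>(1) b by (intro mult_left_mono) auto
      also have "\<dots> = real DIM('a) * \<bar>\<eta> \<bullet> (\<rho> k *\<^sub>R b)\<bar>" using \<rho>(1)[of k] by (simp add: abs_mult)
      finally have "real DIM('a) * (2 * exp 1) \<le> real DIM('a) * \<bar>\<eta> \<bullet> (\<rho> k *\<^sub>R b)\<bar>" unfolding c_def by (simp add: mult_ac)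
      then have t: "2 * exp 1 \<le> \<bar>\<eta> \<bullet> (\<rho> k *\<^sub>R b)\<bar>" by (simp del: inner_scaleR_right)
      have "norm (multiplier (\<eta> \<bullet> (\<rho> k *\<^sub>R b))) * (2 * exp 1) \<le> norm (multiplier (\<eta> \<bullet> (\<rho> k *\<^sub>R b))) * \<bar>\<eta> \<bullet> (\<rho> k *\<^sub>R b)\<bar>"
        by (intro mult_left_mono t) auto
      also have "\<dots> \<le> 2" by (rule norm_multiplier_le)
      finally show ?thesis by (simp add: exp_minus field_simps)
    qed
    then have "(\<Prod>k<N. norm (multiplier (\<eta> \<bullet> (\<rho> k *\<^sub>R b)))) \<le> (\<Prod>k<N. exp (-1))"
      by (intro prod_mono) auto
    also have "\<dots> = exp (- real N)" by (simp add: exp_of_nat_mult[symmetric])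
    also have "\<dots> \<le> exp (- \<theta> (norm \<eta>))" unfolding N_def using of_nat_ceiling[of "\<theta> (norm \<eta>)"] by simp
    finally have P: "(\<Prod>k<N. norm (multiplier (\<eta> \<bullet> (\<rho> k *\<^sub>R b)))) \<le> exp (- \<theta> (norm \<eta>))" .
    have "norm (fourier g \<eta>) \<le> A * exp (- \<theta> (norm \<eta>))"
      by (rule order_trans[OF g(4)[OF b(1), of \<eta> N] mult_mono[OF hA P]]) (use A0 in \<open>auto intro: prod_nonneg\<close>)
    also have "A \<le> (A + 1) * exp (\<theta> 1)"
    proof -
      have "(A + 1) * 1 \<le> (A + 1) * exp (\<theta> 1)" using A0 nn[of 1] by (intro mult_left_mono) auto
      then show ?thesis by (metis add_increasing2 le_add_same_cancel1 mult.right_neutral order_trans zero_le_one)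
    qed
    then have "A * exp (- \<theta> (norm \<eta>)) \<le> (A + 1) * exp (\<theta> 1) * exp (- \<theta> (norm \<eta>))" by (intro mult_right_mono) auto
    finally show ?thesis .
  qed
  moreover have "\<exists>x. g x \<noteq> 0"
  proof (rule ccontr)
    assume "\<not> (\<exists>x. g x \<noteq> 0)"
    then have "fourier g 0 = 0" by (simp add: fourier_def)
    then show False using g(2) fourier_tent[where 'a='a] unfolding h_def by simp
  qed
  moreover have "(A + 1) * exp (\<theta> 1) > 0" using A0 by simp
  ultimately show ?thesis using g(1) by blast
qed

section \<open>Separating families and injectivity of the Fourier transform\<close>

inductive_set fspan :: "('a \<Rightarrow> real) set \<Rightarrow> ('a \<Rightarrow> real) set" for A where
  zero: "(\<lambda>_. 0) \<in> fspan A"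
| step: "a \<in> A \<Longrightarrow> g \<in> fspan A \<Longrightarrow> (\<lambda>x. c * a x + g x) \<in> fspan A"

lemma fspan_scale_base: "a \<in> A \<Longrightarrow> (\<lambda>x. c * a x) \<in> fspan A"
  using fspan.step[OF _ fspan.zero, of a A c] by simp

lemma fspan_add: "f \<in> fspan A \<Longrightarrow> g \<in> fspan A \<Longrightarrow> (\<lambda>x. f x + g x) \<in> fspan A"
proof (induction rule: fspan.induct)
  case (step a f c)
  then show ?case using fspan.step[of a A "\<lambda>x. f x + g x" c] by (simp add: add.assoc)
qed simp

lemma fspan_scale: "f \<in> fspan A \<Longrightarrow> (\<lambda>x. c * f x) \<in> fspan A"
proof (induction rule: fspan.induct)
  case zero
  then show ?case by (simp add: fspan.zero)
next
  case (step a f d)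
  then show ?case using fspan.step[of a A "\<lambda>x. c * f x" "c * d"] by (simp add: algebra_simps)
qed

lemma fspan_mult:
  assumes A: "\<And>a b. a \<in> A \<Longrightarrow> b \<in> A \<Longrightarrow> (\<lambda>x. a x * b x) \<in> fspan A"
    and "f \<in> fspan A" "g \<in> fspan A"
  shows "(\<lambda>x. f x * g x) \<in> fspan A"
  using assms(2)
proof (induction rule: fspan.induct)
  case zero
  then show ?case by (simp add: fspan.zero)
next
  case (step a f c)
  have "(\<lambda>x. a x * g x) \<in> fspan A"
    using assms(3)
  proof (induction rule: fspan.induct)
    case zero
    then show ?case by (simp add: fspan.zero)
  next
    case (step b g d)
    then have "(\<lambda>x. d * (a x * b x) + a x * g x) \<in> fspan A"
      using fspan_add[OF fspan_scale[OF A[OF \<open>a \<in> A\<close> step.hyps(1)]] step.IH] by blast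
    then show ?case by (simp add: algebra_simps)
  qed
  then have "(\<lambda>x. c * (a x * g x) + f x * g x) \<in> fspan A"
    using step by (intro fspan_add fspan_scale)
  then show ?case by (simp add: algebra_simps)
qed

text \<open>
  By the Stone--Weierstrass theorem the span of \<open>A\<close> approximates the real and the imaginary part of
  \<open>f\<close> uniformly on \<open>S\<close>. So \<open>f\<close> is orthogonal to itself.
\<close>
lemma AE_zero_if_orthogonal_to_separating_family:
  fixes f :: "'a::t2_space \<Rightarrow> complex"
  assumes S: "compact S" and cf: "continuous_on S f" and supp: "\<And>x. x \<in> space m \<Longrightarrow> x \<notin> S \<Longrightarrow> f x = 0"
    and fi: "integrable m f"
    and Ac: "\<And>a. a \<in> A \<Longrightarrow> continuous_on S a" and Am: "\<And>a. a \<in> A \<Longrightarrow> a \<in> borel_measurable m"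
    and one: "(\<lambda>_. 1) \<in> A" and mult: "\<And>a b. a \<in> A \<Longrightarrow> b \<in> A \<Longrightarrow> (\<lambda>x. a x * b x) \<in> fspan A"
    and sep: "\<And>x y. x \<in> S \<Longrightarrow> y \<in> S \<Longrightarrow> x \<noteq> y \<Longrightarrow> \<exists>a\<in>A. a x \<noteq> a y"
    and orth: "\<And>a. a \<in> A \<Longrightarrow> (LINT x|m. of_real (a x) * f x) = 0"
  shows "AE x in m. f x = 0"
proof -
  have span: "continuous_on S g \<and> g \<in> borel_measurable m \<and> integrable m (\<lambda>x. of_real (g x) * f x) \<and> (LINT x|m. of_real (g x) * f x) = 0"
    if "g \<in> fspan A" for g
    using that
  proof (induction rule: fspan.induct)
    case (step a g c)
    have "integrable m (\<lambda>x. of_real (a x) * f x)"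
    proof -
      obtain K where K: "\<And>x. x \<in> S \<Longrightarrow> norm (a x) \<le> K"
        using compact_imp_bounded[OF compact_continuous_image[OF Ac[OF step(1)] S]]
        unfolding bounded_iff by blast
      show ?thesis
      proof (rule Bochner_Integration.integrable_bound[OF integrable_mult_right[OF integrable_norm[OF fi], of K]])
        show "(\<lambda>x. complex_of_real (a x) * f x) \<in> borel_measurable m" using Am[OF step(1)] fi by measurable
        show "AE x in m. norm (complex_of_real (a x) * f x) \<le> norm (K * norm (f x))"
        proof (rule AE_I2)
          fix x assume "x \<in> space m"
          then show "norm (complex_of_real (a x) * f x) \<le> norm (K * norm (f x))"
            using K[of x] supp[of x] by (cases "x \<in> S") (auto simp: norm_mult intro!: mult_right_mono)
        qed
      qed
    qed
    then show ?case using step Ac Am orth[of a]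
      by (auto simp: distrib_right mult.assoc intro!: continuous_intros)
  qed auto
  interpret R: function_ring_on "fspan A" S
  proof
    show "(\<lambda>_. c) \<in> fspan A" for c using fspan_scale_base[OF one, of c] by simp
    show "\<exists>f\<in>fspan A. f x \<noteq> f y" if xy: "x \<in> S" "y \<in> S" "x \<noteq> y" for x y
    proof -
      obtain a where a: "a \<in> A" "a x \<noteq> a y" using sep[OF xy] by blast
      then show ?thesis using fspan_scale_base[OF a(1), of 1] by auto
    qed
  qed (use S span in \<open>auto intro: fspan_add fspan_mult[OF mult]\<close>)
  obtain B where B: "\<And>x. x \<in> S \<Longrightarrow> norm (f x) \<le> B"
    using compact_imp_bounded[OF compact_continuous_image[OF cf S]] unfolding bounded_iff by blast
  have fm: "f \<in> borel_measurable m" using fi by auto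
  have cfi: "integrable m (\<lambda>x. cnj (f x) * f x)"
  proof (rule Bochner_Integration.integrable_bound[OF integrable_mult_right[OF integrable_norm[OF fi], of B]])
    show "(\<lambda>x. cnj (f x) * f x) \<in> borel_measurable m"
      by (rule borel_measurable_continuous_on[OF _ fm, of "\<lambda>z. cnj z * z"]) (intro continuous_intros)
    show "AE x in m. norm (cnj (f x) * f x) \<le> norm (B * norm (f x))"
    proof (rule AE_I2)
      fix x assume "x \<in> space m"
      then show "norm (cnj (f x) * f x) \<le> norm (B * norm (f x))"
        using B[of x] supp[of x]
        by (cases "x \<in> S") (auto simp: norm_mult intro!: order_trans[OF mult_right_mono abs_ge_self])
    qed
  qed
  define D where "D = (LINT x|m. norm (f x))"
  have D: "D \<ge> 0" by (simp add: D_def)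
  have small: "norm (LINT x|m. cnj (f x) * f x) \<le> e" if e: "e > 0" for e
  proof -
    define e' where "e' = e / (2 * (D + 1))"
    have e': "e' > 0" using e D by (simp add: e'_def)
    obtain g1 where g1: "g1 \<in> fspan A" "\<And>x. x \<in> S \<Longrightarrow> \<bar>Re (f x) - g1 x\<bar> < e'"
      using R.Stone_Weierstrass_basic[of "\<lambda>x. Re (f x)", OF _ e'] cf by (auto intro: continuous_intros)
    obtain g2 where g2: "g2 \<in> fspan A" "\<And>x. x \<in> S \<Longrightarrow> \<bar>Im (f x) - g2 x\<bar> < e'"
      using R.Stone_Weierstrass_basic[of "\<lambda>x. Im (f x)", OF _ e'] cf by (auto intro: continuous_intros)
    note s1 = span[OF g1(1)] and s2 = span[OF g2(1)]
    define h where "h = (\<lambda>x. cnj (f x) * f x - (of_real (g1 x) * f x - \<i> * (of_real (g2 x) * f x)))"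
    have hi: "integrable m h" unfolding h_def using cfi s1 s2 by (intro Bochner_Integration.integrable_diff integrable_mult_right) auto
    have "(LINT x|m. h x) = (LINT x|m. cnj (f x) * f x)"
      unfolding h_def using cfi s1 s2 by simp
    moreover have "norm (LINT x|m. h x) \<le> (LINT x|m. 2 * e' * norm (f x))"
    proof (rule order_trans[OF integral_norm_bound integral_mono])
      fix x assume x: "x \<in> space m"
      show "norm (h x) \<le> 2 * e' * norm (f x)"
      proof (cases "x \<in> S")
        case True
        have "h x = (cnj (f x) - (of_real (g1 x) - \<i> * of_real (g2 x))) * f x"
          unfolding h_def by (simp add: algebra_simps)
        moreover have "norm (cnj (f x) - (of_real (g1 x) - \<i> * of_real (g2 x))) \<le> 2 * e'"
          by (rule order_trans[OF cmod_le]) (use g1(2)[OF True] g2(2)[OF True] in auto)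
        ultimately show ?thesis by (simp add: norm_mult mult_right_mono)
      qed (use supp[OF x] in \<open>auto simp: h_def\<close>)
    qed (use hi fi in auto)
    moreover have "(LINT x|m. 2 * e' * norm (f x)) = 2 * e' * D" unfolding D_def by simp
    moreover have "2 * e' * D \<le> e" using D e by (simp add: e'_def field_simps)
    ultimately show ?thesis by (metis order_trans)
  qed
  have "cnj (f x) * f x = of_real ((norm (f x))\<^sup>2)" for x
    by (metis complex_norm_square mult.commute)
  then have "(LINT x|m. cnj (f x) * f x) = of_real (LINT x|m. (norm (f x))\<^sup>2)"
    and i2: "integrable m (\<lambda>x. (norm (f x))\<^sup>2)"
    using cfi by (simp_all add: integral_complex_of_real complex_of_real_integrable_eq del: of_real_power)
  moreover have "norm (LINT x|m. cnj (f x) * f x) \<le> 0"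
    by (rule field_le_epsilon) (use small in simp)
  moreover have "(LINT x|m. (norm (f x))\<^sup>2) \<ge> 0" by simp
  ultimately have "(LINT x|m. (norm (f x))\<^sup>2) = 0" by simp
  then have "AE x in m. (norm (f x))\<^sup>2 = 0"
    using integral_nonneg_eq_0_iff_AE[OF i2] by simp
  then show ?thesis by simp
qed

text \<open>
  The functions \<open>cos (\<eta> \<bullet> x)\<close> and \<open>sin (\<eta> \<bullet> x)\<close> form a separating family: for \<open>u = x - y\<close> the frequency
  \<open>\<eta> = (\<pi> / (u \<bullet> u)) u\<close> shifts the phase by \<open>\<pi>\<close> between \<open>y\<close> and \<open>x\<close>, which changes the sign of both
  functions, and they are not both zero.
\<close>
lemma fourier_transform_injective:
  fixes f :: "'a::euclidean_space \<Rightarrow> complex"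
  assumes cf: "continuous_on UNIV f" and supp: "\<And>x. norm x > R \<Longrightarrow> f x = 0"
    and zero: "\<And>\<eta>. (LINT x|lborel. f x * exp (\<i> * of_real (\<eta> \<bullet> x))) = 0"
  shows "f x = 0"
proof -
  define A where "A = (\<Union>\<eta>::'a. {\<lambda>x. cos (\<eta> \<bullet> x), \<lambda>x. sin (\<eta> \<bullet> x)})"
  have cA: "(\<lambda>x. cos (\<eta> \<bullet> x)) \<in> A" and sA: "(\<lambda>x. sin (\<eta> \<bullet> x)) \<in> A" for \<eta> by (auto simp: A_def)
  have Ac: "continuous_on UNIV a" if "a \<in> A" for a
    using that unfolding A_def by (auto intro!: continuous_intros)
  obtain B where B: "\<And>x. x \<in> cball 0 R \<Longrightarrow> norm (f x) \<le> B"
    using compact_imp_bounded[OF compact_continuous_image[OF continuous_on_subset[OF cf subset_UNIV] compact_cball]]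
    unfolding bounded_iff by blast
  have fb: "norm (f x) \<le> B * indicator (cball 0 R) x" for x
    using B[of x] supp[of x] by (cases "norm x > R") (auto simp: indicator_def)
  note intB = integrable_cball_indicator[where 'a='a, of B R]
  have fi: "integrable lborel f"
    by (rule Bochner_Integration.integrable_bound[OF intB])
      (use cf order_trans[OF fb abs_ge_self] in \<open>auto intro!: borel_measurable_continuous_onI\<close>)
  have fei: "integrable lborel (\<lambda>x. f x * exp (\<i> * of_real (\<eta> \<bullet> x)))" for \<eta>
    by (rule Bochner_Integration.integrable_bound[OF intB])
      (use cf order_trans[OF fb abs_ge_self] in \<open>auto intro!: borel_measurable_continuous_onI continuous_intros simp: norm_mult\<close>)
  have trig: "of_real (cos (\<eta> \<bullet> x)) * f x = (f x * exp (\<i> * of_real (\<eta> \<bullet> x)) + f x * exp (\<i> * of_real ((- \<eta>) \<bullet> x))) / 2"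
    "of_real (sin (\<eta> \<bullet> x)) * f x = (f x * exp (\<i> * of_real (\<eta> \<bullet> x)) - f x * exp (\<i> * of_real ((- \<eta>) \<bullet> x))) / (2 * \<i>)" for \<eta> x
    by (simp_all add: cos_of_real[symmetric] sin_of_real[symmetric] cos_exp_eq sin_exp_eq field_simps)
  have "AE x in lborel. f x = 0"
  proof (rule AE_zero_if_orthogonal_to_separating_family[where S = "cball 0 R" and A = A])
    show "(\<lambda>_. 1) \<in> A" using cA[of 0] by simp
    show "(LINT x|lborel. of_real (a x) * f x) = 0" if "a \<in> A" for a
    proof -
      from that obtain \<eta> where "a = (\<lambda>x. cos (\<eta> \<bullet> x)) \<or> a = (\<lambda>x. sin (\<eta> \<bullet> x))" unfolding A_def by blast
      then show ?thesis
      proof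
        assume a: "a = (\<lambda>x. cos (\<eta> \<bullet> x))"
        show ?thesis unfolding a trig
          by (simp only: integral_divide_zero Bochner_Integration.integral_add[OF fei fei] zero) simp
      next
        assume a: "a = (\<lambda>x. sin (\<eta> \<bullet> x))"
        show ?thesis unfolding a trig
          by (simp only: integral_divide_zero Bochner_Integration.integral_diff[OF fei fei] zero) simp
      qed
    qed
    show "(\<lambda>x. a x * b x) \<in> fspan A" if ab: "a \<in> A" "b \<in> A" for a b
    proof -
      have *: "(\<lambda>x. c * cos (\<eta> \<bullet> x) + d * cos (\<zeta> \<bullet> x)) \<in> fspan A" "(\<lambda>x. c * sin (\<eta> \<bullet> x) + d * sin (\<zeta> \<bullet> x)) \<in> fspan A" for c d \<eta> \<zeta>
        by (intro fspan_add fspan_scale_base cA sA)+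
      consider \<eta> \<zeta> where "a = (\<lambda>x. cos (\<eta> \<bullet> x))" "b = (\<lambda>x. cos (\<zeta> \<bullet> x))"
        | \<eta> \<zeta> where "a = (\<lambda>x. cos (\<eta> \<bullet> x))" "b = (\<lambda>x. sin (\<zeta> \<bullet> x))"
        | \<eta> \<zeta> where "a = (\<lambda>x. sin (\<eta> \<bullet> x))" "b = (\<lambda>x. cos (\<zeta> \<bullet> x))"
        | \<eta> \<zeta> where "a = (\<lambda>x. sin (\<eta> \<bullet> x))" "b = (\<lambda>x. sin (\<zeta> \<bullet> x))"
        using ab unfolding A_def by blast
      then show ?thesis
      proof cases
        case (1 \<eta> \<zeta>)
        then show ?thesis using *(1)[of "1/2" "\<eta> - \<zeta>" "1/2" "\<eta> + \<zeta>"]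
          by (simp add: cos_times_cos inner_simps add_divide_distrib)
      next
        case (2 \<eta> \<zeta>)
        then show ?thesis using *(2)[of "1/2" "\<eta> + \<zeta>" "-1/2" "\<eta> - \<zeta>"]
          by (simp add: cos_times_sin inner_simps diff_divide_distrib)
      next
        case (3 \<eta> \<zeta>)
        then show ?thesis using *(2)[of "1/2" "\<eta> + \<zeta>" "1/2" "\<eta> - \<zeta>"]
          by (simp add: sin_times_cos inner_simps add_divide_distrib)
      next
        case (4 \<eta> \<zeta>)
        then show ?thesis using *(1)[of "1/2" "\<eta> - \<zeta>" "-1/2" "\<eta> + \<zeta>"]
          by (simp add: sin_times_sin inner_simps diff_divide_distrib)
      qed
    qed
    show "\<exists>a\<in>A. a x \<noteq> a y" if "x \<noteq> y" for x y
    proof -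
      define u where "u = x - y"
      define \<eta> where "\<eta> = (pi / (u \<bullet> u)) *\<^sub>R u"
      have "\<eta> \<bullet> u = pi" using that by (simp add: \<eta>_def u_def)
      then have eq: "\<eta> \<bullet> x = \<eta> \<bullet> y + pi" by (simp add: u_def inner_simps)
      have "cos (\<eta> \<bullet> x) = - cos (\<eta> \<bullet> y)" "sin (\<eta> \<bullet> x) = - sin (\<eta> \<bullet> y)" unfolding eq by simp_all
      moreover have "cos (\<eta> \<bullet> y) \<noteq> 0 \<or> sin (\<eta> \<bullet> y) \<noteq> 0"
        using sin_cos_squared_add[of "\<eta> \<bullet> y"] by (metis add_0 power_zero_numeral zero_neq_one)
      ultimately have "cos (\<eta> \<bullet> x) \<noteq> cos (\<eta> \<bullet> y) \<or> sin (\<eta> \<bullet> x) \<noteq> sin (\<eta> \<bullet> y)" by auto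
      then show ?thesis
      proof
        assume "cos (\<eta> \<bullet> x) \<noteq> cos (\<eta> \<bullet> y)" then show ?thesis by (intro bexI[OF _ cA[of \<eta>]])
      next
        assume "sin (\<eta> \<bullet> x) \<noteq> sin (\<eta> \<bullet> y)" then show ?thesis by (intro bexI[OF _ sA[of \<eta>]])
      qed
    qed
  qed (use cf fi supp Ac in \<open>auto intro: continuous_on_subset borel_measurable_continuous_onI\<close>)
  moreover have op: "open {x. f x \<noteq> 0}"
    using cf by (intro open_Collect_neq) auto
  ultimately have "{x. f x \<noteq> 0} \<in> null_sets lborel"
    by (subst (asm) AE_iff_null) auto
  then have "negligible {x. f x \<noteq> 0}"
    unfolding negligible_iff_null_sets by (rule null_sets_completionI)
  then show ?thesis using open_not_negligible[OF op] by blast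
qed

section \<open>Decomposition of unitary matrix representations\<close>

abbreviation tp :: "real ^ 'n ^ 'm \<Rightarrow> real ^ 'm ^ 'n" where
  "tp \<equiv> Finite_Cartesian_Product.transpose"

abbreviation idm :: "'n::finite sqmat" where
  "idm \<equiv> Finite_Cartesian_Product.mat 1"

lemma mat_adjoint_carrier: "A \<in> carrier_mat n m \<Longrightarrow> mat_adjoint A \<in> carrier_mat m n"
  unfolding mat_adjoint_def by auto

lemma mat_adjoint_index:
  fixes A :: "complex Matrix.mat"
  assumes "A \<in> carrier_mat n m" "i < m" "j < n"
  shows "index_mat (mat_adjoint A) (i, j) = cnj (index_mat A (j, i))"
  using assms unfolding mat_adjoint_def
  by (auto simp: mat_of_rows_index vec_index_conjugate)

lemma index_mult_sum:
  assumes "A \<in> carrier_mat n l" "B \<in> carrier_mat l m" "i < n" "j < m"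
  shows "index_mat (A * B) (i, j) = (\<Sum>k<l. index_mat A (i, k) * index_mat B (k, j))"
  using assms by (auto simp: scalar_prod_def lessThan_atLeast0 intro!: sum.cong)

lemma index_mult_vec_sum:
  assumes "A \<in> carrier_mat n l" "v \<in> carrier_vec l" "i < n"
  shows "vec_index (A *\<^sub>v v) i = (\<Sum>k<l. index_mat A (i, k) * vec_index v k)"
  using assms by (auto simp: scalar_prod_def lessThan_atLeast0 intro!: sum.cong)

lemma mat_adjoint_mult:
  fixes A :: "complex Matrix.mat"
  assumes A: "A \<in> carrier_mat n l" and B: "B \<in> carrier_mat l m"
  shows "mat_adjoint (A * B) = mat_adjoint B * mat_adjoint A"
proof (rule eq_matI)
  have AB: "A * B \<in> carrier_mat n m" using A B by auto
  note d = mat_adjoint_carrier[OF A] mat_adjoint_carrier[OF B] mat_adjoint_carrier[OF AB]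
  fix i j assume "i < dim_row (mat_adjoint B * mat_adjoint A)" "j < dim_col (mat_adjoint B * mat_adjoint A)"
  then have ij: "i < m" "j < n" using d by auto
  show "index_mat (mat_adjoint (A * B)) (i, j) = index_mat (mat_adjoint B * mat_adjoint A) (i, j)"
    using ij A B by (simp add: mat_adjoint_index[OF AB] index_mult_sum[OF A B] index_mult_sum[OF d(2,1)]
        mat_adjoint_index[OF A] mat_adjoint_index[OF B] mult.commute del: index_mult_mat(1))
qed (use mat_adjoint_carrier[OF A] mat_adjoint_carrier[OF B] mat_adjoint_carrier[OF mult_carrier_mat[OF A B]] in auto)

lemma mat_adjoint_adjoint:
  fixes A :: "complex Matrix.mat"
  assumes A: "A \<in> carrier_mat n m"
  shows "mat_adjoint (mat_adjoint A) = A"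
proof (rule eq_matI)
  note d = mat_adjoint_carrier[OF A]
  show "index_mat (mat_adjoint (mat_adjoint A)) (i, j) = index_mat A (i, j)" if "i < dim_row A" "j < dim_col A" for i j
    using that A by (simp add: mat_adjoint_index[OF d] mat_adjoint_index[OF A])
qed (use A mat_adjoint_carrier[OF mat_adjoint_carrier[OF A]] in auto)

lemma mult_mat_unit_vec:
  fixes A :: "complex Matrix.mat"
  assumes A: "A \<in> carrier_mat n m" and j: "j < m"
  shows "A *\<^sub>v unit_vec m j = col A j"
  using A j by (intro eq_vecI) (auto simp: scalar_prod_right_unit)

lemma vec_index_add_neg:
  fixes w q :: "complex Matrix.vec"
  assumes "w \<in> carrier_vec d" "q \<in> carrier_vec d" "i < d"
  shows "vec_index (w + (-1) \<cdot>\<^sub>v q) i = vec_index w i - vec_index q i"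
  using assms by simp

lemma zero_mat_mult_vec:
  fixes x :: "complex Matrix.vec"
  assumes "x \<in> carrier_vec m"
  shows "0\<^sub>m n m *\<^sub>v x = 0\<^sub>v n"
  using assms by (intro eq_vecI) (auto simp: scalar_prod_def)

lemma vec_add_neg_cancel:
  fixes x q :: "complex Matrix.vec"
  assumes "x \<in> carrier_vec d" "q \<in> carrier_vec d"
  shows "x + (-1) \<cdot>\<^sub>v x = 0\<^sub>v d" "x + (-1) \<cdot>\<^sub>v 0\<^sub>v d = x" "q + (x + (-1) \<cdot>\<^sub>v q) = x"
  using assms by (intro eq_vecI; simp)+

text \<open>
  If \<open>m\<close> were larger than \<open>d\<close>, padding \<open>Q\<close> with zero rows would produce an invertible square matrix
  with a zero row.
\<close>
lemma isometry_dim_le: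
  fixes Q :: "complex Matrix.mat"
  assumes Q: "Q \<in> carrier_mat d m" and iso: "mat_adjoint Q * Q = 1\<^sub>m m"
  shows "m \<le> d"
proof (rule ccontr)
  assume "\<not> m \<le> d"
  then have dm: "d < m" by simp
  define P where "P = Matrix.mat m m (\<lambda>(i, j). if i < d then index_mat Q (i, j) else 0)"
  have P: "P \<in> carrier_mat m m" by (simp add: P_def)
  note aP = mat_adjoint_carrier[OF P] and aQ = mat_adjoint_carrier[OF Q]
  have "mat_adjoint P * P = 1\<^sub>m m"
  proof (rule eq_matI)
    fix i j assume "i < dim_row (1\<^sub>m m)" "j < dim_col (1\<^sub>m m)"
    then have ij: "i < m" "j < m" by auto
    have "index_mat (mat_adjoint P * P) (i, j) = (\<Sum>k<m. cnj (index_mat P (k, i)) * index_mat P (k, j))"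
      using ij by (simp add: index_mult_sum[OF aP P] mat_adjoint_index[OF P] del: index_mult_mat(1))
    also have "\<dots> = (\<Sum>k<d. cnj (index_mat Q (k, i)) * index_mat Q (k, j))"
      using dm ij by (intro sum.mono_neutral_cong_right) (auto simp: P_def)
    also have "\<dots> = index_mat (mat_adjoint Q * Q) (i, j)"
      using ij by (simp add: index_mult_sum[OF aQ Q] mat_adjoint_index[OF Q] del: index_mult_mat(1))
    finally show "index_mat (mat_adjoint P * P) (i, j) = index_mat (1\<^sub>m m) (i, j)" using iso by simp
  qed (use P aP in auto)
  from mat_mult_left_right_inverse[OF aP P this] have "index_mat (P * mat_adjoint P) (d, d) = 1"
    using dm by simp
  moreover have "index_mat (P * mat_adjoint P) (d, d) = 0"
    using dm unfolding index_mult_sum[OF P aP dm dm] by (simp add: P_def)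
  ultimately show False by simp
qed

text \<open>
  The columns of \<open>Q\<close> are a maximal orthonormal system in \<open>W\<close>; its size is bounded by the dimension.
  If a vector of \<open>W\<close> differed from its projection onto the range of \<open>Q\<close>, the normalized difference
  would extend the system.
\<close>
lemma orthonormal_projection_onto:
  fixes W :: "complex Matrix.vec set"
  assumes W: "W \<subseteq> carrier_vec d" and W0: "0\<^sub>v d \<in> W"
    and Wadd: "\<And>v w. v \<in> W \<Longrightarrow> w \<in> W \<Longrightarrow> v + w \<in> W" and Wsm: "\<And>c w. w \<in> W \<Longrightarrow> c \<cdot>\<^sub>v w \<in> W"
  shows "\<exists>m Q. m \<le> d \<and> Q \<in> carrier_mat d m \<and> mat_adjoint Q * Q = 1\<^sub>m m \<and>
    (\<forall>w\<in>carrier_vec d. w \<in> W \<longleftrightarrow> Q *\<^sub>v (mat_adjoint Q *\<^sub>v w) = w)"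
proof -
  define P where "P = (\<lambda>m Q. Q \<in> carrier_mat d m \<and> mat_adjoint Q * Q = 1\<^sub>m m \<and> (\<forall>j<m. col Q j \<in> W))"
  have P0: "\<exists>Q. P 0 Q"
  proof (intro exI[of _ "0\<^sub>m d 0"])
    have z: "0\<^sub>m d 0 \<in> carrier_mat d 0" by simp
    show "P 0 (0\<^sub>m d 0)" unfolding P_def using mat_adjoint_carrier[OF z]
      by (auto intro!: eq_matI)
  qed
  have Pd: "m \<le> d" if "\<exists>Q. P m Q" for m using that isometry_dim_le unfolding P_def by blast
  \<comment> \<open>The largest size of an orthonormal system in \<open>W\<close>.\<close>
  define m where "m = (GREATEST m. \<exists>Q. P m Q)"
  have "\<exists>Q. P m Q" unfolding m_def using GreatestI_nat[of "\<lambda>m. \<exists>Q. P m Q", OF P0 Pd] .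
  then obtain Q where PQ: "P m Q" by blast
  have mmax: "l \<le> m" if "\<exists>Q. P l Q" for l unfolding m_def using Greatest_le_nat[of "\<lambda>m. \<exists>Q. P m Q", OF that Pd] .
  have Q: "Q \<in> carrier_mat d m" and iso: "mat_adjoint Q * Q = 1\<^sub>m m" and colW: "\<And>j. j < m \<Longrightarrow> col Q j \<in> W"
    using PQ unfolding P_def by auto
  note aQ = mat_adjoint_carrier[OF Q]
  have QW: "Q *\<^sub>v x \<in> W" if x: "x \<in> carrier_vec m" for x
  proof -
    have "Matrix.vec d (\<lambda>i. \<Sum>j<l. index_mat Q (i, j) * vec_index x j) \<in> W" if "l \<le> m" for l
      using that
    proof (induction l)
      case 0
      have "Matrix.vec d (\<lambda>i. 0) = (0\<^sub>v d :: complex Matrix.vec)" by (intro eq_vecI) auto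
      then show ?case using W0 by simp
    next
      case (Suc l)
      have "Matrix.vec d (\<lambda>i. \<Sum>j<Suc l. index_mat Q (i, j) * vec_index x j)
        = Matrix.vec d (\<lambda>i. \<Sum>j<l. index_mat Q (i, j) * vec_index x j) + vec_index x l \<cdot>\<^sub>v col Q l"
        using Suc.prems Q by (intro eq_vecI) (auto simp: mult.commute)
      then show ?case using Suc by (auto intro!: Wadd Wsm colW)
    qed
    from this[OF order_refl]
    have "Matrix.vec d (\<lambda>i. \<Sum>j<m. index_mat Q (i, j) * vec_index x j) \<in> W" .
    also have "Matrix.vec d (\<lambda>i. \<Sum>j<m. index_mat Q (i, j) * vec_index x j) = Q *\<^sub>v x"
      using Q x by (intro eq_vecI) (auto simp: index_mult_vec_sum[OF Q x] simp del: index_mult_mat_vec)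
    finally show ?thesis .
  qed
  have "w \<in> W \<longleftrightarrow> Q *\<^sub>v (mat_adjoint Q *\<^sub>v w) = w" if w: "w \<in> carrier_vec d" for w
  proof
    assume "Q *\<^sub>v (mat_adjoint Q *\<^sub>v w) = w"
    then show "w \<in> W" using QW[of "mat_adjoint Q *\<^sub>v w"] aQ w by auto
  next
    assume wW: "w \<in> W"
    define y where "y = mat_adjoint Q *\<^sub>v w"
    have y: "y \<in> carrier_vec m" unfolding y_def using aQ w by auto
    define w' where "w' = w + (-1) \<cdot>\<^sub>v (Q *\<^sub>v y)"
    have Qy: "Q *\<^sub>v y \<in> carrier_vec d" using Q y by auto
    have w'c: "w' \<in> carrier_vec d" unfolding w'_def using w Qy by auto
    have w'W: "w' \<in> W" unfolding w'_def using wW QW[OF y] by (intro Wadd Wsm)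
    have "mat_adjoint Q *\<^sub>v (Q *\<^sub>v y) = y"
      using assoc_mult_mat_vec[OF aQ Q y] iso y by simp
    then have "mat_adjoint Q *\<^sub>v w' = y + (-1) \<cdot>\<^sub>v y"
      unfolding w'_def using aQ w Qy
      by (simp add: mult_add_distrib_mat_vec[OF aQ] mult_mat_vec[OF aQ] y_def[symmetric])
    also have "\<dots> = 0\<^sub>v m" using y by (intro eq_vecI) auto
    finally have aw': "mat_adjoint Q *\<^sub>v w' = 0\<^sub>v m" .
    have orth: "(\<Sum>k<d. cnj (index_mat Q (k, j)) * vec_index w' k) = 0" if "j < m" for j
    proof -
      have "vec_index (mat_adjoint Q *\<^sub>v w') j = (\<Sum>k<d. index_mat (mat_adjoint Q) (j, k) * vec_index w' k)"
        by (rule index_mult_vec_sum[OF aQ w'c that])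
      also have "\<dots> = (\<Sum>k<d. cnj (index_mat Q (k, j)) * vec_index w' k)"
        using that by (intro sum.cong refl) (simp add: mat_adjoint_index[OF Q])
      finally show ?thesis using aw' that by simp
    qed
    have "w' = 0\<^sub>v d"
    proof (rule ccontr)
      assume nz: "w' \<noteq> 0\<^sub>v d"
      define s where "s = (\<Sum>k<d. (cmod (vec_index w' k))\<^sup>2)"
      have s0: "s > 0"
      proof -
        obtain k where k: "k < d" "vec_index w' k \<noteq> 0" using nz w'c by (metis carrier_vecD eq_vecI index_zero_vec(1) index_zero_vec(2))
        then have "0 < (cmod (vec_index w' k))\<^sup>2" by simp
        also have "\<dots> \<le> s" unfolding s_def using k by (intro member_le_sum) auto
        finally show ?thesis .
      qed
      define c :: complex where "c = of_real (1 / sqrt s)"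
      define v where "v = c \<cdot>\<^sub>v w'"
      have v: "v \<in> carrier_vec d" "v \<in> W" unfolding v_def using w'c w'W Wsm by auto
      have vk: "vec_index v k = c * vec_index w' k" if "k < d" for k using that w'c by (simp add: v_def)
      have vorth: "(\<Sum>k<d. cnj (index_mat Q (k, j)) * vec_index v k) = 0" if "j < m" for j
      proof -
        have "(\<Sum>k<d. cnj (index_mat Q (k, j)) * vec_index v k) = c * (\<Sum>k<d. cnj (index_mat Q (k, j)) * vec_index w' k)"
          unfolding sum_distrib_left by (intro sum.cong refl) (simp add: vk)
        then show ?thesis using orth[OF that] by simp
      qed
      have vorth': "(\<Sum>k<d. cnj (vec_index v k) * index_mat Q (k, j)) = 0" if "j < m" for j
        using arg_cong[OF vorth[OF that], of cnj] by (simp add: mult.commute)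
      have vnorm: "(\<Sum>k<d. cnj (vec_index v k) * vec_index v k) = 1"
      proof -
        have "(\<Sum>k<d. cnj (vec_index v k) * vec_index v k) = (\<Sum>k<d. of_real ((1 / s) * (cmod (vec_index w' k))\<^sup>2))"
        proof (intro sum.cong refl)
          fix k assume "k \<in> {..<d}"
          then have "cnj (vec_index v k) * vec_index v k = of_real ((cmod (c * vec_index w' k))\<^sup>2)"
            by (simp add: vk complex_norm_square mult.commute del: of_real_power)
          also have "(cmod (c * vec_index w' k))\<^sup>2 = (1 / s) * (cmod (vec_index w' k))\<^sup>2"
            using s0 by (simp add: c_def norm_mult norm_divide power_mult_distrib power_divide)
          finally show "cnj (vec_index v k) * vec_index v k = of_real ((1 / s) * (cmod (vec_index w' k))\<^sup>2)" .
        qed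
        also have "\<dots> = of_real ((1 / s) * s)" unfolding s_def by (simp add: sum_distrib_left del: of_real_mult of_real_divide)
        finally show ?thesis using s0 by simp
      qed
      define Q' where "Q' = Matrix.mat d (Suc m) (\<lambda>(i, j). if j < m then index_mat Q (i, j) else vec_index v i)"
      have Q': "Q' \<in> carrier_mat d (Suc m)" by (simp add: Q'_def)
      note aQ' = mat_adjoint_carrier[OF Q']
      have "mat_adjoint Q' * Q' = 1\<^sub>m (Suc m)"
      proof (rule eq_matI)
        fix i j assume "i < dim_row (1\<^sub>m (Suc m))" "j < dim_col (1\<^sub>m (Suc m))"
        then have ij: "i < Suc m" "j < Suc m" by auto
        have *: "index_mat (mat_adjoint Q' * Q') (i, j) = (\<Sum>k<d. cnj (index_mat Q' (k, i)) * index_mat Q' (k, j))"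
          using ij by (simp add: index_mult_sum[OF aQ' Q'] mat_adjoint_index[OF Q'] del: index_mult_mat(1))
        have isoij: "(\<Sum>k<d. cnj (index_mat Q (k, i)) * index_mat Q (k, j)) = (if i = j then 1 else 0)" if "i < m" "j < m"
          using arg_cong[OF iso, of "\<lambda>A. index_mat A (i, j)"] that
          by (simp add: index_mult_sum[OF aQ Q] mat_adjoint_index[OF Q] del: index_mult_mat(1))
        have "(\<Sum>k<d. cnj (index_mat Q' (k, i)) * index_mat Q' (k, j)) = (if i = j then 1 else 0)"
          using ij isoij vorth vorth' vnorm by (cases "i < m"; cases "j < m") (auto simp: Q'_def less_Suc_eq)
        then show "index_mat (mat_adjoint Q' * Q') (i, j) = index_mat (1\<^sub>m (Suc m)) (i, j)" using * ij by simp
      qed (use Q' aQ' in auto)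
      moreover have "col Q' j \<in> W" if "j < Suc m" for j
      proof (cases "j < m")
        case True
        then have "col Q' j = col Q j" using Q Q' by (intro eq_vecI) (auto simp: Q'_def)
        then show ?thesis using colW[OF True] by simp
      next
        case False
        then have "col Q' j = v" using that v Q' by (intro eq_vecI) (auto simp: Q'_def)
        then show ?thesis using v by simp
      qed
      ultimately have "P (Suc m) Q'" using Q' unfolding P_def by blast
      then show False using mmax by fastforce
    qed
    then have "w + (-1) \<cdot>\<^sub>v (Q *\<^sub>v y) = 0\<^sub>v d" unfolding w'_def .
    then have "vec_index (w + (-1) \<cdot>\<^sub>v (Q *\<^sub>v y)) i = 0" if "i < d" for i using that by simp
    moreover have "vec_index (w + (-1) \<cdot>\<^sub>v (Q *\<^sub>v y)) i = vec_index w i - vec_index (Q *\<^sub>v y) i" if "i < d" for i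
      using vec_index_add_neg[OF w Qy that] .
    ultimately have "vec_index (Q *\<^sub>v y) i = vec_index w i" if "i < d" for i using that by force
    then show "Q *\<^sub>v (mat_adjoint Q *\<^sub>v w) = w" unfolding y_def[symmetric] using w Qy Q by (intro eq_vecI) auto
  qed
  then show ?thesis using Q iso Pd PQ by blast
qed


text \<open>
  The continuous elements of the representation space, with \<open>G\<close> in the role of the stabilizer.
\<close>
definition covariant :: "'n::finite sqmat set \<Rightarrow> nat \<Rightarrow> ('n sqmat \<Rightarrow> complex Matrix.mat) \<Rightarrow> ('n sqmat \<Rightarrow> complex Matrix.vec) \<Rightarrow> bool" where
  "covariant G d lam \<phi> \<longleftrightarrow> (\<forall>k\<in>SO. \<phi> k \<in> carrier_vec d) \<and>
     (\<forall>i<d. continuous_on SO (\<lambda>k. vec_index (\<phi> k) i)) \<and>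
     (\<forall>u\<in>G. \<forall>k\<in>SO. \<phi> (u ** k) = lam u *\<^sub>v \<phi> k)"

text \<open>
  The hypothesis \<open>inv\<close> says that the range of the isometry \<open>Q\<close> is invariant. The compressed matrices
  describe the restriction of the representation to that range.
\<close>
lemma compress_unitary_rep:
  assumes G: "\<And>u v. u \<in> G \<Longrightarrow> v \<in> G \<Longrightarrow> u ** v \<in> G"
    and rep: "unitary_matrix_rep G d lam" and Q: "Q \<in> carrier_mat d m" and iso: "mat_adjoint Q * Q = 1\<^sub>m m"
    and inv: "\<And>u. u \<in> G \<Longrightarrow> lam u * Q = Q * (mat_adjoint Q * lam u * Q)"
  shows "unitary_matrix_rep G m (\<lambda>u. mat_adjoint Q * lam u * Q)"
proof -
  note aQ = mat_adjoint_carrier[OF Q]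
  have lc: "lam u \<in> carrier_mat d d" and lu: "mat_adjoint (lam u) * lam u = 1\<^sub>m d" if "u \<in> G" for u
    using rep that unfolding unitary_matrix_rep_def by auto
  have lm: "lam (u ** v) = lam u * lam v" if "u \<in> G" "v \<in> G" for u v
    using rep that unfolding unitary_matrix_rep_def by auto
  have cont: "continuous_on G (\<lambda>u. index_mat (lam u) (i, j))" if "i < d" "j < d" for i j
    using rep that unfolding unitary_matrix_rep_def by auto
  have c: "mat_adjoint Q * lam u * Q \<in> carrier_mat m m" if "u \<in> G" for u
    using lc[OF that] Q aQ by auto
  have "mat_adjoint (mat_adjoint Q * lam u * Q) * (mat_adjoint Q * lam u * Q) = 1\<^sub>m m" if u: "u \<in> G" for u
  proof -
    note l = lc[OF u] and al = mat_adjoint_carrier[OF lc[OF u]]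
    have "mat_adjoint (mat_adjoint Q * lam u * Q) = mat_adjoint Q * (mat_adjoint (lam u) * Q)"
      using mat_adjoint_mult[OF mult_carrier_mat[OF aQ l] Q] mat_adjoint_mult[OF aQ l] mat_adjoint_adjoint[OF Q] by simp
    then have "mat_adjoint (mat_adjoint Q * lam u * Q) * (mat_adjoint Q * lam u * Q)
      = mat_adjoint Q * (mat_adjoint (lam u) * Q) * (mat_adjoint Q * lam u * Q)" by simp
    also have "\<dots> = mat_adjoint Q * (mat_adjoint (lam u) * (Q * (mat_adjoint Q * lam u * Q)))"
      using assoc_mult_mat[OF aQ mult_carrier_mat[OF al Q] c[OF u]] assoc_mult_mat[OF al Q c[OF u]] by simp
    also have "\<dots> = mat_adjoint Q * (mat_adjoint (lam u) * (lam u * Q))" by (simp add: inv[OF u])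
    also have "\<dots> = mat_adjoint Q * Q"
      using assoc_mult_mat[OF al l Q] lu[OF u] Q by simp
    finally show ?thesis using iso by simp
  qed
  moreover have "mat_adjoint Q * lam (u ** v) * Q = (mat_adjoint Q * lam u * Q) * (mat_adjoint Q * lam v * Q)"
    if u: "u \<in> G" and v: "v \<in> G" for u v
  proof -
    note l = lc[OF u] lc[OF v]
    have "(mat_adjoint Q * lam u * Q) * (mat_adjoint Q * lam v * Q) = (mat_adjoint Q * lam u) * (lam v * Q)"
      using assoc_mult_mat[OF mult_carrier_mat[OF aQ l(1)] Q c[OF v]] by (simp add: inv[OF v])
    also have "\<dots> = mat_adjoint Q * (lam u * lam v) * Q"
      using assoc_mult_mat[OF mult_carrier_mat[OF aQ l(1)] l(2) Q] assoc_mult_mat[OF aQ l] by simp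
    finally show ?thesis by (simp add: lm[OF u v])
  qed
  moreover have "continuous_on G (\<lambda>u. index_mat (mat_adjoint Q * lam u * Q) (i, j))" if ij: "i < m" "j < m" for i j
  proof (rule continuous_on_eq)
    show "continuous_on G (\<lambda>u. \<Sum>l<d. (\<Sum>k<d. index_mat (mat_adjoint Q) (i, k) * index_mat (lam u) (k, l)) * index_mat Q (l, j))"
      by (intro continuous_intros cont) auto
    fix u assume u: "u \<in> G"
    show "(\<Sum>l<d. (\<Sum>k<d. index_mat (mat_adjoint Q) (i, k) * index_mat (lam u) (k, l)) * index_mat Q (l, j))
       = index_mat (mat_adjoint Q * lam u * Q) (i, j)"
      using ij by (simp add: index_mult_sum[OF mult_carrier_mat[OF aQ lc[OF u]] Q] index_mult_sum[OF aQ lc[OF u]] del: index_mult_mat(1))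
  qed
  ultimately show ?thesis unfolding unitary_matrix_rep_def using c by blast
qed

text \<open>
  Here \<open>inv\<close> is the invariance of the orthogonal complement of the range of \<open>Q\<close>, so the projection
  of \<open>\<phi>\<close> to the range is covariant as well.
\<close>
lemma compress_covariant:
  assumes rep: "unitary_matrix_rep G d lam" and cov: "covariant G d lam \<phi>"
    and Q: "Q \<in> carrier_mat d m" and iso: "mat_adjoint Q * Q = 1\<^sub>m m"
    and inv: "\<And>u. u \<in> G \<Longrightarrow> mat_adjoint Q * lam u = mat_adjoint Q * lam u * Q * mat_adjoint Q"
  shows "covariant G m (\<lambda>u. mat_adjoint Q * lam u * Q) (\<lambda>k. mat_adjoint Q *\<^sub>v \<phi> k)"
proof -
  note aQ = mat_adjoint_carrier[OF Q]
  have lc: "lam u \<in> carrier_mat d d" if "u \<in> G" for u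
    using rep that unfolding unitary_matrix_rep_def by auto
  have pc: "\<phi> k \<in> carrier_vec d" if "k \<in> SO" for k using cov that unfolding covariant_def by auto
  have "mat_adjoint Q *\<^sub>v \<phi> (u ** k) = (mat_adjoint Q * lam u * Q) *\<^sub>v (mat_adjoint Q *\<^sub>v \<phi> k)" if u: "u \<in> G" and k: "k \<in> SO" for u k
  proof -
    note l = lc[OF u] and p = pc[OF k]
    have "mat_adjoint Q *\<^sub>v \<phi> (u ** k) = mat_adjoint Q *\<^sub>v (lam u *\<^sub>v \<phi> k)"
      using cov u k unfolding covariant_def by auto
    also have "\<dots> = (mat_adjoint Q * lam u) *\<^sub>v \<phi> k"
      using assoc_mult_mat_vec[OF aQ l p] by simp
    also have "\<dots> = (mat_adjoint Q * lam u * Q * mat_adjoint Q) *\<^sub>v \<phi> k" using inv[OF u] by simp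
    also have "\<dots> = (mat_adjoint Q * lam u * Q) *\<^sub>v (mat_adjoint Q *\<^sub>v \<phi> k)"
      using aQ Q l p by (intro assoc_mult_mat_vec) auto
    finally show ?thesis .
  qed
  moreover have "continuous_on SO (\<lambda>k. vec_index (mat_adjoint Q *\<^sub>v \<phi> k) i)" if i: "i < m" for i
  proof (rule continuous_on_eq)
    show "continuous_on SO (\<lambda>k. \<Sum>l<d. index_mat (mat_adjoint Q) (i, l) * vec_index (\<phi> k) l)"
      using cov unfolding covariant_def by (intro continuous_intros) auto
    show "(\<Sum>l<d. index_mat (mat_adjoint Q) (i, l) * vec_index (\<phi> k) l) = vec_index (mat_adjoint Q *\<^sub>v \<phi> k) i" if "k \<in> SO" for k
      using index_mult_vec_sum[OF aQ pc[OF that] i] by simp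
  qed
  ultimately show ?thesis unfolding covariant_def using aQ pc by auto
qed

text \<open>
  Invariance of a subspace under the adjoint of \<open>A\<close> is invariance of its orthogonal complement under
  \<open>A\<close>.
\<close>
lemma adjoint_of_invariant_range:
  fixes A Q :: "complex Matrix.mat"
  assumes l: "A \<in> carrier_mat d d" and Q: "Q \<in> carrier_mat d m"
    and inv: "mat_adjoint A * Q = Q * (mat_adjoint Q * mat_adjoint A * Q)"
  shows "mat_adjoint Q * A = mat_adjoint Q * A * Q * mat_adjoint Q"
proof -
  note al = mat_adjoint_carrier[OF l] and aQ = mat_adjoint_carrier[OF Q]
  have "mat_adjoint (mat_adjoint A * Q) = mat_adjoint (Q * (mat_adjoint Q * mat_adjoint A * Q))" using inv by simp
  also have "\<dots> = mat_adjoint (mat_adjoint Q * mat_adjoint A * Q) * mat_adjoint Q"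
    using aQ al Q by (intro mat_adjoint_mult) auto
  also have "mat_adjoint (mat_adjoint Q * mat_adjoint A * Q) = mat_adjoint Q * (A * Q)"
    using mat_adjoint_mult[OF mult_carrier_mat[OF aQ al] Q] mat_adjoint_mult[OF aQ al] mat_adjoint_adjoint[OF Q] mat_adjoint_adjoint[OF l] by simp
  also have "\<dots> = mat_adjoint Q * A * Q" using assoc_mult_mat[OF aQ l Q] by simp
  finally show ?thesis using mat_adjoint_mult[OF al Q] mat_adjoint_adjoint[OF l] by simp
qed

text \<open>
  Complete reducibility in the form needed for covariant functions. If the representation has a
  proper invariant subspace, orthonormal bases of this subspace and of its complement, which is
  invariant because the representation is unitary, split \<open>\<phi>\<close> into two covariant functions of smaller
  dimension. Their components span those of \<open>\<phi>\<close>, and induction on the dimension applies.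
\<close>
lemma covariant_components_by_irreducibles:
  fixes G :: "'n::finite sqmat set" and Z :: "('n sqmat \<Rightarrow> complex) set"
  assumes G: "\<And>u v. u \<in> G \<Longrightarrow> v \<in> G \<Longrightarrow> u ** v \<in> G"
    and G1: "idm \<in> G"
    and Ginv: "\<And>u. u \<in> G \<Longrightarrow> \<exists>u'\<in>G. u ** u' = idm"
    and Zcong: "\<And>f g. f \<in> Z \<Longrightarrow> (\<And>k. k \<in> SO \<Longrightarrow> f k = g k) \<Longrightarrow> g \<in> Z"
    and Z0: "(\<lambda>_. 0) \<in> Z" and Zadd: "\<And>f g. f \<in> Z \<Longrightarrow> g \<in> Z \<Longrightarrow> (\<lambda>k. f k + g k) \<in> Z"
    and Zsm: "\<And>c f. f \<in> Z \<Longrightarrow> (\<lambda>k. c * f k) \<in> Z"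
    and irr: "\<And>d lam \<phi> i. irreducible_unitary_rep G d lam \<Longrightarrow> covariant G d lam \<phi> \<Longrightarrow> i < d \<Longrightarrow> (\<lambda>k. vec_index (\<phi> k) i) \<in> Z"
    and rep: "unitary_matrix_rep G d lam" and cov: "covariant G d lam \<phi>" and i: "i < d"
  shows "(\<lambda>k. vec_index (\<phi> k) i) \<in> Z"
  using rep cov i
proof (induction d arbitrary: lam \<phi> i rule: less_induct)
  case (less d)
  note rep = less.prems(1) and cov = less.prems(2) and i = less.prems(3)
  have lc: "lam u \<in> carrier_mat d d" and lu: "mat_adjoint (lam u) * lam u = 1\<^sub>m d" if "u \<in> G" for u
    using rep that unfolding unitary_matrix_rep_def by auto
  have lm: "lam (u ** v) = lam u * lam v" if "u \<in> G" "v \<in> G" for u v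
    using rep that unfolding unitary_matrix_rep_def by auto
  show ?case
  proof (cases "irreducible_unitary_rep G d lam")
    case True
    then show ?thesis using irr cov i by blast
  next
    case False
    then obtain W where W: "VectorSpace.subspace class_ring W (module_vec TYPE(complex) d)"
      and Winv: "\<And>u w. u \<in> G \<Longrightarrow> w \<in> W \<Longrightarrow> lam u *\<^sub>v w \<in> W" and Wne: "W \<noteq> {0\<^sub>v d}" "W \<noteq> carrier_vec d"
      using rep i unfolding irreducible_unitary_rep_def by auto
    have sub: "submodule class_ring W (module_vec TYPE(complex) d)" using W unfolding VectorSpace.subspace_def by blast
    have Wc: "W \<subseteq> carrier_vec d" using submodule.subset[OF sub] by (simp add: module_vec_simps)
    have W0: "0\<^sub>v d \<in> W" using submodule.zero_closed[OF sub] by (simp add: module_vec_simps)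
    have Wadd: "v + w \<in> W" if "v \<in> W" "w \<in> W" for v w
      using submodule.m_closed[OF sub that] by (simp add: module_vec_simps)
    have Wsm: "c \<cdot>\<^sub>v w \<in> W" if "w \<in> W" for c w
      using submodule.smult_closed[OF sub _ that, of c] by (simp add: module_vec_simps class_ring_simps)
    obtain m Q where m: "m \<le> d" and Q: "Q \<in> carrier_mat d m" and Qiso: "mat_adjoint Q * Q = 1\<^sub>m m"
      and QW: "\<And>w. w \<in> carrier_vec d \<Longrightarrow> w \<in> W \<longleftrightarrow> Q *\<^sub>v (mat_adjoint Q *\<^sub>v w) = w"
      using orthonormal_projection_onto[OF Wc W0 Wadd Wsm] by blast
    note aQ = mat_adjoint_carrier[OF Q]
    define W' where "W' = {v \<in> carrier_vec d. mat_adjoint Q *\<^sub>v v = 0\<^sub>v m}"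
    obtain m' R where m': "m' \<le> d" and R: "R \<in> carrier_mat d m'" and Riso: "mat_adjoint R * R = 1\<^sub>m m'"
      and RW: "\<And>w. w \<in> carrier_vec d \<Longrightarrow> w \<in> W' \<longleftrightarrow> R *\<^sub>v (mat_adjoint R *\<^sub>v w) = w"
    proof -
      have "W' \<subseteq> carrier_vec d" "0\<^sub>v d \<in> W'" using aQ unfolding W'_def by auto
      moreover have "v + w \<in> W'" if "v \<in> W'" "w \<in> W'" for v w
        using that mult_add_distrib_mat_vec[OF aQ, of v w] unfolding W'_def by auto
      moreover have "c \<cdot>\<^sub>v w \<in> W'" if "w \<in> W'" for c w
        using that mult_mat_vec[OF aQ, of w c] unfolding W'_def by auto
      ultimately show thesis using orthonormal_projection_onto[of W' d] that by blast
    qed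
    note aR = mat_adjoint_carrier[OF R]
    have md: "m < d"
    proof (rule ccontr)
      assume "\<not> m < d"
      then have [simp]: "m = d" using m by simp
      have "Q * mat_adjoint Q = 1\<^sub>m d" using mat_mult_left_right_inverse[of "mat_adjoint Q" d Q] aQ Q Qiso by simp
      then have "w \<in> W" if "w \<in> carrier_vec d" for w
        using QW[OF that] assoc_mult_mat_vec[OF Q aQ that] that by simp
      then have "W = carrier_vec d" using Wc by blast
      then show False using Wne(2) by blast
    qed
    have QR: "mat_adjoint Q * R = 0\<^sub>m m m'"
    proof (rule eq_matI)
      fix i j assume "i < dim_row (0\<^sub>m m m' :: complex Matrix.mat)" "j < dim_col (0\<^sub>m m m' :: complex Matrix.mat)"
      then have ij: "i < m" "j < m'" by auto
      have e: "unit_vec m' j \<in> carrier_vec m'" by simp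
      have c: "R *\<^sub>v unit_vec m' j \<in> carrier_vec d" using R e by auto
      have "mat_adjoint R *\<^sub>v (R *\<^sub>v unit_vec m' j) = unit_vec m' j"
        using assoc_mult_mat_vec[OF aR R e] Riso e by simp
      then have "R *\<^sub>v unit_vec m' j \<in> W'" using RW[OF c] by simp
      then have "mat_adjoint Q *\<^sub>v (R *\<^sub>v unit_vec m' j) = 0\<^sub>v m" unfolding W'_def by simp
      then have "(mat_adjoint Q * R) *\<^sub>v unit_vec m' j = 0\<^sub>v m" using assoc_mult_mat_vec[OF aQ R e] by simp
      moreover have "(mat_adjoint Q * R) *\<^sub>v unit_vec m' j = col (mat_adjoint Q * R) j"
        using mult_mat_unit_vec[OF mult_carrier_mat[OF aQ R] ij(2)] by simp
      ultimately have "vec_index (col (mat_adjoint Q * R) j) i = 0" using ij by simp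
      then show "index_mat (mat_adjoint Q * R) (i, j) = index_mat (0\<^sub>m m m') (i, j)"
        using ij aQ R by simp
    qed (use aQ R in auto)
    have RQ: "mat_adjoint R * Q = 0\<^sub>m m' m"
    proof -
      have "mat_adjoint (mat_adjoint Q * R) = mat_adjoint R * Q"
        using mat_adjoint_mult[OF aQ R] mat_adjoint_adjoint[OF Q] by simp
      moreover have "mat_adjoint (0\<^sub>m m m' :: complex Matrix.mat) = 0\<^sub>m m' m"
        using mat_adjoint_carrier[of "0\<^sub>m m m' :: complex Matrix.mat" m m']
        by (intro eq_matI) (auto simp: mat_adjoint_index[of _ m m'])
      ultimately show ?thesis using QR by simp
    qed
    have m'd: "m' < d"
    proof (rule ccontr)
      assume "\<not> m' < d"
      then have [simp]: "m' = d" using m' by simp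
      have "R * mat_adjoint R = 1\<^sub>m d" using mat_mult_left_right_inverse[of "mat_adjoint R" d R] aR R Riso by simp
      then have Qz: "Q = R * (mat_adjoint R * Q)" using assoc_mult_mat[OF R aR Q] Q by simp
      have "R * (mat_adjoint R * Q) = 0\<^sub>m d m" unfolding RQ using R by (rule right_mult_zero_mat)
      then have "Q = 0\<^sub>m d m" using Qz by (rule trans[rotated])
      have "w = 0\<^sub>v d" if "w \<in> W" for w
      proof -
        have w: "w \<in> carrier_vec d" using that Wc by auto
        have "w = Q *\<^sub>v (mat_adjoint Q *\<^sub>v w)" using QW[OF w] that by simp
        also have "\<dots> = 0\<^sub>v d"
          unfolding arg_cong[OF \<open>Q = 0\<^sub>m d m\<close>, of "\<lambda>A. A *\<^sub>v (mat_adjoint Q *\<^sub>v w)"]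
          by (rule zero_mat_mult_vec) (use aQ w in auto)
        finally show ?thesis .
      qed
      then have "W = {0\<^sub>v d}" using W0 by blast
      then show False using Wne(1) by blast
    qed
    have decomp: "w = Q *\<^sub>v (mat_adjoint Q *\<^sub>v w) + R *\<^sub>v (mat_adjoint R *\<^sub>v w)" if w: "w \<in> carrier_vec d" for w
    proof -
      define q where "q = Q *\<^sub>v (mat_adjoint Q *\<^sub>v w)"
      have aw: "mat_adjoint Q *\<^sub>v w \<in> carrier_vec m" using aQ w by auto
      have q: "q \<in> carrier_vec d" unfolding q_def using Q aQ w by auto
      define v where "v = w + (-1) \<cdot>\<^sub>v q"
      have v: "v \<in> carrier_vec d" unfolding v_def using w q by auto
      have "mat_adjoint Q *\<^sub>v q = mat_adjoint Q *\<^sub>v w"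
        unfolding q_def using assoc_mult_mat_vec[OF aQ Q aw] Qiso aw by simp
      then have "mat_adjoint Q *\<^sub>v v = mat_adjoint Q *\<^sub>v w + (-1) \<cdot>\<^sub>v (mat_adjoint Q *\<^sub>v w)"
        unfolding v_def using mult_add_distrib_mat_vec[OF aQ w, of "(-1) \<cdot>\<^sub>v q"] mult_mat_vec[OF aQ q, of "-1"] q by simp
      also have "\<dots> = 0\<^sub>v m" by (rule vec_add_neg_cancel(1)[OF aw aw])
      finally have "v \<in> W'" using v unfolding W'_def by simp
      then have Rv: "R *\<^sub>v (mat_adjoint R *\<^sub>v v) = v" using RW[OF v] by simp
      have "mat_adjoint R *\<^sub>v q = 0\<^sub>v m'"
      proof -
        have "mat_adjoint R *\<^sub>v q = (mat_adjoint R * Q) *\<^sub>v (mat_adjoint Q *\<^sub>v w)"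
          unfolding q_def using assoc_mult_mat_vec[OF aR Q aw] by simp
        also have "\<dots> = 0\<^sub>v m'" unfolding RQ using aw by (rule zero_mat_mult_vec)
        finally show ?thesis .
      qed
      then have "mat_adjoint R *\<^sub>v v = mat_adjoint R *\<^sub>v w + (-1) \<cdot>\<^sub>v 0\<^sub>v m'"
        unfolding v_def using mult_add_distrib_mat_vec[OF aR w, of "(-1) \<cdot>\<^sub>v q"] mult_mat_vec[OF aR q, of "-1"] q by simp
      also have "\<dots> = mat_adjoint R *\<^sub>v w" by (rule vec_add_neg_cancel(2)[OF _ zero_carrier_vec]) (use aR w in auto)
      finally have "R *\<^sub>v (mat_adjoint R *\<^sub>v w) = w + (-1) \<cdot>\<^sub>v q" using Rv unfolding v_def by simp
      then show ?thesis unfolding q_def[symmetric] using vec_add_neg_cancel(3)[OF w q] by simp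
    qed
    have QQRR: "A = Q * (mat_adjoint Q * A) + R * (mat_adjoint R * A)" if A: "A \<in> carrier_mat d l" for A l
    proof (rule eq_matI)
      fix i j assume "i < dim_row (Q * (mat_adjoint Q * A) + R * (mat_adjoint R * A))" "j < dim_col (Q * (mat_adjoint Q * A) + R * (mat_adjoint R * A))"
      then have ij: "i < d" "j < l" using R A by auto
      have c: "col A j \<in> carrier_vec d" using A by auto
      have "col (Q * (mat_adjoint Q * A)) j = Q *\<^sub>v (mat_adjoint Q *\<^sub>v col A j)"
        using col_mult2[OF Q mult_carrier_mat[OF aQ A] ij(2)] col_mult2[OF aQ A ij(2)] by simp
      moreover have "col (R * (mat_adjoint R * A)) j = R *\<^sub>v (mat_adjoint R *\<^sub>v col A j)"
        using col_mult2[OF R mult_carrier_mat[OF aR A] ij(2)] col_mult2[OF aR A ij(2)] by simp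
      ultimately have "col A j = col (Q * (mat_adjoint Q * A)) j + col (R * (mat_adjoint R * A)) j"
        using decomp[OF c] by simp
      then have "vec_index (col A j) i = vec_index (col (Q * (mat_adjoint Q * A)) j + col (R * (mat_adjoint R * A)) j) i" by simp
      then show "index_mat A (i, j) = index_mat (Q * (mat_adjoint Q * A) + R * (mat_adjoint R * A)) (i, j)"
        using ij A Q R aQ aR by (simp del: index_mult_mat(1) col_mult2)
    qed (use A R in auto)
    have Qinv: "lam u * Q = Q * (mat_adjoint Q * lam u * Q)" if u: "u \<in> G" for u
    proof -
      have lQ: "lam u * Q \<in> carrier_mat d m" using lc[OF u] Q by auto
      have "mat_adjoint R * (lam u * Q) = 0\<^sub>m m' m"
      proof (rule eq_matI)
        fix i j assume "i < dim_row (0\<^sub>m m' m :: complex Matrix.mat)" "j < dim_col (0\<^sub>m m' m :: complex Matrix.mat)"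
        then have ij: "i < m'" "j < m" by auto
        have cj: "col Q j \<in> carrier_vec d" using Q by auto
        have "mat_adjoint Q *\<^sub>v col Q j = unit_vec m j"
          using col_mult2[OF aQ Q ij(2)] Qiso ij by (metis col_one)
        then have "Q *\<^sub>v (mat_adjoint Q *\<^sub>v col Q j) = col Q j" using mult_mat_unit_vec[OF Q ij(2)] by simp
        then have "col Q j \<in> W" using QW[OF cj] by simp
        then have wW: "lam u *\<^sub>v col Q j \<in> W" using Winv[OF u] by blast
        define w where "w = lam u *\<^sub>v col Q j"
        have w: "w \<in> carrier_vec d" "w \<in> W" using wW Wc by (auto simp: w_def)
        have aw: "mat_adjoint Q *\<^sub>v w \<in> carrier_vec m" using aQ w by auto
        have "mat_adjoint R *\<^sub>v w = mat_adjoint R *\<^sub>v (Q *\<^sub>v (mat_adjoint Q *\<^sub>v w))" using QW[OF w(1)] w by simp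
        also have "\<dots> = (mat_adjoint R * Q) *\<^sub>v (mat_adjoint Q *\<^sub>v w)" using assoc_mult_mat_vec[OF aR Q aw] by simp
        also have "\<dots> = 0\<^sub>v m'" unfolding RQ using aw by (rule zero_mat_mult_vec)
        finally have "col (mat_adjoint R * (lam u * Q)) j = 0\<^sub>v m'"
          unfolding w_def using col_mult2[OF aR lQ ij(2)] col_mult2[OF lc[OF u] Q ij(2)] by simp
        then have "vec_index (col (mat_adjoint R * (lam u * Q)) j) i = 0" using ij by simp
        then show "index_mat (mat_adjoint R * (lam u * Q)) (i, j) = index_mat (0\<^sub>m m' m) (i, j)"
          using ij aR lQ Q by simp
      qed (use aR lQ Q in auto)
      then have "lam u * Q = Q * (mat_adjoint Q * (lam u * Q)) + R * 0\<^sub>m m' m"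
        using QQRR[OF lQ] by simp
      also have "\<dots> = Q * (mat_adjoint Q * (lam u * Q))" using R Q aQ lQ by simp
      finally show ?thesis using assoc_mult_mat[OF aQ lc[OF u] Q] by simp
    qed
    have l1: "lam idm = 1\<^sub>m d"
    proof -
      define A where "A = lam idm"
      have A: "A \<in> carrier_mat d d" "mat_adjoint A * A = 1\<^sub>m d" "A = A * A"
        using lc[OF G1] lu[OF G1] lm[OF G1 G1] unfolding A_def by auto
      \<comment> \<open>A unitary matrix with \<open>A = A * A\<close> is the identity.\<close>
      have "A = (mat_adjoint A * A) * A" using A by simp
      also have "\<dots> = mat_adjoint A * (A * A)" using assoc_mult_mat[OF mat_adjoint_carrier[OF A(1)] A(1) A(1)] .
      finally show ?thesis using A unfolding A_def[symmetric] by simp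
    qed
    have adj: "\<exists>u'\<in>G. lam u' = mat_adjoint (lam u)" if u: "u \<in> G" for u
    proof -
      obtain u' where u': "u' \<in> G" "u ** u' = idm" using Ginv[OF u] by blast
      have "lam u * lam u' = 1\<^sub>m d" using lm[OF u u'(1)] u' l1 by simp
      have al: "mat_adjoint (lam u) \<in> carrier_mat d d" using mat_adjoint_carrier[OF lc[OF u]] .
      have "lam u' = (mat_adjoint (lam u) * lam u) * lam u'" using lu[OF u] lc[OF u'(1)] by simp
      also have "\<dots> = mat_adjoint (lam u) * (lam u * lam u')" using assoc_mult_mat[OF al lc[OF u] lc[OF u'(1)]] .
      also have "\<dots> = mat_adjoint (lam u)" using \<open>lam u * lam u' = 1\<^sub>m d\<close> al by simp
      finally show ?thesis using u' by blast
    qed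
    have Qinv': "mat_adjoint Q * lam u = mat_adjoint Q * lam u * Q * mat_adjoint Q" if u: "u \<in> G" for u
    proof -
      obtain u' where u': "u' \<in> G" "lam u' = mat_adjoint (lam u)" using adj[OF u] by blast
      show ?thesis by (rule adjoint_of_invariant_range[OF lc[OF u] Q Qinv[OF u'(1), unfolded u'(2)]])
    qed
    have Rinv: "lam u * R = R * (mat_adjoint R * lam u * R)" if u: "u \<in> G" for u
    proof -
      note l = lc[OF u]
      have lR: "lam u * R \<in> carrier_mat d m'" using l R by auto
      have "mat_adjoint Q * (lam u * R) = mat_adjoint Q * lam u * R" using assoc_mult_mat[OF aQ l R] by simp
      also have "\<dots> = (mat_adjoint Q * lam u * Q * mat_adjoint Q) * R"
        by (rule arg_cong[OF Qinv'[OF u], of "\<lambda>A. A * R"])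
      also have "\<dots> = mat_adjoint Q * lam u * Q * (mat_adjoint Q * R)"
        by (rule assoc_mult_mat[of _ m m _ d _ m']) (use aQ l Q R in auto)
      also have "\<dots> = 0\<^sub>m m m'" unfolding QR using aQ l Q by (intro right_mult_zero_mat) auto
      finally have "lam u * R = Q * 0\<^sub>m m m' + R * (mat_adjoint R * (lam u * R))" using QQRR[OF lR] by simp
      also have "\<dots> = R * (mat_adjoint R * (lam u * R))" using R Q aR lR by simp
      finally show ?thesis using assoc_mult_mat[OF aR l R] by simp
    qed
    have Rinv': "mat_adjoint R * lam u = mat_adjoint R * lam u * R * mat_adjoint R" if u: "u \<in> G" for u
    proof -
      obtain u' where u': "u' \<in> G" "lam u' = mat_adjoint (lam u)" using adj[OF u] by blast
      show ?thesis by (rule adjoint_of_invariant_range[OF lc[OF u] R Rinv[OF u'(1), unfolded u'(2)]])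
    qed
    have ZQ: "(\<lambda>k. vec_index (mat_adjoint Q *\<^sub>v \<phi> k) j) \<in> Z" if "j < m" for j
      by (rule less.IH[OF md compress_unitary_rep[OF G rep Q Qiso Qinv] compress_covariant[OF rep cov Q Qiso Qinv'] that])
    have ZR: "(\<lambda>k. vec_index (mat_adjoint R *\<^sub>v \<phi> k) j) \<in> Z" if "j < m'" for j
      by (rule less.IH[OF m'd compress_unitary_rep[OF G rep R Riso Rinv] compress_covariant[OF rep cov R Riso Rinv'] that])
    have Zsum: "(\<lambda>k. \<Sum>j<l. c j * f j k) \<in> Z" if "\<And>j. j < l \<Longrightarrow> f j \<in> Z" for l :: nat and c f
      using that
    proof (induction l)
      case (Suc l)
      then have "(\<lambda>k. (\<Sum>j<l. c j * f j k) + c l * f l k) \<in> Z" by (intro Zadd[OF _ Zsm]) auto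
      then show ?case by simp
    qed (simp add: Z0)
    show ?thesis
    proof (rule Zcong)
      show "(\<lambda>k. (\<Sum>j<m. index_mat Q (i, j) * vec_index (mat_adjoint Q *\<^sub>v \<phi> k) j)
          + (\<Sum>j<m'. index_mat R (i, j) * vec_index (mat_adjoint R *\<^sub>v \<phi> k) j)) \<in> Z"
        by (intro Zadd Zsum ZQ ZR)
      fix k assume k: "k \<in> (SO :: 'n sqmat set)"
      have p: "\<phi> k \<in> carrier_vec d" using cov k unfolding covariant_def by blast
      have a: "mat_adjoint Q *\<^sub>v \<phi> k \<in> carrier_vec m" "mat_adjoint R *\<^sub>v \<phi> k \<in> carrier_vec m'" using aQ aR p by auto
      have "vec_index (\<phi> k) i = vec_index (Q *\<^sub>v (mat_adjoint Q *\<^sub>v \<phi> k) + R *\<^sub>v (mat_adjoint R *\<^sub>v \<phi> k)) i"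
        using decomp[OF p] by simp
      also have "\<dots> = vec_index (Q *\<^sub>v (mat_adjoint Q *\<^sub>v \<phi> k)) i + vec_index (R *\<^sub>v (mat_adjoint R *\<^sub>v \<phi> k)) i"
        using i R by simp
      finally show "(\<Sum>j<m. index_mat Q (i, j) * vec_index (mat_adjoint Q *\<^sub>v \<phi> k) j)
          + (\<Sum>j<m'. index_mat R (i, j) * vec_index (mat_adjoint R *\<^sub>v \<phi> k) j) = vec_index (\<phi> k) i"
        unfolding index_mult_vec_sum[OF Q a(1) i] index_mult_vec_sum[OF R a(2) i] by simp
    qed
  qed
qed


lemma prod_sum_PiE_UNIV:
  fixes f :: "nat \<Rightarrow> 'n::finite \<Rightarrow> 'c::comm_semiring_1"
  shows "(\<Prod>s<m. \<Sum>x\<in>UNIV. f s x) = (\<Sum>h\<in>Pi\<^sub>E {..<m} (\<lambda>_. UNIV). \<Prod>s<m. f s (h s))"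
  by (rule prod_sum_PiE) auto

lemma mat_entry_mult: "vec_nth (vec_nth ((u :: 'n::finite sqmat) ** k) i) j = (\<Sum>x\<in>UNIV. vec_nth (vec_nth u i) x * vec_nth (vec_nth k x) j)"
  by (simp add: matrix_matrix_mult_def)

lemma SO_columns_orthonormal:
  assumes "u \<in> (SO :: 'n::finite sqmat set)"
  shows "(\<Sum>x\<in>UNIV. vec_nth (vec_nth u x) i * vec_nth (vec_nth u x) j) = (if i = j then 1 else 0)"
proof -
  have "tp u ** u = idm"
    using assms by (simp add: SO_def rotation_matrix_def orthogonal_matrix_def)
  then have "vec_nth (vec_nth (tp u ** u) i) j = (if i = j then 1 else 0)"
    by (simp add: Finite_Cartesian_Product.mat_def)
  then show ?thesis by (simp add: mat_entry_mult Finite_Cartesian_Product.transpose_def)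
qed

text \<open>
  For a fixed multi-index \<open>c\<close>, the monomials \<open>\<Prod>\<^sub>s k\<^bsub>f(s) c(s)\<^esub>\<close> with varying \<open>f\<close> are a column of the
  \<open>m\<close>-fold tensor power of \<open>k\<close>. Multiplying \<open>k\<close> by \<open>u\<close> from the left multiplies this column by the
  tensor power of \<open>u\<close>, which is an orthogonal matrix. The bijection \<open>h\<close> numbers the multi-indices.
\<close>
lemma monomials_are_covariant_components:
  fixes G :: "'n::finite sqmat set" and r c :: "nat \<Rightarrow> 'n"
  assumes GSO: "G \<subseteq> SO"
  shows "\<exists>d lam \<phi> i. unitary_matrix_rep G d lam \<and> covariant G d lam \<phi> \<and> i < d \<and>
    (\<forall>k. vec_index (\<phi> k) i = of_real (\<Prod>s<m. vec_nth (vec_nth k (r s)) (c s)))"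
proof -
  define I where "I = Pi\<^sub>E {..<m} (\<lambda>_. UNIV :: 'n set)"
  have finI: "finite I" unfolding I_def by (intro finite_PiE) auto
  obtain h where h: "bij_betw h {..<card I} I" using ex_bij_betw_nat_finite[OF finI] by (auto simp: lessThan_atLeast0)
  define d where "d = card I"
  have hI: "h a \<in> I" if "a < d" for a using h that unfolding d_def bij_betw_def by auto
  have hinj: "h a = h b \<longleftrightarrow> a = b" if "a < d" "b < d" for a b
    using h that unfolding d_def bij_betw_def inj_on_def by auto
  have sumI: "(\<Sum>a<d. F (h a)) = (\<Sum>f\<in>I. F f)" for F :: "(nat \<Rightarrow> 'n) \<Rightarrow> complex"
    unfolding d_def by (rule sum.reindex_bij_betw[OF h])
  define E where "E = (\<lambda>(k::'n sqmat) (f::nat\<Rightarrow>'n) (g::nat\<Rightarrow>'n). complex_of_real (\<Prod>s<m. vec_nth (vec_nth k (f s)) (g s)))"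
  have Emult: "E (u ** k) f g = (\<Sum>e\<in>I. E u f e * E k e g)" for u k f g
    unfolding E_def I_def mat_entry_mult prod_sum_PiE_UNIV
    by (simp add: prod.distrib)
  define lam where "lam = (\<lambda>u. Matrix.mat d d (\<lambda>(a, b). E u (h a) (h b)))"
  define \<phi> where "\<phi> = (\<lambda>k. Matrix.vec d (\<lambda>a. E k (h a) c))"
  have lc: "lam u \<in> carrier_mat d d" for u by (simp add: lam_def)
  have pc: "\<phi> k \<in> carrier_vec d" for k by (simp add: \<phi>_def)
  have contE: "continuous_on S (\<lambda>k. E k f g)" for S f g
    unfolding E_def by (intro continuous_intros)
  have "mat_adjoint (lam u) * lam u = 1\<^sub>m d" if "u \<in> G" for u
  proof (rule eq_matI)
    note al = mat_adjoint_carrier[OF lc]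
    fix a b assume "a < dim_row (1\<^sub>m d)" "b < dim_col (1\<^sub>m d)"
    then have ab: "a < d" "b < d" by auto
    have "index_mat (mat_adjoint (lam u) * lam u) (a, b) = (\<Sum>e<d. E u (h e) (h a) * E u (h e) (h b))"
      unfolding index_mult_sum[OF al lc ab]
    proof (intro sum.cong refl)
      fix e assume "e \<in> {..<d}"
      then show "index_mat (mat_adjoint (lam u)) (a, e) * index_mat (lam u) (e, b) = E u (h e) (h a) * E u (h e) (h b)"
        using ab by (subst mat_adjoint_index[OF lc]) (auto simp: lam_def E_def)
    qed
    also have "\<dots> = (\<Sum>f\<in>I. E u f (h a) * E u f (h b))" by (rule sumI)
    also have "\<dots> = of_real (\<Prod>s<m. \<Sum>x\<in>UNIV. vec_nth (vec_nth u x) (h a s) * vec_nth (vec_nth u x) (h b s))"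
      unfolding prod_sum_PiE_UNIV by (simp add: E_def I_def prod.distrib)
    also have "\<dots> = of_real (\<Prod>s<m. if h a s = h b s then 1 else 0)"
    proof -
      have "u \<in> SO" using that GSO by blast
      from SO_columns_orthonormal[OF this] show ?thesis by (simp only:)
    qed
    also have "\<dots> = (if a = b then 1 else 0)"
    proof (cases "a = b")
      case False
      then have "h a \<noteq> h b" using hinj ab by blast
      then obtain s where "s < m" "h a s \<noteq> h b s"
        using PiE_ext[OF hI[OF ab(1), unfolded I_def] hI[OF ab(2), unfolded I_def]] by auto
      then have "(\<Prod>s<m. if h a s = h b s then 1 else 0 :: real) = 0" by (intro prod_zero) auto
      then show ?thesis using False by simp
    qed simp
    finally show "index_mat (mat_adjoint (lam u) * lam u) (a, b) = index_mat (1\<^sub>m d) (a, b)" using ab by simp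
  qed (use lc mat_adjoint_carrier[OF lc] in auto)
  moreover have "lam (u ** v) = lam u * lam v" for u v
  proof (rule eq_matI)
    fix a b assume "a < dim_row (lam u * lam v)" "b < dim_col (lam u * lam v)"
    then have ab: "a < d" "b < d" using lc[of u] lc[of v] by auto
    show "index_mat (lam (u ** v)) (a, b) = index_mat (lam u * lam v) (a, b)"
      unfolding index_mult_sum[OF lc lc ab] using ab by (simp add: lam_def Emult sumI[symmetric])
  qed (auto simp: lam_def)
  moreover have "continuous_on G (\<lambda>u. index_mat (lam u) (i, j))" if "i < d" "j < d" for i j
    using that contE by (simp add: lam_def)
  ultimately have rep: "unitary_matrix_rep G d lam" unfolding unitary_matrix_rep_def using lc by blast
  have "\<phi> (u ** k) = lam u *\<^sub>v \<phi> k" for u k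
  proof (rule eq_vecI)
    fix a assume "a < dim_vec (lam u *\<^sub>v \<phi> k)"
    then have a: "a < d" using lc[of u] by auto
    show "vec_index (\<phi> (u ** k)) a = vec_index (lam u *\<^sub>v \<phi> k) a"
      unfolding index_mult_vec_sum[OF lc pc a] using a by (simp add: \<phi>_def lam_def Emult sumI[symmetric])
  qed (auto simp: lam_def \<phi>_def)
  moreover have "continuous_on SO (\<lambda>k. vec_index (\<phi> k) i)" if "i < d" for i
    using that contE by (simp add: \<phi>_def)
  ultimately have cov: "covariant G d lam \<phi>" unfolding covariant_def using pc by blast
  have "restrict r {..<m} \<in> I" unfolding I_def by auto
  then obtain i where i: "i < d" "h i = restrict r {..<m}" using h unfolding d_def bij_betw_def by (metis imageE lessThan_iff)
  have "vec_index (\<phi> k) i = of_real (\<Prod>s<m. vec_nth (vec_nth k (r s)) (c s))" for k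
    using i by (simp add: \<phi>_def E_def)
  then show ?thesis using rep cov i by blast
qed

lemma K1_mult:
  assumes "u \<in> K1" "v \<in> K1"
  shows "u ** v \<in> (K1 :: 'n::{finite,linorder} sqmat set)"
  using assms unfolding K1_eq_stabilizer[of 1, simplified]
  by (auto simp: SO_def rotation_matrix_def orthogonal_matrix_mul det_mul matrix_vector_mul_assoc[symmetric])

lemma K1_one: "idm \<in> (K1 :: 'n::{finite,linorder} sqmat set)"
  unfolding K1_eq_stabilizer[of 1, simplified]
  by (auto simp: SO_def rotation_matrix_def orthogonal_matrix_id)

lemma K1_inverse:
  assumes "u \<in> (K1 :: 'n::{finite,linorder} sqmat set)"
  shows "\<exists>u'\<in>K1. u ** u' = idm"
proof (intro bexI[of _ "tp u"])
  have u: "orthogonal_matrix u" "det u = 1" using assms by (auto simp: K1_def SO_def rotation_matrix_def)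
  then show "u ** tp u = idm" by (simp add: orthogonal_matrix_def)
  show "tp u \<in> K1"
  proof -
    have "vec_nth (vec_nth (tp u) i) j = vec_nth (vec_nth u j) i" for i j
      by (simp add: Finite_Cartesian_Product.transpose_def)
    then show ?thesis using assms u unfolding K1_def SO_def rotation_matrix_def by simp
  qed
qed

text \<open>
  In the application \<open>Z\<close> consists of the functions orthogonal to the kernel of the Fourier transform.
  It is closed under linear combinations, so the two preceding lemmas reduce its membership
  conditions for monomials to those for irreducible representations of the stabilizer.
\<close>
lemma monomials_by_irreducibles:
  fixes Z :: "('n::{finite,linorder} sqmat \<Rightarrow> complex) set" and r c :: "nat \<Rightarrow> 'n"
  assumes Zcong: "\<And>f g. f \<in> Z \<Longrightarrow> (\<And>k. k \<in> SO \<Longrightarrow> f k = g k) \<Longrightarrow> g \<in> Z"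
    and Z0: "(\<lambda>_. 0) \<in> Z" and Zadd: "\<And>f g. f \<in> Z \<Longrightarrow> g \<in> Z \<Longrightarrow> (\<lambda>k. f k + g k) \<in> Z"
    and Zsm: "\<And>c f. f \<in> Z \<Longrightarrow> (\<lambda>k. c * f k) \<in> Z"
    and irr: "\<And>d lam \<phi> i. irreducible_unitary_rep K1 d lam \<Longrightarrow> covariant K1 d lam \<phi> \<Longrightarrow> i < d \<Longrightarrow> (\<lambda>k. vec_index (\<phi> k) i) \<in> Z"
  shows "(\<lambda>k. of_real (\<Prod>s<m. vec_nth (vec_nth k (r s)) (c s))) \<in> Z"
proof -
  have "K1 \<subseteq> (SO :: 'n sqmat set)" by (auto simp: K1_def)
  from monomials_are_covariant_components[OF this, where m = m and r = r and c = c]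
  obtain d lam \<phi> i where *: "unitary_matrix_rep (K1 :: 'n sqmat set) d lam" "covariant K1 d lam \<phi>" "i < d"
    "\<And>k. vec_index (\<phi> k) i = of_real (\<Prod>s<m. vec_nth (vec_nth k (r s)) (c s))" by blast
  have "(\<lambda>k. vec_index (\<phi> k) i) \<in> Z"
    by (rule covariant_components_by_irreducibles[OF K1_mult K1_one K1_inverse Zcong Z0 Zadd Zsm irr *(1,2,3)])
  then show ?thesis by (rule Zcong) (use * in simp)
qed

section \<open>The rotation group and the kernel of the group Fourier transform\<close>

lemma SO_iff: "k \<in> SO \<longleftrightarrow> orthogonal_matrix k \<and> det k = 1"
  by (simp add: SO_def rotation_matrix_def)

lemma SO_mult: "u \<in> SO \<Longrightarrow> v \<in> SO \<Longrightarrow> u ** v \<in> SO"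
  by (simp add: SO_iff orthogonal_matrix_mul det_mul)

lemma SO_transpose: "u \<in> SO \<Longrightarrow> tp u \<in> SO"
  by (simp add: SO_iff)

lemma SO_one: "idm \<in> SO"
  by (simp add: SO_iff orthogonal_matrix_id)

lemma SO_inverse:
  assumes "u \<in> SO"
  shows "tp u ** u = idm"
    "u ** tp u = idm"
    "matrix_inv u = tp u"
proof -
  show 1: "tp u ** u = idm"
    "u ** tp u = idm"
    using assms by (auto simp: SO_iff orthogonal_matrix_def)
  show "matrix_inv u = tp u"
  proof -
    have "invertible u" using 1 unfolding invertible_def by blast
    then have "matrix_inv u ** u = idm"
      unfolding matrix_inv_def invertible_def by (metis (mono_tags, lifting) someI_ex)
    then have "matrix_inv u ** (u ** tp u) = tp u"
      by (simp add: matrix_mul_assoc)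
    then show ?thesis by (simp add: 1)
  qed
qed

lemma SO_cancel:
  assumes "u \<in> SO"
  shows "tp u ** (u ** k) = k" "u ** (tp u ** k) = k"
  by (simp_all add: matrix_mul_assoc SO_inverse[OF assms])

lemma SO_norm:
  assumes "u \<in> SO"
  shows "norm (u *v x) = norm x"
proof -
  have "orthogonal_transformation ((*v) u)"
    using assms by (simp add: orthogonal_transformation_matrix SO_iff)
  then show ?thesis by (rule orthogonal_transformation_norm)
qed

lemma xi_scaleR: "(xi r :: 'n::{finite,linorder} rvec) = r *\<^sub>R xi 1"
  by (simp add: xi_def axis_def vec_eq_iff)

lemma norm_xi: "norm (xi r :: 'n::{finite,linorder} rvec) = \<bar>r\<bar>"
  by (subst xi_scaleR) (simp add: xi_def norm_axis_1)

lemma continuous_on_matrix_mult [continuous_intros]: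
  fixes a :: "'t::topological_space \<Rightarrow> real ^ 'n::finite ^ 'm::finite" and b :: "'t \<Rightarrow> real ^ 'p::finite ^ 'n"
  assumes "continuous_on S a" "continuous_on S b"
  shows "continuous_on S (\<lambda>t. a t ** b t)"
  unfolding matrix_matrix_mult_def by (intro continuous_intros assms)

lemma continuous_on_transpose [continuous_intros]:
  fixes a :: "'t::topological_space \<Rightarrow> real ^ 'n::finite ^ 'm::finite"
  assumes "continuous_on S a"
  shows "continuous_on S (\<lambda>t. tp (a t))"
  unfolding Finite_Cartesian_Product.transpose_def by (intro continuous_intros assms)

lemma continuous_on_matrix_vector_mult' [continuous_intros]:
  fixes a :: "'t::topological_space \<Rightarrow> real ^ 'n::finite ^ 'm::finite"
  assumes "continuous_on S a" "continuous_on S b"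
  shows "continuous_on S (\<lambda>t. a t *v b t)"
  unfolding matrix_vector_mult_def by (intro continuous_intros assms)

lemma compact_SO: "compact (SO :: 'n::finite sqmat set)"
proof -
  have eq: "(SO :: 'n sqmat set) = {k. tp k ** k = idm} \<inter> {k. det k = 1}"
    by (auto simp: SO_iff orthogonal_matrix)
  have "closed {k::'n sqmat. tp k ** k = idm}"
    by (intro closed_Collect_eq continuous_intros)
  moreover have "closed {k::'n sqmat. det k = 1}"
    unfolding Determinants.det_def by (intro closed_Collect_eq continuous_intros)
  ultimately have "closed (SO :: 'n sqmat set)" unfolding eq by (rule closed_Int)
  moreover have "bounded (SO :: 'n sqmat set)"
  proof (rule boundedI)
    fix k :: "'n sqmat" assume "k \<in> SO"
    then have "norm (vec_nth k i) = 1" for i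
      using orthogonal_matrix_orthonormal_rows by (auto simp: SO_iff row_def)
    then have "norm k \<le> (\<Sum>i\<in>(UNIV::'n set). 1)"
      unfolding norm_vec_def[of k] by (intro order_trans[OF L2_set_le_sum]) auto
    then show "norm k \<le> real CARD('n)" by simp
  qed
  ultimately show ?thesis by (simp add: compact_eq_bounded_closed)
qed

lemma integrable_pair_product:
  fixes u :: "'a \<Rightarrow> complex" and v :: "'b \<Rightarrow> complex"
  assumes "pair_sigma_finite M1 M2" and u: "integrable M1 u" and v: "integrable M2 v"
  shows "integrable (M1 \<Otimes>\<^sub>M M2) (\<lambda>p. u (fst p) * v (snd p))"
proof -
  interpret pair_sigma_finite M1 M2 by fact
  have um: "u \<in> borel_measurable M1" and vm: "v \<in> borel_measurable M2" using u v by auto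
  show ?thesis
  proof (rule integrableI_bounded)
    show m: "(\<lambda>p. u (fst p) * v (snd p)) \<in> borel_measurable (M1 \<Otimes>\<^sub>M M2)"
      using um vm by (intro borel_measurable_times measurable_compose[OF measurable_fst] measurable_compose[OF measurable_snd])
    have "(\<lambda>p. ennreal (norm (u (fst p) * v (snd p)))) \<in> borel_measurable (M1 \<Otimes>\<^sub>M M2)" using m by measurable
    from M2.nn_integral_fst[OF this, symmetric]
    have "(\<integral>\<^sup>+p. ennreal (norm (u (fst p) * v (snd p))) \<partial>(M1 \<Otimes>\<^sub>M M2))
        = (\<integral>\<^sup>+x. \<integral>\<^sup>+y. ennreal (norm (u x)) * ennreal (norm (v y)) \<partial>M2 \<partial>M1)"
      by (simp add: norm_mult ennreal_mult)
    also have "\<dots> = (\<integral>\<^sup>+x. ennreal (norm (u x)) \<partial>M1) * (\<integral>\<^sup>+y. ennreal (norm (v y)) \<partial>M2)"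
      using um vm by (simp add: nn_integral_cmult nn_integral_multc)
    also have "\<dots> < \<infinity>"
      using u v unfolding integrable_iff_bounded by (simp add: ennreal_mult_less_top)
    finally show "(\<integral>\<^sup>+p. ennreal (norm (u (fst p) * v (snd p))) \<partial>(M1 \<Otimes>\<^sub>M M2)) < \<infinity>" .
  qed
qed

locale haar_SO =
  fixes \<mu> :: "'n::finite sqmat measure"
  assumes haar: "normalized_haar_measure SO \<mu>"
begin

lemma sets_mu: "sets \<mu> = sets (restrict_space borel SO)"
  using haar by (simp add: normalized_haar_measure_def)

lemma space_mu: "space \<mu> = SO"
  using sets_eq_imp_space_eq[OF sets_mu] by (simp add: space_restrict_space)

sublocale prob_space \<mu>
  by (rule prob_spaceI) (use haar in \<open>simp add: normalized_haar_measure_def space_mu\<close>)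

lemma measurable_mu_continuous_on:
  fixes q :: "'n sqmat \<Rightarrow> 'b::topological_space"
  assumes "continuous_on SO q"
  shows "q \<in> borel_measurable \<mu>"
  using borel_measurable_continuous_on_restrict[OF assms] measurable_cong_sets[OF sets_mu refl] by blast

lemma integrable_continuous_on:
  fixes q :: "'n sqmat \<Rightarrow> complex"
  assumes q: "continuous_on SO q"
  shows "integrable \<mu> q"
proof -
  obtain B where "\<And>k. k \<in> SO \<Longrightarrow> norm (q k) \<le> B"
    using compact_imp_bounded[OF compact_continuous_image[OF q compact_SO]] unfolding bounded_iff by blast
  then show ?thesis
    by (intro integrable_const_bound[of q B]) (auto simp: space_mu measurable_mu_continuous_on[OF q])
qed

lemma measurable_left_mult: "g \<in> SO \<Longrightarrow> (\<lambda>k. g ** k) \<in> measurable \<mu> \<mu>"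
proof -
  assume g: "g \<in> SO"
  have "(\<lambda>k. g ** k) \<in> borel_measurable \<mu>"
    by (intro measurable_mu_continuous_on continuous_intros)
  then have "(\<lambda>k. g ** k) \<in> measurable \<mu> (restrict_space borel SO)"
    by (rule measurable_restrict_space2[rotated]) (use g SO_mult in \<open>auto simp: space_mu\<close>)
  then show ?thesis using measurable_cong_sets[OF refl sets_mu] by blast
qed

lemma integral_left_mult:
  fixes h :: "'n sqmat \<Rightarrow> complex"
  assumes "g \<in> SO" "h \<in> borel_measurable \<mu>"
  shows "(LINT k|\<mu>. h (g ** k)) = (LINT k|\<mu>. h k)"
proof -
  have "distr \<mu> \<mu> (\<lambda>k. g ** k) = \<mu>" using haar assms by (simp add: normalized_haar_measure_def)
  then show ?thesis using integral_distr[OF measurable_left_mult[OF assms(1)] assms(2)] by simp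
qed

lemma nn_integral_left_mult:
  assumes "g \<in> SO" "h \<in> borel_measurable \<mu>"
  shows "(\<integral>\<^sup>+k. h (g ** k) \<partial>\<mu>) = (\<integral>\<^sup>+k. h k \<partial>\<mu>)"
proof -
  have "distr \<mu> \<mu> (\<lambda>k. g ** k) = \<mu>" using haar assms by (simp add: normalized_haar_measure_def)
  then show ?thesis using nn_integral_distr[OF measurable_left_mult[OF assms(1)], of h] assms by simp
qed

text \<open>
  The Haar measure charges every non-empty open set: by compactness, finitely many translates of the
  set where \<open>q\<close> does not vanish cover the group, and they would all be null sets.
\<close>
lemma AE_zero_imp_zero:
  fixes q :: "'n sqmat \<Rightarrow> complex"
  assumes q: "continuous_on SO q" and ae: "AE k in \<mu>. q k = 0" and k: "k \<in> SO"
  shows "q k = 0"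
proof (rule ccontr)
  assume nz: "q k \<noteq> 0"
  have "\<exists>U. open U \<and> q -` (- {0}) \<inter> SO = U \<inter> SO"
    using q unfolding continuous_on_open_invariant by (metis open_Compl closed_singleton)
  then obtain U where U: "open U" "q -` (- {0}) \<inter> SO = U \<inter> SO" by blast
  define V where "V = (\<lambda>g::'n sqmat. {x::'n sqmat. tp g ** x \<in> U})"
  have V: "open (V g)" for g
  proof -
    have "continuous_on UNIV (\<lambda>x. tp g ** x)" by (intro continuous_intros)
    then have "open ((\<lambda>x. tp g ** x) -` U)" using U(1) by (rule open_vimage[rotated])
    then show ?thesis by (simp add: V_def vimage_def)
  qed
  have "SO \<subseteq> (\<Union>g\<in>SO. V g)"
  proof
    fix x :: "'n sqmat" assume x: "x \<in> SO"
    define g where "g = x ** tp k"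
    have "g \<in> SO" unfolding g_def using x k by (intro SO_mult SO_transpose)
    moreover have "tp g ** x = k"
      unfolding g_def using x SO_inverse(1)[OF x] by (simp add: matrix_transpose_mul matrix_mul_assoc[symmetric])
    moreover have "k \<in> U" using nz k U by auto
    ultimately show "x \<in> (\<Union>g\<in>SO. V g)" by (auto simp: V_def)
  qed
  then obtain C where C: "C \<subseteq> SO" "finite C" "SO \<subseteq> (\<Union>g\<in>C. V g)"
    using compactE_image[OF compact_SO, of SO V] V by blast
  have "AE x in \<mu>. x \<notin> V g" if "g \<in> SO" for g
  proof -
    have g': "tp g \<in> SO" using that by (rule SO_transpose)
    have eq: "distr \<mu> \<mu> (\<lambda>k. tp g ** k) = \<mu>" using haar g' by (simp add: normalized_haar_measure_def)
    have "AE x in distr \<mu> \<mu> (\<lambda>k. tp g ** k). q x = 0" by (subst eq) (rule ae)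
    then have "AE x in \<mu>. q (tp g ** x) = 0"
      using measurable_left_mult[OF g'] measurable_mu_continuous_on[OF q] by (subst (asm) AE_distr_iff) auto
    moreover have "AE x in \<mu>. x \<in> SO" using AE_space[of \<mu>] by (simp add: space_mu)
    ultimately show ?thesis
    proof eventually_elim
      case (elim x)
      then have "tp g ** x \<in> SO" using g' SO_mult by blast
      then show ?case using elim U by (auto simp: V_def)
    qed
  qed
  then have "AE x in \<mu>. \<forall>g\<in>C. x \<notin> V g" using C by (intro AE_finite_allI) auto
  moreover have "AE x in \<mu>. x \<in> SO" using AE_space[of \<mu>] by (simp add: space_mu)
  ultimately have "AE x in \<mu>. False" by eventually_elim (use C in auto)
  then show False by simp
qed

lemma borel_measurable_on_product:
  fixes h :: "('n sqmat \<times> 'n sqmat) \<times> 'n rvec \<Rightarrow> 'b::topological_space"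
  assumes "h \<in> borel_measurable borel"
  shows "h \<in> borel_measurable ((\<mu> \<Otimes>\<^sub>M \<mu>) \<Otimes>\<^sub>M lborel)"
proof -
  have id: "(\<lambda>k. k) \<in> borel_measurable \<mu>" by (intro measurable_mu_continuous_on continuous_intros)
  have "(\<lambda>p. ((fst (fst p), snd (fst p)), snd p)) \<in> ((\<mu> \<Otimes>\<^sub>M \<mu>) \<Otimes>\<^sub>M lborel) \<rightarrow>\<^sub>M ((borel \<Otimes>\<^sub>M borel) \<Otimes>\<^sub>M borel)"
    by (intro measurable_Pair measurable_compose[OF measurable_compose[OF measurable_fst measurable_fst] id]
        measurable_compose[OF measurable_compose[OF measurable_fst measurable_snd] id]
        measurable_compose[OF measurable_snd measurable_ident_sets[OF sets_lborel]])
  then have "(\<lambda>p. p) \<in> ((\<mu> \<Otimes>\<^sub>M \<mu>) \<Otimes>\<^sub>M lborel) \<rightarrow>\<^sub>M (borel :: (('n sqmat \<times> 'n sqmat) \<times> 'n rvec) measure)"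
    by (simp add: borel_prod)
  then show ?thesis using assms measurable_compose by blast
qed

lemma borel_measurable_on_pair:
  fixes h :: "'n sqmat \<times> 'n sqmat \<Rightarrow> 'b::topological_space"
  assumes "continuous_on (SO \<times> SO) h"
  shows "h \<in> borel_measurable (\<mu> \<Otimes>\<^sub>M \<mu>)"
proof -
  have id: "(\<lambda>k. k) \<in> borel_measurable \<mu>" by (intro measurable_mu_continuous_on continuous_intros)
  have "(\<lambda>p. (fst p, snd p)) \<in> (\<mu> \<Otimes>\<^sub>M \<mu>) \<rightarrow>\<^sub>M (borel \<Otimes>\<^sub>M borel)"
    by (intro measurable_Pair measurable_compose[OF measurable_fst id] measurable_compose[OF measurable_snd id])
  then have "(\<lambda>p. p) \<in> (\<mu> \<Otimes>\<^sub>M \<mu>) \<rightarrow>\<^sub>M (borel :: ('n sqmat \<times> 'n sqmat) measure)"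
    by (simp add: borel_prod)
  then have "(\<lambda>p. p) \<in> (\<mu> \<Otimes>\<^sub>M \<mu>) \<rightarrow>\<^sub>M restrict_space borel (SO \<times> SO)"
    by (rule measurable_restrict_space2[rotated]) (auto simp: space_pair_measure space_mu)
  then show ?thesis using borel_measurable_continuous_on_restrict[OF assms] measurable_compose by blast
qed

lemma measurable_shear: "(\<lambda>p. (fst p, fst p ** snd p)) \<in> (\<mu> \<Otimes>\<^sub>M \<mu>) \<rightarrow>\<^sub>M (\<mu> \<Otimes>\<^sub>M \<mu>)"
proof (rule measurable_Pair)
  have "(\<lambda>p. fst p ** snd p) \<in> borel_measurable (\<mu> \<Otimes>\<^sub>M \<mu>)"
    by (intro borel_measurable_on_pair continuous_intros)
  then have "(\<lambda>p. fst p ** snd p) \<in> (\<mu> \<Otimes>\<^sub>M \<mu>) \<rightarrow>\<^sub>M restrict_space borel SO"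
    by (rule measurable_restrict_space2[rotated]) (auto simp: space_pair_measure space_mu SO_mult)
  then show "(\<lambda>p. fst p ** snd p) \<in> (\<mu> \<Otimes>\<^sub>M \<mu>) \<rightarrow>\<^sub>M \<mu>"
    using measurable_cong_sets[OF refl sets_mu] by blast
qed simp

sublocale PP: pair_prob_space \<mu> \<mu> ..
sublocale PL: pair_sigma_finite "\<mu> \<Otimes>\<^sub>M \<mu>" "lborel :: 'n rvec measure" ..
sublocale LM: pair_sigma_finite "lborel :: 'n rvec measure" \<mu> ..

text \<open>
  By left invariance in the second variable, the shear \<open>(k0, k) \<mapsto> (k0, k0 k)\<close> preserves the product
  measure.
\<close>
lemma integrable_shear:
  fixes Th :: "'n sqmat \<times> 'n sqmat \<Rightarrow> complex"
  assumes Th: "integrable (\<mu> \<Otimes>\<^sub>M \<mu>) Th"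
  shows "integrable (\<mu> \<Otimes>\<^sub>M \<mu>) (\<lambda>p. Th (fst p, fst p ** snd p))"
proof (rule integrableI_bounded)
  have m: "Th \<in> borel_measurable (\<mu> \<Otimes>\<^sub>M \<mu>)" using Th by auto
  show m': "(\<lambda>p. Th (fst p, fst p ** snd p)) \<in> borel_measurable (\<mu> \<Otimes>\<^sub>M \<mu>)"
    using measurable_compose[OF measurable_shear m] .
  have "(\<integral>\<^sup>+p. ennreal (norm (Th (fst p, fst p ** snd p))) \<partial>(\<mu> \<Otimes>\<^sub>M \<mu>))
      = (\<integral>\<^sup>+k0. \<integral>\<^sup>+k. ennreal (norm (Th (k0, k0 ** k))) \<partial>\<mu> \<partial>\<mu>)"
    using m' by (subst nn_integral_fst[symmetric]) auto
  also have "\<dots> = (\<integral>\<^sup>+k0. \<integral>\<^sup>+k. ennreal (norm (Th (k0, k))) \<partial>\<mu> \<partial>\<mu>)"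
  proof (rule nn_integral_cong)
    fix k0 assume k0: "k0 \<in> space \<mu>"
    have "(\<lambda>k. Th (k0, k)) \<in> borel_measurable \<mu>" using measurable_Pair2[OF m k0] .
    then have "(\<lambda>k. ennreal (norm (Th (k0, k)))) \<in> borel_measurable \<mu>" by measurable
    from nn_integral_left_mult[OF _ this, of k0] k0
    show "(\<integral>\<^sup>+k. ennreal (norm (Th (k0, k0 ** k))) \<partial>\<mu>) = (\<integral>\<^sup>+k. ennreal (norm (Th (k0, k))) \<partial>\<mu>)"
      by (simp add: space_mu)
  qed
  also have "\<dots> = (\<integral>\<^sup>+p. ennreal (norm (Th p)) \<partial>(\<mu> \<Otimes>\<^sub>M \<mu>))"
    using m by (subst nn_integral_fst[symmetric]) auto
  also have "\<dots> < \<infinity>" using Th by (simp add: integrable_iff_bounded)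
  finally show "(\<integral>\<^sup>+p. ennreal (norm (Th (fst p, fst p ** snd p))) \<partial>(\<mu> \<Otimes>\<^sub>M \<mu>)) < \<infinity>" .
qed

end


locale motion_kernel = haar_SO \<mu> for \<mu> :: "'n::{finite,linorder} sqmat measure" +
  fixes f :: "'n rvec \<times> 'n sqmat \<Rightarrow> complex" and B R :: real
  assumes cont_f: "continuous_on (UNIV \<times> SO) f"
    and supp_f: "\<And>x k. k \<in> SO \<Longrightarrow> norm x > R \<Longrightarrow> f (x, k) = 0"
    and bound_f: "\<And>x k. k \<in> SO \<Longrightarrow> norm (f (x, k)) \<le> B"
begin

text \<open>
  The factor by which \<open>T_rep r\<close> multiplies at the point \<open>k0\<close>; on rotations, \<open>tp\<close> is the inverse.
\<close>
definition phase :: "real \<Rightarrow> 'n sqmat \<Rightarrow> 'n rvec \<Rightarrow> complex" where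
  "phase r k0 x = exp (\<i> * of_real ((tp k0 *v xi r) \<bullet> x))"

definition kern :: "real \<Rightarrow> 'n sqmat \<Rightarrow> 'n sqmat \<Rightarrow> complex" where
  "kern r k0 k = (LINT x|lborel. f (x, tp k0 ** k) * phase r k0 x)"

text \<open>
  An integrable majorant of \<open>f(\<cdot>, k)\<close>, uniform in \<open>k\<close>.
\<close>
definition dom :: "'n rvec \<Rightarrow> real" where "dom x = B * indicator (cball 0 R) x"

lemma norm_phase: "norm (phase r k0 x) = 1"
  by (simp add: phase_def norm_exp_eq_Re)

lemma phase_eq: "phase r k0 x = exp (\<i> * of_real (r * ((tp k0 *v xi 1) \<bullet> x)))"
proof -
  show ?thesis unfolding phase_def by (subst xi_scaleR) (simp add: matrix_vector_mult_scaleR)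
qed

lemma integrable_dom: "integrable lborel dom"
  unfolding dom_def by (rule integrable_cball_indicator)

lemma norm_f_le: "k \<in> SO \<Longrightarrow> norm (f (x, k)) \<le> dom x"
  using bound_f[of k x] supp_f[of k x] by (cases "norm x > R") (auto simp: dom_def indicator_def)

lemma dom_nonneg: "dom x \<ge> 0"
  using norm_f_le[OF SO_one, of x] norm_ge_zero order_trans by blast

lemma integrable_f_phase:
  assumes "k \<in> SO"
  shows "integrable lborel (\<lambda>x. f (x, k) * phase r k0 x)"
proof (rule Bochner_Integration.integrable_bound[OF integrable_dom])
  have "continuous_on UNIV (\<lambda>x. f (x, k) * phase r k0 x)"
    unfolding phase_def using assms
    by (intro continuous_intros continuous_on_compose2[OF cont_f]) auto
  then show "(\<lambda>x. f (x, k) * phase r k0 x) \<in> borel_measurable lborel"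
    by (simp add: borel_measurable_continuous_onI)
  show "AE x in lborel. norm (f (x, k) * phase r k0 x) \<le> norm (dom x)"
    using norm_f_le[OF assms] dom_nonneg by (auto simp: norm_mult norm_phase)
qed

lemma integral_f_phase_bound:
  assumes "k \<in> SO"
  shows "norm (LINT x|lborel. f (x, k) * phase r k0 x) \<le> integral\<^sup>L lborel dom"
proof -
  have "norm (LINT x|lborel. f (x, k) * phase r k0 x) \<le> (LINT x|lborel. norm (f (x, k) * phase r k0 x))"
    by (rule integral_norm_bound)
  also have "\<dots> \<le> integral\<^sup>L lborel dom"
    using norm_f_le[OF assms]
    by (intro integral_mono integrable_norm integrable_f_phase[OF assms] integrable_dom) (simp add: norm_mult norm_phase)
  finally show ?thesis .
qed

lemma kern_bound: "k0 \<in> SO \<Longrightarrow> k \<in> SO \<Longrightarrow> norm (kern r k0 k) \<le> integral\<^sup>L lborel dom"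
  unfolding kern_def by (intro integral_f_phase_bound SO_mult SO_transpose)

lemma continuous_on_param_integral:
  fixes g :: "'p::metric_space \<Rightarrow> 'y \<Rightarrow> complex"
  assumes meas: "\<And>p. p \<in> S \<Longrightarrow> g p \<in> borel_measurable M" and cont: "\<And>y. y \<in> space M \<Longrightarrow> continuous_on S (\<lambda>p. g p y)"
    and w: "integrable M w" and le: "\<And>p y. p \<in> S \<Longrightarrow> y \<in> space M \<Longrightarrow> norm (g p y) \<le> w y"
  shows "continuous_on S (\<lambda>p. LINT y|M. g p y)"
  unfolding continuous_on_sequentially o_def
proof (intro allI ballI impI)
  fix x a assume a: "a \<in> S" and x: "(\<forall>n. x n \<in> S) \<and> x \<longlonglongrightarrow> a"
  show "(\<lambda>n. LINT y|M. g (x n) y) \<longlonglongrightarrow> (LINT y|M. g a y)"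
  proof (rule integral_dominated_convergence[where w = w])
    show "AE y in M. (\<lambda>n. g (x n) y) \<longlonglongrightarrow> g a y"
      using cont x a unfolding continuous_on_sequentially o_def by (intro AE_I2) blast
  qed (use x a meas w le in auto)
qed

lemma continuous_on_kern: "continuous_on (SO \<times> SO) (\<lambda>p. kern r (fst p) (snd p))"
  unfolding kern_def
proof (rule continuous_on_param_integral[where w = dom])
  fix p :: "'n sqmat \<times> 'n sqmat" assume p: "p \<in> SO \<times> SO"
  then have k: "tp (fst p) ** snd p \<in> SO" by (auto intro!: SO_mult SO_transpose)
  show "(\<lambda>x. f (x, tp (fst p) ** snd p) * phase r (fst p) x) \<in> borel_measurable lborel"
    using integrable_f_phase[OF k] by auto
  show "norm (f (x, tp (fst p) ** snd p) * phase r (fst p) x) \<le> dom x" for x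
    using norm_f_le[OF k] by (simp add: norm_mult norm_phase)
next
  show "continuous_on (SO \<times> SO) (\<lambda>p. f (x, tp (fst p) ** snd p) * phase r (fst p) x)" for x
    unfolding phase_def
    by (intro continuous_intros continuous_on_compose2[OF cont_f]) (auto intro!: SO_mult SO_transpose)
qed (rule integrable_dom)

text \<open>
  The stabilizer fixes \<open>\<xi>\<^sub>r\<close>, and \<open>k0\<inverse> k\<close> is invariant under a common left translation. This is why
  operators with this kernel preserve the covariance condition.
\<close>
lemma kern_left_mult:
  assumes "u \<in> K1"
  shows "kern r (u ** k0) (u ** k) = kern r k0 k"
proof -
  have u: "u \<in> SO" "tp u *v xi r = xi r"
  proof -
    show "u \<in> SO" using assms by (simp add: K1_def)
    have "u *v xi 1 = xi 1" using assms K1_eq_stabilizer[of 1, simplified] by blast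
    then have "u *v xi r = xi r"
      by (subst (1 2) xi_scaleR) (simp add: matrix_vector_mult_scaleR)
    then have "(tp u ** u) *v xi r = tp u *v xi r"
      by (simp add: matrix_vector_mul_assoc[symmetric])
    then show "tp u *v xi r = xi r" using \<open>u \<in> SO\<close> by (simp add: SO_inverse)
  qed
  have "tp (u ** k0) ** (u ** k) = tp k0 ** (tp u ** u) ** k"
    by (simp add: matrix_transpose_mul matrix_mul_assoc)
  moreover have "tp (u ** k0) *v xi r = tp k0 *v xi r"
    using u by (simp add: matrix_transpose_mul matrix_vector_mul_assoc[symmetric])
  ultimately show ?thesis unfolding kern_def phase_def using SO_inverse(1)[OF u(1)] by simp
qed

text \<open>
  The left-hand side has the shape in which matrix coefficients occur in the weak definition of the
  Fourier transform, with \<open>Th (k0, k) = \<psi> k \<bullet>c \<phi> k0\<close>. Fubini's theorem moves the integral over \<open>k0\<close> to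
  the outside, and the substitution of \<open>k0\<inverse> k\<close> for \<open>k\<close> creates the kernel. Since
  \<open>k0 \<mapsto> Th (k0, k0 k)\<close> is integrable only for almost every \<open>k\<close>, the inner integrals are compared
  almost everywhere.
\<close>
lemma weak_integral_eq_kernel:
  fixes Th :: "'n sqmat \<times> 'n sqmat \<Rightarrow> complex"
  assumes Th: "integrable (\<mu> \<Otimes>\<^sub>M \<mu>) Th"
  shows "(LINT k|\<mu>. LINT x|lborel. f (x, k) * (LINT k0|\<mu>. phase r k0 x * Th (k0, k0 ** k)))
     = (LINT k0|\<mu>. LINT k|\<mu>. kern r k0 k * Th (k0, k))"
proof -
  define Ps where "Ps = (\<lambda>k0 k. Th (k0, k0 ** k))"
  have Ps: "integrable (\<mu> \<Otimes>\<^sub>M \<mu>) (\<lambda>(k0, k). Ps k0 k)"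
    using integrable_shear[OF Th] by (simp add: Ps_def case_prod_unfold)
  define F where "F = (\<lambda>k0 k. LINT x|lborel. f (x, k) * phase r k0 x)"
  have cF: "continuous_on (SO \<times> SO) (\<lambda>p. F (fst p) (snd p))"
    unfolding F_def
  proof (rule continuous_on_param_integral[where w = dom])
    show "continuous_on (SO \<times> SO) (\<lambda>p. f (x, snd p) * phase r (fst p) x)" for x
      unfolding phase_def by (intro continuous_intros continuous_on_compose2[OF cont_f]) auto
    fix p :: "'n sqmat \<times> 'n sqmat" assume "p \<in> SO \<times> SO"
    then have p: "snd p \<in> SO" by auto
    show "(\<lambda>x. f (x, snd p) * phase r (fst p) x) \<in> borel_measurable lborel"
      by (rule borel_measurable_integrable[OF integrable_f_phase[OF p]])
    show "norm (f (x, snd p) * phase r (fst p) x) \<le> dom x" for x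
      using norm_f_le[OF p] by (simp add: norm_mult norm_phase)
  qed (rule integrable_dom)
  have Fb: "norm (F k0 k) \<le> integral\<^sup>L lborel dom" if "k \<in> SO" for k0 k
    unfolding F_def by (rule integral_f_phase_bound[OF that])
  have A: "(LINT x|lborel. f (x, k) * (LINT k0|\<mu>. phase r k0 x * Ps k0 k)) = (LINT k0|\<mu>. F k0 k * Ps k0 k)"
    if k: "k \<in> SO" and P: "integrable \<mu> (\<lambda>k0. Ps k0 k)" for k
  proof -
    have fk: "integrable lborel (\<lambda>x. f (x, k))"
      using integrable_f_phase[OF k, of 0] by (simp add: phase_eq)
    have int: "integrable (lborel \<Otimes>\<^sub>M \<mu>) (\<lambda>(x, k0). f (x, k) * phase r k0 x * Ps k0 k)"
    proof (rule Bochner_Integration.integrable_bound[OF integrable_pair_product[OF LM.pair_sigma_finite_axioms fk P]])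
      have id: "(\<lambda>k. k) \<in> borel_measurable \<mu>" by (intro measurable_mu_continuous_on continuous_intros)
      have m1: "(\<lambda>p. f (fst p, k)) \<in> borel_measurable (lborel \<Otimes>\<^sub>M \<mu>)"
        using measurable_compose[OF measurable_fst borel_measurable_integrable[OF fk]] .
      have m2: "(\<lambda>p. Ps (snd p) k) \<in> borel_measurable (lborel \<Otimes>\<^sub>M \<mu>)"
        using measurable_compose[OF measurable_snd borel_measurable_integrable[OF P]] .
      have "(\<lambda>p. (fst p, snd p)) \<in> (lborel \<Otimes>\<^sub>M \<mu>) \<rightarrow>\<^sub>M (borel \<Otimes>\<^sub>M borel)"
        by (intro measurable_Pair measurable_compose[OF measurable_snd id] measurable_compose[OF measurable_fst measurable_ident_sets[OF sets_lborel]])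
      then have i2: "(\<lambda>p. p) \<in> (lborel \<Otimes>\<^sub>M \<mu>) \<rightarrow>\<^sub>M (borel :: ('n rvec \<times> 'n sqmat) measure)"
        by (simp add: borel_prod)
      have "(\<lambda>p. phase r (snd p) (fst p)) \<in> borel_measurable borel"
        unfolding phase_def by (intro borel_measurable_continuous_onI continuous_intros)
      from measurable_compose[OF i2 this]
      have m3: "(\<lambda>p. phase r (snd p) (fst p)) \<in> borel_measurable (lborel \<Otimes>\<^sub>M \<mu>)" .
      show "(\<lambda>(x, k0). f (x, k) * phase r k0 x * Ps k0 k) \<in> borel_measurable (lborel \<Otimes>\<^sub>M \<mu>)"
        unfolding case_prod_unfold using m1 m2 m3 by (intro borel_measurable_times)
      show "AE p in lborel \<Otimes>\<^sub>M \<mu>. norm (case p of (x, k0) \<Rightarrow> f (x, k) * phase r k0 x * Ps k0 k) \<le> norm (f (fst p, k) * Ps (snd p) k)"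
        by (auto simp: norm_mult norm_phase)
    qed
    have "(LINT x|lborel. f (x, k) * (LINT k0|\<mu>. phase r k0 x * Ps k0 k)) = (LINT x|lborel. LINT k0|\<mu>. f (x, k) * phase r k0 x * Ps k0 k)"
      by (simp add: mult.assoc)
    also have "\<dots> = (LINT k0|\<mu>. LINT x|lborel. f (x, k) * phase r k0 x * Ps k0 k)"
      using LM.Fubini_integral[OF int] by simp
    also have "\<dots> = (LINT k0|\<mu>. F k0 k * Ps k0 k)" by (simp add: F_def)
    finally show ?thesis .
  qed
  have "AE k in \<mu>. integrable \<mu> (\<lambda>k0. Ps k0 k)"
    using PP.AE_integrable_snd[OF Ps] by simp
  moreover have "AE k in \<mu>. k \<in> SO" using AE_space[of \<mu>] by (simp add: space_mu)
  ultimately have ae: "AE k in \<mu>. (LINT x|lborel. f (x, k) * (LINT k0|\<mu>. phase r k0 x * Ps k0 k)) = (LINT k0|\<mu>. F k0 k * Ps k0 k)"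
    by eventually_elim (rule A)
  have Fm: "(\<lambda>(k0, k). F k0 k * Ps k0 k) \<in> borel_measurable (\<mu> \<Otimes>\<^sub>M \<mu>)"
    using borel_measurable_times[OF borel_measurable_on_pair[OF cF] borel_measurable_integrable[OF Ps]] by (simp add: case_prod_unfold)
  have FI: "integrable (\<mu> \<Otimes>\<^sub>M \<mu>) (\<lambda>(k0, k). F k0 k * Ps k0 k)"
  proof (rule Bochner_Integration.integrable_bound[OF integrable_mult_right[OF integrable_norm[OF Ps], of "integral\<^sup>L lborel dom"] Fm])
    show "AE p in \<mu> \<Otimes>\<^sub>M \<mu>. norm (case p of (k0, k) \<Rightarrow> F k0 k * Ps k0 k)
        \<le> norm (integral\<^sup>L lborel dom * norm (case p of (k0, k) \<Rightarrow> Ps k0 k))"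
    proof (rule AE_I2, clarify)
      fix k0 k assume "(k0, k) \<in> space (\<mu> \<Otimes>\<^sub>M \<mu>)"
      then have "k \<in> SO" by (simp add: space_pair_measure space_mu)
      then show "norm (F k0 k * Ps k0 k) \<le> norm (integral\<^sup>L lborel dom * norm (Ps k0 k))"
        using Fb[of k k0] by (auto simp: norm_mult intro!: order_trans[OF mult_right_mono abs_ge_self])
    qed
  qed
  have rm: "(\<lambda>k. LINT k0|\<mu>. F k0 k * Ps k0 k) \<in> borel_measurable \<mu>"
    using borel_measurable_integrable[OF PP.integrable_snd[OF FI]] by simp
  have lm: "(\<lambda>k. LINT x|lborel. f (x, k) * (LINT k0|\<mu>. phase r k0 x * Ps k0 k)) \<in> borel_measurable \<mu>"
  proof (rule lborel.borel_measurable_lebesgue_integral)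
    have id: "(\<lambda>k. k) \<in> borel_measurable \<mu>" by (intro measurable_mu_continuous_on continuous_intros)
    note idl = measurable_ident_sets[OF sets_lborel]
    have e1: "(\<lambda>p. (snd (fst p), snd p)) \<in> ((\<mu> \<Otimes>\<^sub>M lborel) \<Otimes>\<^sub>M \<mu>) \<rightarrow>\<^sub>M (borel :: ('n rvec \<times> 'n sqmat) measure)"
      unfolding borel_prod[symmetric]
      by (intro measurable_Pair measurable_compose[OF measurable_snd id]
          measurable_compose[OF measurable_compose[OF measurable_fst measurable_snd] idl])
    have "(\<lambda>q. phase r (snd q) (fst q)) \<in> borel_measurable borel"
      unfolding phase_def by (intro borel_measurable_continuous_onI continuous_intros)
    from measurable_compose[OF e1 this]
    have m1: "(\<lambda>p. phase r (snd p) (snd (fst p))) \<in> borel_measurable ((\<mu> \<Otimes>\<^sub>M lborel) \<Otimes>\<^sub>M \<mu>)" by simp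
    have "(\<lambda>p. (snd p, fst (fst p))) \<in> ((\<mu> \<Otimes>\<^sub>M (lborel :: 'n rvec measure)) \<Otimes>\<^sub>M \<mu>) \<rightarrow>\<^sub>M (\<mu> \<Otimes>\<^sub>M \<mu>)"
      by (intro measurable_Pair measurable_snd measurable_compose[OF measurable_fst measurable_fst])
    from measurable_compose[OF this borel_measurable_integrable[OF Ps]]
    have m2: "(\<lambda>p. Ps (snd p) (fst (fst p))) \<in> borel_measurable ((\<mu> \<Otimes>\<^sub>M (lborel :: 'n rvec measure)) \<Otimes>\<^sub>M \<mu>)" by simp
    have "(\<lambda>(q, k0). phase r k0 (snd q) * Ps k0 (fst q)) \<in> borel_measurable ((\<mu> \<Otimes>\<^sub>M (lborel :: 'n rvec measure)) \<Otimes>\<^sub>M \<mu>)"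
      using borel_measurable_times[OF m1 m2] by (simp add: case_prod_unfold)
    then have i1: "(\<lambda>q. LINT k0|\<mu>. phase r k0 (snd q) * Ps k0 (fst q)) \<in> borel_measurable (\<mu> \<Otimes>\<^sub>M (lborel :: 'n rvec measure))"
      by (rule borel_measurable_lebesgue_integral)
    have "(\<lambda>q. (snd q, fst q)) \<in> (\<mu> \<Otimes>\<^sub>M lborel) \<rightarrow>\<^sub>M (borel :: ('n rvec \<times> 'n sqmat) measure)"
      unfolding borel_prod[symmetric]
      by (intro measurable_Pair measurable_compose[OF measurable_fst id] measurable_compose[OF measurable_snd idl])
    then have "(\<lambda>q. (snd q, fst q)) \<in> (\<mu> \<Otimes>\<^sub>M lborel) \<rightarrow>\<^sub>M restrict_space borel (UNIV \<times> SO :: ('n rvec \<times> 'n sqmat) set)"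
      by (rule measurable_restrict_space2[rotated]) (auto simp: space_pair_measure space_mu)
    from measurable_compose[OF this borel_measurable_continuous_on_restrict[OF cont_f]]
    have i2: "(\<lambda>q. f (snd q, fst q)) \<in> borel_measurable (\<mu> \<Otimes>\<^sub>M (lborel :: 'n rvec measure))" .
    show "(\<lambda>(k, x). f (x, k) * (LINT k0|\<mu>. phase r k0 x * Ps k0 k)) \<in> borel_measurable (\<mu> \<Otimes>\<^sub>M lborel)"
      using borel_measurable_times[OF i2 i1] by (simp add: case_prod_unfold)
  qed
  have "(LINT k|\<mu>. LINT x|lborel. f (x, k) * (LINT k0|\<mu>. phase r k0 x * Ps k0 k)) = (LINT k|\<mu>. LINT k0|\<mu>. F k0 k * Ps k0 k)"
    by (rule integral_cong_AE[OF lm rm ae])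
  also have "\<dots> = (LINT k0|\<mu>. LINT k|\<mu>. F k0 k * Ps k0 k)"
    using PP.Fubini_integral[OF FI] by simp
  also have "\<dots> = (LINT k0|\<mu>. LINT k|\<mu>. kern r k0 k * Th (k0, k))"
  proof (rule Bochner_Integration.integral_cong[OF refl])
    fix k0 assume "k0 \<in> space \<mu>"
    then have k0: "k0 \<in> SO" by (simp add: space_mu)
    have "(\<lambda>k. kern r k0 k * Th (k0, k)) \<in> borel_measurable \<mu>"
    proof (intro borel_measurable_times)
      show "(\<lambda>k. Th (k0, k)) \<in> borel_measurable \<mu>"
        using measurable_Pair2[OF borel_measurable_integrable[OF Th] \<open>k0 \<in> space \<mu>\<close>] .
      show "kern r k0 \<in> borel_measurable \<mu>"
        using measurable_Pair2[OF borel_measurable_on_pair[OF continuous_on_kern] \<open>k0 \<in> space \<mu>\<close>] by simp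
    qed
    from integral_left_mult[OF k0 this]
    have "(LINT k|\<mu>. kern r k0 k * Th (k0, k)) = (LINT k|\<mu>. kern r k0 (k0 ** k) * Th (k0, k0 ** k))" by simp
    moreover have "kern r k0 (k0 ** k) = F k0 k" for k by (simp add: kern_def F_def SO_cancel[OF k0])
    ultimately show "(LINT k|\<mu>. F k0 k * Ps k0 k) = (LINT k|\<mu>. kern r k0 k * Th (k0, k))" by (simp add: Ps_def)
  qed
  finally show ?thesis by (simp add: Ps_def)
qed

text \<open>
  Written as one integral over all three variables, a matrix coefficient depends on \<open>r\<close> only through
  the phase \<open>r * s p\<close>, where \<open>s\<close> is bounded because \<open>f\<close> has bounded support.
\<close>
lemma kernel_integral_as_fourier_integral:
  fixes Th :: "'n sqmat \<times> 'n sqmat \<Rightarrow> complex"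
  assumes Th: "integrable (\<mu> \<Otimes>\<^sub>M \<mu>) Th"
  shows "\<exists>(w :: ('n sqmat \<times> 'n sqmat) \<times> 'n rvec \<Rightarrow> complex) s.
    integrable ((\<mu> \<Otimes>\<^sub>M \<mu>) \<Otimes>\<^sub>M lborel) w \<and> s \<in> borel_measurable ((\<mu> \<Otimes>\<^sub>M \<mu>) \<Otimes>\<^sub>M lborel) \<and>
    (\<forall>p. \<bar>s p\<bar> \<le> \<bar>R\<bar>) \<and>
    (\<forall>r. (LINT k0|\<mu>. LINT k|\<mu>. kern r k0 k * Th (k0, k))
      = (LINT p|((\<mu> \<Otimes>\<^sub>M \<mu>) \<Otimes>\<^sub>M lborel). exp (\<i> * of_real (r * s p)) * w p))"
proof -
  let ?M = "(\<mu> \<Otimes>\<^sub>M \<mu>) \<Otimes>\<^sub>M (lborel :: 'n rvec measure)"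
  define s where "s = (\<lambda>p :: ('n sqmat \<times> 'n sqmat) \<times> 'n rvec. if fst (fst p) \<in> SO \<and> norm (snd p) \<le> R
     then (tp (fst (fst p)) *v xi 1 :: 'n rvec) \<bullet> snd p else 0)"
  define w where "w = (\<lambda>p :: ('n sqmat \<times> 'n sqmat) \<times> 'n rvec. f (snd p, tp (fst (fst p)) ** snd (fst p)) * Th (fst p))"
  have sp: "fst (fst p) \<in> SO \<and> snd (fst p) \<in> SO" if "p \<in> space ?M" for p
    using that by (auto simp: space_pair_measure space_mu)
  have Thm: "Th \<in> borel_measurable (\<mu> \<Otimes>\<^sub>M \<mu>)" using Th by auto
  have sm: "s \<in> borel_measurable ?M"
  proof -
    have "(\<lambda>p :: ('n sqmat \<times> 'n sqmat) \<times> 'n rvec. (tp (fst (fst p)) *v xi 1 :: 'n rvec) \<bullet> snd p * indicator (cball 0 R) (snd p)) \<in> borel_measurable borel"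
      by (intro borel_measurable_times borel_measurable_continuous_onI continuous_intros
          borel_measurable_indicator' measurable_compose[OF borel_measurable_continuous_onI[of snd] borel_measurable_indicator]) auto
    from borel_measurable_on_product[OF this]
    show ?thesis
      by (rule measurable_cong[THEN iffD1, rotated]) (use sp in \<open>auto simp: s_def indicator_def\<close>)
  qed
  have sb: "\<bar>s p\<bar> \<le> \<bar>R\<bar>" for p
  proof (cases "fst (fst p) \<in> SO \<and> norm (snd p) \<le> R")
    case True
    have "norm (tp (fst (fst p)) *v xi 1 :: 'n rvec) = norm (xi 1 :: 'n rvec)"
      using True by (intro SO_norm SO_transpose) auto
    then have "\<bar>s p\<bar> \<le> 1 * norm (snd p)"
      using True Cauchy_Schwarz_ineq2[of "tp (fst (fst p)) *v xi 1 :: 'n rvec" "snd p"]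
      by (simp add: s_def norm_xi)
    then show ?thesis using True by auto
  qed (auto simp: s_def)
  have wm: "w \<in> borel_measurable ?M"
  proof -
    have "(\<lambda>p. (snd p, tp (fst (fst p)) ** snd (fst p))) \<in> ?M \<rightarrow>\<^sub>M (borel :: ('n rvec \<times> 'n sqmat) measure)"
      by (intro borel_measurable_on_product borel_measurable_continuous_onI continuous_intros)
    then have "(\<lambda>p. (snd p, tp (fst (fst p)) ** snd (fst p))) \<in> ?M \<rightarrow>\<^sub>M restrict_space borel (UNIV \<times> SO :: ('n rvec \<times> 'n sqmat) set)"
      by (rule measurable_restrict_space2[rotated]) (auto simp: space_pair_measure space_mu intro!: SO_mult SO_transpose)
    from measurable_compose[OF this borel_measurable_continuous_on_restrict[OF cont_f]] measurable_compose[OF measurable_fst Thm]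
    show ?thesis unfolding w_def by (rule borel_measurable_times)
  qed
  have domc: "integrable lborel (\<lambda>x. complex_of_real (dom x))" using integrable_dom by simp
  have wi: "integrable ?M w"
  proof (rule Bochner_Integration.integrable_bound[OF integrable_pair_product[OF PL.pair_sigma_finite_axioms Th domc] wm])
    show "AE p in ?M. norm (w p) \<le> norm (Th (fst p) * complex_of_real (dom (snd p)))"
    proof (rule AE_I2)
      fix p assume "p \<in> space ?M"
      then have "tp (fst (fst p)) ** snd (fst p) \<in> SO"
        using sp by (intro SO_mult SO_transpose) auto
      from norm_f_le[OF this, of "snd p"] show "norm (w p) \<le> norm (Th (fst p) * complex_of_real (dom (snd p)))"
        using dom_nonneg[of "snd p"] by (simp add: w_def norm_mult mult.commute mult_left_mono)
    qed
  qed
  have eq: "(LINT k0|\<mu>. LINT k|\<mu>. kern r k0 k * Th (k0, k)) = (LINT p|?M. exp (\<i> * of_real (r * s p)) * w p)" for r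
  proof -
    have int: "integrable ?M (\<lambda>p. exp (\<i> * of_real (r * s p)) * w p)"
    proof (rule Bochner_Integration.integrable_bound[OF wi])
      have "(\<lambda>p. exp (\<i> * complex_of_real (r * s p))) \<in> borel_measurable ?M"
        by (rule borel_measurable_continuous_on[OF _ sm, of "\<lambda>t. exp (\<i> * complex_of_real (r * t))"]) (intro continuous_intros)
      then show "(\<lambda>p. exp (\<i> * complex_of_real (r * s p)) * w p) \<in> borel_measurable ?M"
        using wm by (rule borel_measurable_times)
    qed (simp add: norm_mult)
    have inner: "(LINT x|lborel. exp (\<i> * of_real (r * s (kk, x))) * w (kk, x)) = kern r (fst kk) (snd kk) * Th kk"
      if "kk \<in> SO \<times> SO" for kk
    proof -
      have k: "fst kk \<in> SO" "tp (fst kk) ** snd kk \<in> SO"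
        using that by (auto intro!: SO_mult SO_transpose)
      have "exp (\<i> * of_real (r * s (kk, x))) * w (kk, x) = f (x, tp (fst kk) ** snd kk) * phase r (fst kk) x * Th kk" for x
        using k(1) supp_f[OF k(2), of x] by (cases "norm x > R") (auto simp: w_def s_def phase_eq)
      then show ?thesis by (simp add: kern_def)
    qed
    have int': "integrable (\<mu> \<Otimes>\<^sub>M \<mu>) (\<lambda>kk. kern r (fst kk) (snd kk) * Th kk)"
      by (rule Bochner_Integration.integrable_cong[THEN iffD1, OF refl _ PL.integrable_fst'[OF int]])
        (use inner in \<open>auto simp: space_pair_measure space_mu\<close>)
    have "(LINT p|?M. exp (\<i> * of_real (r * s p)) * w p) = (LINT kk|(\<mu> \<Otimes>\<^sub>M \<mu>). LINT x|lborel. exp (\<i> * of_real (r * s (kk, x))) * w (kk, x))"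
      by (rule PL.integral_fst'[OF int, symmetric])
    also have "\<dots> = (LINT kk|(\<mu> \<Otimes>\<^sub>M \<mu>). kern r (fst kk) (snd kk) * Th kk)"
      by (rule Bochner_Integration.integral_cong[OF refl inner]) (auto simp: space_pair_measure space_mu)
    also have "\<dots> = (LINT k0|\<mu>. LINT k|\<mu>. kern r k0 k * Th (k0, k))"
      using PP.integral_fst'[OF int'] by simp
    finally show ?thesis by simp
  qed
  show ?thesis using wi sm sb eq by blast
qed

end

section \<open>Semi-inner products and the Hilbert--Schmidt norm\<close>

text \<open>
  Vectors of norm 0 are not identified with zero. The vector operations are parameters, since the
  representation spaces consist of functions with values in \<open>carrier_vec d\<close>.
\<close>
locale semi_inner_space =
  fixes L :: "'h set" and ip :: "'h \<Rightarrow> 'h \<Rightarrow> complex"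
    and add :: "'h \<Rightarrow> 'h \<Rightarrow> 'h" and scale :: "complex \<Rightarrow> 'h \<Rightarrow> 'h"
  assumes add_closed: "a \<in> L \<Longrightarrow> b \<in> L \<Longrightarrow> add a b \<in> L"
    and scale_closed: "a \<in> L \<Longrightarrow> scale z a \<in> L"
    and ip_add: "a \<in> L \<Longrightarrow> b \<in> L \<Longrightarrow> c \<in> L \<Longrightarrow> ip (add a b) c = ip a c + ip b c"
    and ip_scale: "a \<in> L \<Longrightarrow> c \<in> L \<Longrightarrow> ip (scale z a) c = z * ip a c"
    and ip_cnj: "a \<in> L \<Longrightarrow> b \<in> L \<Longrightarrow> ip b a = cnj (ip a b)"
    and ip_nonneg: "a \<in> L \<Longrightarrow> Re (ip a a) \<ge> 0"
begin

lemma ip_self: "a \<in> L \<Longrightarrow> ip a a = of_real (Re (ip a a))"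
  using ip_cnj[of a a] by (simp add: complex_eq_iff)

lemma ip_sub_scale:
  assumes "a \<in> L" "b \<in> L" "c \<in> L"
  shows "ip (add a (scale z b)) c = ip a c + z * ip b c"
    "ip c (add a (scale z b)) = ip c a + cnj z * ip c b"
proof -
  show 1: "ip (add a (scale z b)) c = ip a c + z * ip b c"
    using assms by (simp add: ip_add ip_scale scale_closed)
  have "ip c (add a (scale z b)) = cnj (ip (add a (scale z b)) c)"
    using assms by (intro ip_cnj add_closed scale_closed)
  then show "ip c (add a (scale z b)) = ip c a + cnj z * ip c b"
    unfolding 1 using ip_cnj[OF assms(1,3)] ip_cnj[OF assms(2,3)] by simp
qed

text \<open>
  The usual minimization of the norm of \<open>a - t c b\<close> over real \<open>t\<close>, where \<open>c = \<langle>a, b\<rangle>\<close>; when \<open>b\<close> has norm 0, letting \<open>t\<close>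
  grow shows that \<open>c = 0\<close>.
\<close>
lemma cauchy_schwarz:
  assumes a: "a \<in> L" and b: "b \<in> L"
  shows "(cmod (ip a b))\<^sup>2 \<le> Re (ip a a) * Re (ip b b)"
proof -
  have expand: "Re (ip (add a (scale z b)) (add a (scale z b))) = Re (ip a a) + 2 * Re (cnj z * ip a b) + (cmod z)\<^sup>2 * Re (ip b b)" for z
  proof -
    have ab: "add a (scale z b) \<in> L" using a b by (intro add_closed scale_closed)
    have "ip (add a (scale z b)) (add a (scale z b)) = ip a a + cnj z * ip a b + z * (ip b a + cnj z * ip b b)"
      unfolding ip_sub_scale(1)[OF a b ab] ip_sub_scale(2)[OF a b a] ip_sub_scale(2)[OF a b b] ..
    moreover have "z * ip b a = cnj (cnj z * ip a b)" using ip_cnj[OF a b] by simp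
    moreover have "z * (cnj z * ip b b) = of_real ((cmod z)\<^sup>2 * Re (ip b b))"
      using ip_self[OF b] by (metis complex_norm_square mult.assoc of_real_mult)
    ultimately have "ip (add a (scale z b)) (add a (scale z b)) = ip a a + cnj z * ip a b + cnj (cnj z * ip a b) + of_real ((cmod z)\<^sup>2 * Re (ip b b))"
      by (simp only: distrib_left add.assoc)
    then show ?thesis by (simp del: complex_cnj_mult complex_cnj_cnj of_real_mult of_real_power)
  qed
  define s where "s = Re (ip b b)"
  define c where "c = ip a b"
  have s0: "s \<ge> 0" using ip_nonneg[OF b] by (simp add: s_def)
  have cc: "cnj c * c = of_real ((cmod c)\<^sup>2)" by (metis complex_norm_square mult.commute)
  \<comment> \<open>The squared norm of \<open>a - t c b\<close>.\<close>
  have q: "0 \<le> Re (ip a a) - 2 * t * (cmod c)\<^sup>2 + t\<^sup>2 * (cmod c)\<^sup>2 * s" for t :: real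
  proof -
    have "0 \<le> Re (ip (add a (scale (- of_real t * c) b)) (add a (scale (- of_real t * c) b)))"
      using a b by (intro ip_nonneg add_closed scale_closed)
    also have "\<dots> = Re (ip a a) + 2 * Re (- of_real t * (cnj c * c)) + (t\<^sup>2 * (cmod c)\<^sup>2) * s"
      unfolding expand by (simp add: c_def s_def norm_mult power_mult_distrib mult.assoc)
    also have "\<dots> = Re (ip a a) - 2 * t * (cmod c)\<^sup>2 + t\<^sup>2 * (cmod c)\<^sup>2 * s"
      unfolding cc by simp
    finally show ?thesis .
  qed
  show ?thesis
  proof (cases "s = 0")
    case True
    have "cmod c = 0"
    proof (rule ccontr)
      assume "cmod c \<noteq> 0"
      then have "(cmod c)\<^sup>2 > 0" by simp
      then have "2 * ((Re (ip a a) + 1) / (2 * (cmod c)\<^sup>2)) * (cmod c)\<^sup>2 = Re (ip a a) + 1" by simp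
      then show False using q[of "(Re (ip a a) + 1) / (2 * (cmod c)\<^sup>2)"] True by simp
    qed
    then show ?thesis using True unfolding c_def s_def by simp
  next
    case False
    then have s: "s > 0" using s0 by simp
    have "0 \<le> s * (Re (ip a a) - 2 * (1/s) * (cmod c)\<^sup>2 + (1/s)\<^sup>2 * (cmod c)\<^sup>2 * s)"
      using s q[of "1/s"] by (intro mult_nonneg_nonneg) auto
    also have "\<dots> = s * Re (ip a a) - (cmod c)\<^sup>2" using s by (simp add: field_simps power2_eq_square)
    finally show ?thesis unfolding c_def s_def by (simp add: mult.commute)
  qed
qed

text \<open>
  A maximal orthonormal set, which exists by Zorn's lemma, is a basis in the sense used here: a
  vector of positive norm orthogonal to it could be normalized and added.
\<close>
lemma orthonormal_basis_exists:
  assumes HL: "H \<subseteq> L" and Hs: "\<And>a z. a \<in> H \<Longrightarrow> scale z a \<in> H"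
  shows "\<exists>E. orthonormal_basis H ip E"
proof -
  define ON where "ON = {E. E \<subseteq> H \<and> (\<forall>e\<in>E. \<forall>e'\<in>E. ip e e' = (if e = e' then 1 else 0))}"
  have "\<exists>E\<in>ON. \<forall>F\<in>ON. E \<subseteq> F \<longrightarrow> F = E"
  proof (rule subset_Zorn)
    fix \<C> assume C: "subset.chain ON \<C>"
    have "\<Union>\<C> \<in> ON"
      unfolding ON_def
    proof (intro CollectI conjI ballI)
      show "\<Union>\<C> \<subseteq> H" using C unfolding subset.chain_def ON_def by blast
      fix e e' assume "e \<in> \<Union>\<C>" "e' \<in> \<Union>\<C>"
      then obtain X Y where XY: "X \<in> \<C>" "e \<in> X" "Y \<in> \<C>" "e' \<in> Y" by blast
      then have "X \<subseteq> Y \<or> Y \<subseteq> X" using C unfolding subset_chain_def by blast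
      then obtain Z where "Z \<in> \<C>" "e \<in> Z" "e' \<in> Z" using XY by blast
      then show "ip e e' = (if e = e' then 1 else 0)" using C unfolding subset.chain_def ON_def by blast
    qed
    then show "\<exists>U\<in>ON. \<forall>X\<in>\<C>. X \<subseteq> U" by blast
  qed
  then obtain E where E: "E \<in> ON" "\<And>F. F \<in> ON \<Longrightarrow> E \<subseteq> F \<Longrightarrow> F = E" by blast
  have "ip \<psi> \<psi> = 0" if \<psi>: "\<psi> \<in> H" and orth: "\<forall>e\<in>E. ip \<psi> e = 0" for \<psi>
  proof (rule ccontr)
    assume nz: "ip \<psi> \<psi> \<noteq> 0"
    define s where "s = Re (ip \<psi> \<psi>)"
    have \<psi>L: "\<psi> \<in> L" using \<psi> HL by blast
    have ips: "ip \<psi> \<psi> = of_real s" unfolding s_def by (rule ip_self[OF \<psi>L])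
    have "s \<noteq> 0" using nz ips by auto
    moreover have "s \<ge> 0" using ip_nonneg[OF \<psi>L] by (simp add: s_def)
    ultimately have s: "s > 0" by simp
    define u where "u = scale (of_real (1 / sqrt s)) \<psi>"
    have uH: "u \<in> H" unfolding u_def by (rule Hs[OF \<psi>])
    have uL: "u \<in> L" using uH HL by blast
    have ipu: "ip u c = of_real (1 / sqrt s) * ip \<psi> c" if "c \<in> L" for c
      unfolding u_def by (rule ip_scale[OF \<psi>L that])
    have "ip u u = of_real (1 / sqrt s) * cnj (of_real (1 / sqrt s) * ip \<psi> \<psi>)"
      using ipu[OF uL] ip_cnj[OF uL \<psi>L] ipu[OF \<psi>L] by simp
    also have "\<dots> = of_real (1 / sqrt s * (1 / sqrt s * s))"
      by (simp only: ips of_real_mult complex_cnj_mult complex_cnj_complex_of_real)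
    also have "1 / sqrt s * (1 / sqrt s * s) = 1" using s by (simp add: field_simps)
    finally have uu: "ip u u = 1" by simp
    have ue: "ip u e = 0" "ip e u = 0" if "e \<in> E" for e
    proof -
      have eL: "e \<in> L" using that E HL unfolding ON_def by blast
      show 1: "ip u e = 0" using ipu[OF eL] orth that by simp
      show "ip e u = 0" using ip_cnj[OF uL eL] 1 by simp
    qed
    have "u \<notin> E" using ue(1)[of u] uu by auto
    moreover have "insert u E \<in> ON"
      unfolding ON_def
    proof (intro CollectI conjI ballI)
      show "insert u E \<subseteq> H" using E(1) uH unfolding ON_def by blast
      fix e e' assume "e \<in> insert u E" "e' \<in> insert u E"
      moreover have "ip a a' = (if a = a' then 1 else 0)" if "a \<in> E" "a' \<in> E" for a a'
        using E(1) that unfolding ON_def by blast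
      ultimately show "ip e e' = (if e = e' then 1 else 0)"
        using uu ue \<open>u \<notin> E\<close> by (elim insertE) auto
    qed
    ultimately show False using E(2)[of "insert u E"] by blast
  qed
  then show ?thesis using E unfolding ON_def orthonormal_basis_def by blast
qed

text \<open>
  Subtracting from \<open>w\<close> its component along one member of the system does not change the coefficients
  with respect to the others and lowers the squared norm by the square of the removed coefficient.
\<close>
lemma bessel:
  assumes "finite F" "F \<subseteq> L" "\<And>e e'. e \<in> F \<Longrightarrow> e' \<in> F \<Longrightarrow> ip e e' = (if e = e' then 1 else 0)" "w \<in> L"
  shows "(\<Sum>e\<in>F. (cmod (ip w e))\<^sup>2) \<le> Re (ip w w)"
  using assms
proof (induction F arbitrary: w rule: finite_induct)
  case empty
  then show ?case using ip_nonneg by simp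
next
  case (insert e F)
  have eL: "e \<in> L" and w: "w \<in> L" and ee: "ip e e = 1" using insert.prems by auto
  define c where "c = ip w e"
  define w' where "w' = add w (scale (- c) e)"
  have w': "w' \<in> L" unfolding w'_def using w eL by (intro add_closed scale_closed)
  have "ip w' e' = ip w e'" if "e' \<in> F" for e'
  proof -
    have "e' \<in> L" "ip e e' = 0" using that insert.prems insert.hyps by auto
    then show ?thesis unfolding w'_def using ip_sub_scale(1)[OF w eL] by simp
  qed
  then have "(\<Sum>x\<in>F. (cmod (ip w x))\<^sup>2) = (\<Sum>x\<in>F. (cmod (ip w' x))\<^sup>2)" by simp
  also have "\<dots> \<le> Re (ip w' w')" using insert.prems w' by (intro insert.IH) auto
  also have "ip w' w' = ip w w - of_real ((cmod c)\<^sup>2)"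
  proof -
    have "ip w' w' = ip w w' - c * ip e w'"
      using ip_sub_scale(1)[OF w eL w', of "- c"] unfolding w'_def by simp
    moreover have "ip e w' = ip e w - cnj c * ip e e" "ip w w' = ip w w - cnj c * ip w e"
      using ip_sub_scale(2)[OF w eL eL, of "- c"] ip_sub_scale(2)[OF w eL w, of "- c"] unfolding w'_def by auto
    moreover have "ip e w = cnj c" unfolding c_def by (rule ip_cnj[OF w eL])
    moreover have "c * cnj c = of_real ((cmod c)\<^sup>2)" by (metis complex_norm_square)
    ultimately show ?thesis using ee by (simp add: c_def[symmetric] mult.commute)
  qed
  finally show ?case using insert.hyps by (simp add: c_def)
qed

end

lemma hs_norm_ge:
  assumes E: "E = (SOME E. orthonormal_basis H ip E)" and le: "hs_norm H ip A \<le> ennreal c" and c: "c \<ge> 0" and e: "e \<in> E"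
    and nn: "Re (ip (A e) (A e)) \<ge> 0"
  shows "Re (ip (A e) (A e)) \<le> c\<^sup>2"
proof -
  define S where "S = hs_norm_sq H ip A"
  have fin: "S \<noteq> \<infinity>" using le unfolding hs_norm_def S_def by (auto simp: top_unique split: if_splits)
  have "ennreal (Re (ip (A e) (A e))) = (\<Sum>\<^sub>\<infinity>e\<in>{e}. ennreal (Re (ip (A e) (A e))))" by simp
  also have "\<dots> \<le> S" unfolding S_def hs_norm_sq_def E[symmetric]
    using e by (intro infsum_mono_neutral nonneg_summable_on_complete) auto
  finally have 1: "ennreal (Re (ip (A e) (A e))) \<le> S" .
  have "sqrt (enn2real S) \<le> c" using le fin c unfolding hs_norm_def S_def[symmetric] by (simp add: ennreal_le_iff)
  then have "enn2real S \<le> c\<^sup>2" using c by (metis enn2real_nonneg real_sqrt_le_iff real_sqrt_unique sqrt_le_D)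
  then have "S \<le> ennreal (c\<^sup>2)" using fin by (metis ennreal_enn2real_if ennreal_leI infinity_ennreal_def)
  then have "ennreal (Re (ip (A e) (A e))) \<le> ennreal (c\<^sup>2)" using 1 by (rule order_trans[rotated])
  then show ?thesis by (simp add: ennreal_le_iff)
qed

lemma hs_norm_le:
  assumes E: "E = (SOME E. orthonormal_basis H ip E)" and c: "c \<ge> 0"
    and nn: "\<And>e. e \<in> E \<Longrightarrow> Re (ip (A e) (A e)) \<ge> 0"
    and le: "\<And>F. finite F \<Longrightarrow> F \<subseteq> E \<Longrightarrow> (\<Sum>e\<in>F. Re (ip (A e) (A e))) \<le> c\<^sup>2"
  shows "hs_norm H ip A \<le> ennreal c"
proof -
  define S where "S = hs_norm_sq H ip A"
  have "S = (SUP F\<in>{F. finite F \<and> F \<subseteq> E}. \<Sum>e\<in>F. ennreal (Re (ip (A e) (A e))))"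
    unfolding S_def hs_norm_sq_def E[symmetric] by (rule nonneg_infsum_complete) simp
  also have "\<dots> \<le> ennreal (c\<^sup>2)"
  proof (rule SUP_least)
    fix F assume "F \<in> {F. finite F \<and> F \<subseteq> E}"
    then have F: "finite F" "F \<subseteq> E" by auto
    have "(\<Sum>e\<in>F. ennreal (Re (ip (A e) (A e)))) = ennreal (\<Sum>e\<in>F. Re (ip (A e) (A e)))"
      using F nn by (intro sum_ennreal) auto
    then show "(\<Sum>e\<in>F. ennreal (Re (ip (A e) (A e)))) \<le> ennreal (c\<^sup>2)" using le[OF F] by (simp add: ennreal_leI)
  qed
  finally have S: "S \<le> ennreal (c\<^sup>2)" .
  then have fin: "S \<noteq> \<infinity>" by (auto simp: top_unique)
  have "enn2real S \<le> c\<^sup>2" using S c by (metis enn2real_ennreal enn2real_mono ennreal_less_top zero_le_power2)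
  then have "sqrt (enn2real S) \<le> c" using c by (simp add: real_le_lsqrt)
  then show ?thesis using fin unfolding hs_norm_def S_def[symmetric] by (simp add: ennreal_leI)
qed

section \<open>Kernel operators on the representation spaces\<close>

lemma cscalar_prod_sum:
  fixes a b :: "complex Matrix.vec"
  assumes "a \<in> carrier_vec d" "b \<in> carrier_vec d"
  shows "a \<bullet>c b = (\<Sum>i<d. vec_index a i * cnj (vec_index b i))"
  using assms by (auto simp: scalar_prod_def lessThan_atLeast0 intro!: sum.cong)

lemma Re_cscalar_self:
  fixes a :: "complex Matrix.vec"
  assumes "a \<in> carrier_vec d"
  shows "Re (a \<bullet>c a) = (\<Sum>i<d. (cmod (vec_index a i))\<^sup>2)"
  using assms by (simp add: cscalar_prod_sum[of _ d] complex_norm_square[symmetric] Re_complex_of_real del: of_real_power)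

context haar_SO
begin

text \<open>
  The square-integrable functions without the covariance condition. Constant functions, to which
  Bessel's inequality is applied, belong to this space but in general not to \<open>H_space\<close>.
\<close>
definition L2 :: "nat \<Rightarrow> ('n sqmat \<Rightarrow> complex Matrix.vec) set" where
  "L2 d = {\<psi>. (\<forall>k\<in>SO. \<psi> k \<in> carrier_vec d) \<and> (\<forall>i<d. (\<lambda>k. vec_index (\<psi> k) i) \<in> borel_measurable \<mu>) \<and>
     (\<forall>i<d. integrable \<mu> (\<lambda>k. (cmod (vec_index (\<psi> k) i))\<^sup>2))}"

lemma integrable_Re_cscalar_iff:
  assumes "\<forall>k\<in>SO. \<psi> k \<in> carrier_vec d" "\<forall>i<d. (\<lambda>k. vec_index (\<psi> k) i) \<in> borel_measurable \<mu>"
  shows "integrable \<mu> (\<lambda>k. Re (\<psi> k \<bullet>c \<psi> k)) \<longleftrightarrow> (\<forall>i<d. integrable \<mu> (\<lambda>k. (cmod (vec_index (\<psi> k) i))\<^sup>2))"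
proof -
  have eq: "integrable \<mu> (\<lambda>k. Re (\<psi> k \<bullet>c \<psi> k)) \<longleftrightarrow> integrable \<mu> (\<lambda>k. \<Sum>i<d. (cmod (vec_index (\<psi> k) i))\<^sup>2)"
    using assms by (intro Bochner_Integration.integrable_cong refl Re_cscalar_self) (auto simp: space_mu)
  show ?thesis
  proof
    assume "integrable \<mu> (\<lambda>k. Re (\<psi> k \<bullet>c \<psi> k))"
    then have I: "integrable \<mu> (\<lambda>k. \<Sum>i<d. (cmod (vec_index (\<psi> k) i))\<^sup>2)" using eq by simp
    show "\<forall>i<d. integrable \<mu> (\<lambda>k. (cmod (vec_index (\<psi> k) i))\<^sup>2)"
    proof (intro allI impI)
      fix i assume i: "i < d"
      show "integrable \<mu> (\<lambda>k. (cmod (vec_index (\<psi> k) i))\<^sup>2)"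
      proof (rule Bochner_Integration.integrable_bound[OF I])
        have "(\<lambda>k. vec_index (\<psi> k) i) \<in> borel_measurable \<mu>" using assms i by blast
        then show "(\<lambda>k. (cmod (vec_index (\<psi> k) i))\<^sup>2) \<in> borel_measurable \<mu>" by measurable
        have "(cmod (vec_index (\<psi> k) i))\<^sup>2 \<le> (\<Sum>i<d. (cmod (vec_index (\<psi> k) i))\<^sup>2)" for k
          using i by (intro member_le_sum) auto
        then show "AE k in \<mu>. norm ((cmod (vec_index (\<psi> k) i))\<^sup>2) \<le> norm (\<Sum>i<d. (cmod (vec_index (\<psi> k) i))\<^sup>2)"
          by (intro AE_I2) (auto intro!: order_trans[OF _ abs_ge_self])
      qed
    qed
  qed (use eq in auto)
qed

lemma integrable_mult_cnj:
  fixes p q :: "'n sqmat \<Rightarrow> complex"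
  assumes m: "p \<in> borel_measurable \<mu>" "q \<in> borel_measurable \<mu>"
    and i: "integrable \<mu> (\<lambda>k. (cmod (p k))\<^sup>2)" "integrable \<mu> (\<lambda>k. (cmod (q k))\<^sup>2)"
  shows "integrable \<mu> (\<lambda>k. p k * cnj (q k))"
proof (rule Bochner_Integration.integrable_bound[OF Bochner_Integration.integrable_add[OF i]])
  have "(\<lambda>k. cnj (q k)) \<in> borel_measurable \<mu>"
    by (rule borel_measurable_continuous_on[OF _ m(2), of cnj]) (intro continuous_intros)
  then show "(\<lambda>k. p k * cnj (q k)) \<in> borel_measurable \<mu>" using m(1) by (intro borel_measurable_times)
  have "cmod a * cmod b \<le> (cmod a)\<^sup>2 + (cmod b)\<^sup>2" for a b :: complex
    using sum_squares_bound[of "cmod a" "cmod b"] mult_nonneg_nonneg[OF norm_ge_zero[of a] norm_ge_zero[of b]] by linarith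
  then show "AE k in \<mu>. norm (p k * cnj (q k)) \<le> norm ((cmod (p k))\<^sup>2 + (cmod (q k))\<^sup>2)"
    by (simp add: norm_mult)
qed

lemma L2_component:
  assumes "\<psi> \<in> L2 d" "i < d"
  shows "(\<lambda>k. vec_index (\<psi> k) i) \<in> borel_measurable \<mu>" "integrable \<mu> (\<lambda>k. (cmod (vec_index (\<psi> k) i))\<^sup>2)"
    "integrable \<mu> (\<lambda>k. vec_index (\<psi> k) i)"
proof -
  show 1: "(\<lambda>k. vec_index (\<psi> k) i) \<in> borel_measurable \<mu>" "integrable \<mu> (\<lambda>k. (cmod (vec_index (\<psi> k) i))\<^sup>2)"
    using assms by (auto simp: L2_def)
  show "integrable \<mu> (\<lambda>k. vec_index (\<psi> k) i)"
    using integrable_mult_cnj[OF 1(1) _ 1(2), of "\<lambda>_. 1"] by simp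
qed

lemma H_inner_sum:
  assumes a: "a \<in> L2 d" and b: "b \<in> L2 d"
  shows "H_inner \<mu> d a b = of_nat d * (\<Sum>i<d. (LINT k|\<mu>. vec_index (a k) i * cnj (vec_index (b k) i)))"
proof -
  have "(LINT k|\<mu>. a k \<bullet>c b k) = (LINT k|\<mu>. (\<Sum>i<d. vec_index (a k) i * cnj (vec_index (b k) i)))"
    using a b by (intro Bochner_Integration.integral_cong refl cscalar_prod_sum) (auto simp: space_mu L2_def)
  also have "\<dots> = (\<Sum>i<d. (LINT k|\<mu>. vec_index (a k) i * cnj (vec_index (b k) i)))"
    using L2_component[OF a] L2_component[OF b] by (intro Bochner_Integration.integral_sum integrable_mult_cnj) auto
  finally show ?thesis by (simp add: H_inner_def)
qed

lemma integrable_sq_add: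
  fixes p q :: "'n sqmat \<Rightarrow> complex"
  assumes m: "p \<in> borel_measurable \<mu>" "q \<in> borel_measurable \<mu>"
    and i: "integrable \<mu> (\<lambda>k. (cmod (p k))\<^sup>2)" "integrable \<mu> (\<lambda>k. (cmod (q k))\<^sup>2)"
  shows "integrable \<mu> (\<lambda>k. (cmod (p k + q k))\<^sup>2)"
proof (rule Bochner_Integration.integrable_bound[OF integrable_mult_right[OF Bochner_Integration.integrable_add[OF i], of 2]])
  show "(\<lambda>k. (cmod (p k + q k))\<^sup>2) \<in> borel_measurable \<mu>" using m by measurable
  have "(cmod (a + b))\<^sup>2 \<le> 2 * ((cmod a)\<^sup>2 + (cmod b)\<^sup>2)" for a b :: complex
  proof -
    have "(cmod (a + b))\<^sup>2 \<le> (cmod a + cmod b)\<^sup>2" by (intro power_mono norm_triangle_ineq) auto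
    also have "\<dots> \<le> 2 * ((cmod a)\<^sup>2 + (cmod b)\<^sup>2)"
      using sum_squares_bound[of "cmod a" "cmod b"] by (simp add: power2_sum)
    finally show ?thesis .
  qed
  then show "AE k in \<mu>. norm ((cmod (p k + q k))\<^sup>2) \<le> norm (2 * ((cmod (p k))\<^sup>2 + (cmod (q k))\<^sup>2))"
    by simp
qed

lemma L2I:
  assumes c: "\<And>k. k \<in> SO \<Longrightarrow> \<psi> k \<in> carrier_vec d"
    and m: "\<And>i. i < d \<Longrightarrow> G i \<in> borel_measurable \<mu>" and g: "\<And>i. i < d \<Longrightarrow> integrable \<mu> (\<lambda>k. (cmod (G i k))\<^sup>2)"
    and eq: "\<And>i k. i < d \<Longrightarrow> k \<in> SO \<Longrightarrow> vec_index (\<psi> k) i = G i k"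
  shows "\<psi> \<in> L2 d"
proof -
  have "(\<lambda>k. vec_index (\<psi> k) i) \<in> borel_measurable \<mu>" if "i < d" for i
    using m[OF that] eq[OF that] by (subst measurable_cong[of _ _ "G i"]) (auto simp: space_mu)
  moreover have "integrable \<mu> (\<lambda>k. (cmod (vec_index (\<psi> k) i))\<^sup>2)" if "i < d" for i
    using g[OF that] eq[OF that]
    by (subst Bochner_Integration.integrable_cong[of \<mu> \<mu> _ "\<lambda>k. (cmod (G i k))\<^sup>2"]) (auto simp: space_mu)
  ultimately show ?thesis using c by (auto simp: L2_def)
qed

lemma semi_inner_space_L2:
  "semi_inner_space (L2 d) (H_inner \<mu> d) (\<lambda>a b k. a k + b k) (\<lambda>z a k. z \<cdot>\<^sub>v a k)"
proof
  fix a b c :: "'n sqmat \<Rightarrow> complex Matrix.vec" and z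
  assume a: "a \<in> L2 d"
  have ac: "a k \<in> carrier_vec d" if "k \<in> SO" for k using a that by (auto simp: L2_def)
  have zi: "vec_index (z \<cdot>\<^sub>v a k) i = z * vec_index (a k) i" if "k \<in> SO" "i < d" for k i using ac[OF that(1)] that by simp
  show za: "(\<lambda>k. z \<cdot>\<^sub>v a k) \<in> L2 d"
  proof (rule L2I[where G = "\<lambda>i k. z * vec_index (a k) i"])
    fix i assume i: "i < d"
    show "(\<lambda>k. z * vec_index (a k) i) \<in> borel_measurable \<mu>" using L2_component(1)[OF a i] by measurable
    show "integrable \<mu> (\<lambda>k. (cmod (z * vec_index (a k) i))\<^sup>2)"
      using L2_component(2)[OF a i] by (simp add: norm_mult power_mult_distrib)
  qed (use ac zi in auto)
  show "0 \<le> Re (H_inner \<mu> d a a)"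
  proof -
    have "H_inner \<mu> d a a = of_real (real d * (\<Sum>i<d. (LINT k|\<mu>. (cmod (vec_index (a k) i))\<^sup>2)))"
      unfolding H_inner_sum[OF a a] by (simp add: complex_norm_square[symmetric] integral_complex_of_real del: of_real_power)
    then show ?thesis by (simp add: sum_nonneg)
  qed
  {
    assume b: "b \<in> L2 d"
    have bc: "b k \<in> carrier_vec d" if "k \<in> SO" for k using b that by (auto simp: L2_def)
    have abi: "vec_index (a k + b k) i = vec_index (a k) i + vec_index (b k) i" if "k \<in> SO" "i < d" for k i
      using ac[OF that(1)] bc[OF that(1)] that by simp
    show ab: "(\<lambda>k. a k + b k) \<in> L2 d"
    proof (rule L2I[where G = "\<lambda>i k. vec_index (a k) i + vec_index (b k) i"])
      fix i assume i: "i < d"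
      show "(\<lambda>k. vec_index (a k) i + vec_index (b k) i) \<in> borel_measurable \<mu>"
        using L2_component(1)[OF a i] L2_component(1)[OF b i] by (rule borel_measurable_add)
      show "integrable \<mu> (\<lambda>k. (cmod (vec_index (a k) i + vec_index (b k) i))\<^sup>2)"
        by (rule integrable_sq_add[OF L2_component(1)[OF a i] L2_component(1)[OF b i] L2_component(2)[OF a i] L2_component(2)[OF b i]])
    qed (use ac bc abi in auto)
    have "(LINT k|\<mu>. vec_index (b k) i * cnj (vec_index (a k) i)) = cnj (LINT k|\<mu>. vec_index (a k) i * cnj (vec_index (b k) i))" for i
      by (subst Bochner_Integration.integral_cnj[symmetric]) (simp add: mult.commute)
    then show "H_inner \<mu> d b a = cnj (H_inner \<mu> d a b)"
      unfolding H_inner_sum[OF a b] H_inner_sum[OF b a] by simp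
    assume c: "c \<in> L2 d"
    have "(LINT k|\<mu>. vec_index (a k + b k) i * cnj (vec_index (c k) i))
      = (LINT k|\<mu>. vec_index (a k) i * cnj (vec_index (c k) i)) + (LINT k|\<mu>. vec_index (b k) i * cnj (vec_index (c k) i))" if "i < d" for i
    proof -
      have "(LINT k|\<mu>. vec_index (a k + b k) i * cnj (vec_index (c k) i)) = (LINT k|\<mu>. vec_index (a k) i * cnj (vec_index (c k) i) + vec_index (b k) i * cnj (vec_index (c k) i))"
        using abi that by (intro Bochner_Integration.integral_cong refl) (simp add: space_mu distrib_right)
      then show ?thesis using L2_component[OF a that] L2_component[OF b that] L2_component[OF c that]
        by (simp add: integrable_mult_cnj)
    qed
    then show "H_inner \<mu> d (\<lambda>k. a k + b k) c = H_inner \<mu> d a c + H_inner \<mu> d b c"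
      unfolding H_inner_sum[OF ab c] H_inner_sum[OF a c] H_inner_sum[OF b c]
      by (simp add: sum.distrib distrib_left)
  next
    assume c: "c \<in> L2 d"
    have "(LINT k|\<mu>. vec_index (z \<cdot>\<^sub>v a k) i * cnj (vec_index (c k) i)) = z * (LINT k|\<mu>. vec_index (a k) i * cnj (vec_index (c k) i))" if "i < d" for i
    proof -
      have "(LINT k|\<mu>. vec_index (z \<cdot>\<^sub>v a k) i * cnj (vec_index (c k) i)) = (LINT k|\<mu>. z * (vec_index (a k) i * cnj (vec_index (c k) i)))"
        using zi that by (intro Bochner_Integration.integral_cong refl) (simp add: space_mu mult.assoc)
      then show ?thesis by simp
    qed
    then show "H_inner \<mu> d (\<lambda>k. z \<cdot>\<^sub>v a k) c = z * H_inner \<mu> d a c"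
      unfolding H_inner_sum[OF za c] H_inner_sum[OF a c] by (simp add: sum_distrib_left mult.left_commute)
  }
qed

end

context motion_kernel
begin

sublocale sip: semi_inner_space "L2 d" "H_inner \<mu> d" "\<lambda>a b k. a k + b k" "\<lambda>z a k. z \<cdot>\<^sub>v a k" for d
  by (rule semi_inner_space_L2)

lemma H_space_iff:
  "\<psi> \<in> H_space \<mu> d lam \<longleftrightarrow> \<psi> \<in> L2 d \<and> (\<forall>u\<in>K1. \<forall>k\<in>SO. \<psi> (u ** k) = lam u *\<^sub>v \<psi> k)"
  unfolding H_space_def L2_def using integrable_Re_cscalar_iff[of \<psi> d] by auto

definition kernel_op :: "nat \<Rightarrow> ('n sqmat \<Rightarrow> 'n sqmat \<Rightarrow> complex) \<Rightarrow> ('n sqmat \<Rightarrow> complex Matrix.vec) \<Rightarrow> 'n sqmat \<Rightarrow> complex Matrix.vec" where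
  "kernel_op d N \<psi> k0 = Matrix.vec d (\<lambda>i. LINT k|\<mu>. N k0 k * vec_index (\<psi> k) i)"

lemma kernel_op:
  assumes N: "continuous_on (SO \<times> SO) (\<lambda>p. N (fst p) (snd p))"
    and \<psi>: "\<psi> \<in> L2 d"
  shows "i < d \<Longrightarrow> continuous_on SO (\<lambda>k0. vec_index (kernel_op d N \<psi> k0) i)" "kernel_op d N \<psi> \<in> L2 d"
    "k0 \<in> SO \<Longrightarrow> i < d \<Longrightarrow> integrable \<mu> (\<lambda>k. N k0 k * vec_index (\<psi> k) i)"
proof -
  obtain C where C: "\<And>k0 k. k0 \<in> SO \<Longrightarrow> k \<in> SO \<Longrightarrow> norm (N k0 k) \<le> C"
    using compact_imp_bounded[OF compact_continuous_image[OF N compact_Times[OF compact_SO compact_SO]]]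
    unfolding bounded_iff by fastforce
  have Nc: "continuous_on SO (\<lambda>k. N k0 k)" if "k0 \<in> SO" for k0
    using that by (intro continuous_on_compose2[OF N, of SO "\<lambda>k. (k0, k)", simplified] continuous_intros) auto
  have Nc': "continuous_on SO (\<lambda>k0. N k0 k)" if "k \<in> SO" for k
    using that by (intro continuous_on_compose2[OF N, of SO "\<lambda>k0. (k0, k)", simplified] continuous_intros) auto
  have m: "(\<lambda>k. N k0 k * vec_index (\<psi> k) i) \<in> borel_measurable \<mu>" if "k0 \<in> SO" "i < d" for k0 i
    using measurable_mu_continuous_on[OF Nc[OF that(1)]] L2_component[OF \<psi> that(2)] by (intro borel_measurable_times)
  have le: "norm (N k0 k * vec_index (\<psi> k) i) \<le> C * norm (vec_index (\<psi> k) i)" if "k0 \<in> SO" "k \<in> SO" for k0 k i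
    using C[OF that] by (simp add: norm_mult mult_right_mono)
  have int: "integrable \<mu> (\<lambda>k. C * norm (vec_index (\<psi> k) i))" if "i < d" for i
    using L2_component[OF \<psi> that] by simp
  show "integrable \<mu> (\<lambda>k. N k0 k * vec_index (\<psi> k) i)" if "k0 \<in> SO" "i < d" for k0 i
    by (rule Bochner_Integration.integrable_bound[OF int[OF that(2)] m[OF that]])
      (use that in \<open>auto intro!: AE_I2 order_trans[OF le abs_ge_self] simp: space_mu\<close>)
  show cont: "continuous_on SO (\<lambda>k0. vec_index (kernel_op d N \<psi> k0) i)" if i: "i < d" for i
  proof -
    have "continuous_on SO (\<lambda>k0. LINT k|\<mu>. N k0 k * vec_index (\<psi> k) i)"
      by (rule continuous_on_param_integral[OF m[OF _ i] _ int[OF i]])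
        (use le Nc' in \<open>auto simp: space_mu intro!: continuous_intros\<close>)
    then show ?thesis using i by (simp add: kernel_op_def)
  qed
  show "kernel_op d N \<psi> \<in> L2 d"
    unfolding L2_def
  proof (intro CollectI conjI ballI allI impI)
    show "kernel_op d N \<psi> k \<in> carrier_vec d" for k by (simp add: kernel_op_def)
    fix i assume i: "i < d"
    show "(\<lambda>k. vec_index (kernel_op d N \<psi> k) i) \<in> borel_measurable \<mu>"
      by (rule measurable_mu_continuous_on[OF cont[OF i]])
    have "integrable \<mu> (\<lambda>k. complex_of_real ((cmod (vec_index (kernel_op d N \<psi> k) i))\<^sup>2))"
      by (intro integrable_continuous_on continuous_intros cont[OF i])
    then show "integrable \<mu> (\<lambda>k. (cmod (vec_index (kernel_op d N \<psi> k) i))\<^sup>2)"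
      by (simp only: complex_of_real_integrable_eq)
  qed
qed

text \<open>
  Left invariance of the measure allows one to translate the integration variable by \<open>u\<close> as well, and the
  kernel is invariant under the common translation.
\<close>
lemma kernel_op_covariant:
  assumes N: "continuous_on (SO \<times> SO) (\<lambda>p. N (fst p) (snd p))"
    and inv: "\<And>u k0 k. u \<in> K1 \<Longrightarrow> N (u ** k0) (u ** k) = N k0 k"
    and rep: "unitary_matrix_rep K1 d lam" and \<psi>: "\<psi> \<in> H_space \<mu> d lam"
  shows "kernel_op d N \<psi> \<in> H_space \<mu> d lam"
proof -
  have \<psi>L: "\<psi> \<in> L2 d" using \<psi> by (simp add: H_space_iff)
  have "kernel_op d N \<psi> (u ** k0) = lam u *\<^sub>v kernel_op d N \<psi> k0" if u: "u \<in> K1" and k0: "k0 \<in> SO" for u k0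
  proof (rule eq_vecI)
    have uS: "u \<in> SO" using u by (simp add: K1_def)
    have l: "lam u \<in> carrier_mat d d" using rep u by (simp add: unitary_matrix_rep_def)
    have kc: "kernel_op d N \<psi> k0 \<in> carrier_vec d" for k0 by (simp add: kernel_op_def)
    show "dim_vec (kernel_op d N \<psi> (u ** k0)) = dim_vec (lam u *\<^sub>v kernel_op d N \<psi> k0)"
      using l by (simp add: kernel_op_def)
    fix i assume "i < dim_vec (lam u *\<^sub>v kernel_op d N \<psi> k0)"
    then have i: "i < d" using l by simp
    have uk: "u ** k0 \<in> SO" using uS k0 by (rule SO_mult)
    have "vec_index (kernel_op d N \<psi> (u ** k0)) i = (LINT k|\<mu>. N (u ** k0) k * vec_index (\<psi> k) i)"
      using i by (simp add: kernel_op_def)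
    also have "\<dots> = (LINT k|\<mu>. N (u ** k0) (u ** k) * vec_index (\<psi> (u ** k)) i)"
      by (rule integral_left_mult[OF uS, symmetric]) (use kernel_op(3)[OF N \<psi>L uk i] in auto)
    also have "\<dots> = (LINT k|\<mu>. (\<Sum>j<d. index_mat (lam u) (i, j) * (N k0 k * vec_index (\<psi> k) j)))"
    proof (rule Bochner_Integration.integral_cong[OF refl])
      fix k assume "k \<in> space \<mu>"
      then have k: "k \<in> SO" by (simp add: space_mu)
      have pk: "\<psi> k \<in> carrier_vec d" using \<psi>L k by (auto simp: L2_def)
      have "\<psi> (u ** k) = lam u *\<^sub>v \<psi> k" using \<psi> u k by (simp add: H_space_iff)
      then have "vec_index (\<psi> (u ** k)) i = (\<Sum>j<d. index_mat (lam u) (i, j) * vec_index (\<psi> k) j)"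
        using index_mult_vec_sum[OF l pk i] by simp
      then show "N (u ** k0) (u ** k) * vec_index (\<psi> (u ** k)) i = (\<Sum>j<d. index_mat (lam u) (i, j) * (N k0 k * vec_index (\<psi> k) j))"
        by (simp add: inv[OF u] sum_distrib_left mult.left_commute)
    qed
    also have "\<dots> = (\<Sum>j<d. index_mat (lam u) (i, j) * (LINT k|\<mu>. N k0 k * vec_index (\<psi> k) j))"
      using kernel_op(3)[OF N \<psi>L k0] by (subst Bochner_Integration.integral_sum) auto
    also have "\<dots> = vec_index (lam u *\<^sub>v kernel_op d N \<psi> k0) i"
      unfolding index_mult_vec_sum[OF l kc i] by (simp add: kernel_op_def)
    finally show "vec_index (kernel_op d N \<psi> (u ** k0)) i = vec_index (lam u *\<^sub>v kernel_op d N \<psi> k0) i" .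
  qed
  then show ?thesis using kernel_op(2)[OF N \<psi>L] by (simp add: H_space_iff)
qed

lemma integrable_tensor:
  assumes \<psi>: "\<psi> \<in> L2 d" and \<phi>: "\<phi> \<in> L2 d"
  shows "integrable (\<mu> \<Otimes>\<^sub>M \<mu>) (\<lambda>p. \<psi> (snd p) \<bullet>c \<phi> (fst p))"
proof -
  have "integrable (\<mu> \<Otimes>\<^sub>M \<mu>) (\<lambda>p. \<Sum>i<d. cnj (vec_index (\<phi> (fst p)) i) * vec_index (\<psi> (snd p)) i)"
    using L2_component(3)[OF \<psi>] L2_component(3)[OF \<phi>]
    by (intro Bochner_Integration.integrable_sum integrable_pair_product PP.pair_sigma_finite_axioms) auto
  then show ?thesis
    by (rule Bochner_Integration.integrable_cong[THEN iffD1, OF refl, rotated])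
      (use \<psi> \<phi> in \<open>auto simp: space_pair_measure space_mu L2_def cscalar_prod_sum[of _ d] mult.commute\<close>)
qed

lemma kernel_op_inner:
  assumes N: "continuous_on (SO \<times> SO) (\<lambda>p. N (fst p) (snd p))"
    and \<psi>: "\<psi> \<in> L2 d" and \<phi>: "\<phi> \<in> L2 d"
  shows "of_nat d * (LINT k0|\<mu>. LINT k|\<mu>. N k0 k * (\<psi> k \<bullet>c \<phi> k0)) = H_inner \<mu> d (kernel_op d N \<psi>) \<phi>"
proof -
  have "(LINT k|\<mu>. N k0 k * (\<psi> k \<bullet>c \<phi> k0)) = kernel_op d N \<psi> k0 \<bullet>c \<phi> k0" if k0: "k0 \<in> SO" for k0
  proof -
    have "(LINT k|\<mu>. N k0 k * (\<psi> k \<bullet>c \<phi> k0)) = (LINT k|\<mu>. (\<Sum>i<d. (N k0 k * vec_index (\<psi> k) i) * cnj (vec_index (\<phi> k0) i)))"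
      using \<psi> \<phi> k0 by (intro Bochner_Integration.integral_cong refl)
        (auto simp: space_mu L2_def cscalar_prod_sum[of _ d] sum_distrib_left mult.assoc)
    also have "\<dots> = (\<Sum>i<d. (LINT k|\<mu>. N k0 k * vec_index (\<psi> k) i) * cnj (vec_index (\<phi> k0) i))"
      using kernel_op(3)[OF N \<psi> k0] by (subst Bochner_Integration.integral_sum) auto
    also have "\<dots> = kernel_op d N \<psi> k0 \<bullet>c \<phi> k0"
      using \<phi> k0 by (subst cscalar_prod_sum[of _ d]) (auto simp: kernel_op_def L2_def)
    finally show ?thesis .
  qed
  then show ?thesis unfolding H_inner_def
    by (intro arg_cong[where f = "\<lambda>z. of_nat d * z"] Bochner_Integration.integral_cong refl) (simp add: space_mu)
qed

lemma weak_fourier_eq: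
  assumes \<psi>: "\<psi> \<in> L2 d" and \<phi>: "\<phi> \<in> L2 d"
  shows "(LINT k|\<mu>. LINT x|lborel. f (x, k) * H_inner \<mu> d (T_rep r (x, k) \<psi>) \<phi>)
     = of_nat d * (LINT k0|\<mu>. LINT k|\<mu>. kern r k0 k * (\<psi> k \<bullet>c \<phi> k0))"
proof -
  define Th where "Th = (\<lambda>p. \<psi> (snd p) \<bullet>c \<phi> (fst p))"
  have Th: "integrable (\<mu> \<Otimes>\<^sub>M \<mu>) Th" unfolding Th_def by (rule integrable_tensor[OF \<psi> \<phi>])
  have "H_inner \<mu> d (T_rep r (x, k) \<psi>) \<phi> = of_nat d * (LINT k0|\<mu>. phase r k0 x * Th (k0, k0 ** k))" if k: "k \<in> SO" for x k
    unfolding H_inner_def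
  proof (intro arg_cong[where f = "\<lambda>z. of_nat d * z"] Bochner_Integration.integral_cong refl)
    fix k0 assume "k0 \<in> space \<mu>"
    then have k0: "k0 \<in> SO" by (simp add: space_mu)
    have c: "\<psi> (k0 ** k) \<in> carrier_vec d" "\<phi> k0 \<in> carrier_vec d" using \<psi> \<phi> k k0 SO_mult by (auto simp: L2_def)
    have "T_rep r (x, k) \<psi> k0 = phase r k0 x \<cdot>\<^sub>v \<psi> (k0 ** k)"
      by (simp add: T_rep_def phase_def SO_inverse(3)[OF k0])
    then show "T_rep r (x, k) \<psi> k0 \<bullet>c \<phi> k0 = phase r k0 x * Th (k0, k0 ** k)"
      using c by (simp add: Th_def)
  qed
  then have "(LINT k|\<mu>. LINT x|lborel. f (x, k) * H_inner \<mu> d (T_rep r (x, k) \<psi>) \<phi>)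
     = (LINT k|\<mu>. LINT x|lborel. of_nat d * (f (x, k) * (LINT k0|\<mu>. phase r k0 x * Th (k0, k0 ** k))))"
    by (intro Bochner_Integration.integral_cong refl) (simp add: space_mu mult.left_commute)
  also have "\<dots> = of_nat d * (LINT k|\<mu>. LINT x|lborel. f (x, k) * (LINT k0|\<mu>. phase r k0 x * Th (k0, k0 ** k)))" by simp
  also have "\<dots> = of_nat d * (LINT k0|\<mu>. LINT k|\<mu>. kern r k0 k * Th (k0, k))"
    unfolding weak_integral_eq_kernel[OF Th] ..
  finally show ?thesis by (simp add: Th_def)
qed

text \<open>
  The kernel operator satisfies the defining equation of the Fourier transform. The vector chosen
  there can differ from it only by a null vector, which affects neither its inner products nor its
  norm.
\<close>
lemma group_fourier_eq:
  fixes r :: real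
  assumes rep: "unitary_matrix_rep K1 d lam" and \<psi>: "\<psi> \<in> H_space \<mu> d lam"
  defines "\<eta> \<equiv> group_fourier \<mu> (H_space \<mu> d lam) (H_inner \<mu> d) f (T_rep r) \<psi>"
  shows "\<eta> \<in> H_space \<mu> d lam"
    and "\<phi> \<in> H_space \<mu> d lam \<Longrightarrow> H_inner \<mu> d \<eta> \<phi> = of_nat d * (LINT k0|\<mu>. LINT k|\<mu>. kern r k0 k * (\<psi> k \<bullet>c \<phi> k0))"
    and "H_inner \<mu> d \<eta> \<eta> = H_inner \<mu> d (kernel_op d (kern r) \<psi>) (kernel_op d (kern r) \<psi>)"
proof -
  define A where "A = kernel_op d (kern r) \<psi>"
  have sub: "\<phi> \<in> L2 d" if "\<phi> \<in> H_space \<mu> d lam" for \<phi> using that by (simp add: H_space_iff)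
  have A: "A \<in> H_space \<mu> d lam"
    unfolding A_def by (rule kernel_op_covariant[OF continuous_on_kern kern_left_mult rep \<psi>])
  have Aw: "H_inner \<mu> d A \<phi> = (LINT k|\<mu>. LINT x|lborel. f (x, k) * H_inner \<mu> d (T_rep r (x, k) \<psi>) \<phi>)" if "\<phi> \<in> H_space \<mu> d lam" for \<phi>
    unfolding A_def using kernel_op_inner[OF continuous_on_kern sub[OF \<psi>] sub[OF that]] weak_fourier_eq[OF sub[OF \<psi>] sub[OF that]] by simp
  have "\<eta> \<in> H_space \<mu> d lam \<and> (\<forall>\<phi>\<in>H_space \<mu> d lam. H_inner \<mu> d \<eta> \<phi> = (LINT k|\<mu>. LINT x|lborel. f (x, k) * H_inner \<mu> d (T_rep r (x, k) \<psi>) \<phi>))"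
    unfolding \<eta>_def group_fourier_def by (rule someI[of _ A]) (use A Aw in blast)
  then have \<eta>: "\<eta> \<in> H_space \<mu> d lam" and w: "\<And>\<phi>. \<phi> \<in> H_space \<mu> d lam \<Longrightarrow> H_inner \<mu> d \<eta> \<phi> = H_inner \<mu> d A \<phi>"
    using Aw by auto
  show "\<eta> \<in> H_space \<mu> d lam" by (rule \<eta>)
  show "H_inner \<mu> d \<eta> \<phi> = of_nat d * (LINT k0|\<mu>. LINT k|\<mu>. kern r k0 k * (\<psi> k \<bullet>c \<phi> k0))" if "\<phi> \<in> H_space \<mu> d lam" for \<phi>
    using w[OF that] Aw[OF that] weak_fourier_eq[OF sub[OF \<psi>] sub[OF that]] by simp
  have "H_inner \<mu> d \<eta> \<eta> = H_inner \<mu> d A \<eta>" by (rule w[OF \<eta>])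
  also have "\<dots> = cnj (H_inner \<mu> d \<eta> A)" by (rule sip.ip_cnj[OF sub[OF \<eta>] sub[OF A]])
  also have "\<dots> = cnj (H_inner \<mu> d A A)" by (simp add: w[OF A])
  also have "\<dots> = H_inner \<mu> d A A" by (rule sip.ip_cnj[OF sub[OF A] sub[OF A], symmetric])
  finally show "H_inner \<mu> d \<eta> \<eta> = H_inner \<mu> d (kernel_op d (kern r) \<psi>) (kernel_op d (kern r) \<psi>)" unfolding A_def .
qed

lemma H_space_basis:
  assumes rep: "unitary_matrix_rep K1 d lam"
  shows "orthonormal_basis (H_space \<mu> d lam) (H_inner \<mu> d) (SOME E. orthonormal_basis (H_space \<mu> d lam) (H_inner \<mu> d) E)"
proof (rule someI_ex, rule sip.orthonormal_basis_exists[of _ d])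
  show "H_space \<mu> d lam \<subseteq> L2 d" by (auto simp: H_space_iff)
  fix a z assume a: "a \<in> H_space \<mu> d lam"
  have "z \<cdot>\<^sub>v a (u ** k) = lam u *\<^sub>v (z \<cdot>\<^sub>v a k)" if "u \<in> K1" "k \<in> SO" for u k
  proof -
    have "lam u \<in> carrier_mat d d" using rep that by (simp add: unitary_matrix_rep_def)
    moreover have "a k \<in> carrier_vec d" "a (u ** k) = lam u *\<^sub>v a k" using a that by (auto simp: H_space_iff L2_def)
    ultimately show ?thesis by (simp add: mult_mat_vec)
  qed
  then show "(\<lambda>k. z \<cdot>\<^sub>v a k) \<in> H_space \<mu> d lam"
    using a sip.scale_closed[of a d z] by (simp add: H_space_iff)
qed

text \<open>
  Such a kernel sends \<open>e\<close> to \<open>c\<close> times its mean value. The components of the mean values are the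
  coefficients of the constant functions with respect to the orthonormal system, so the sum of
  their squares is bounded by Bessel's inequality.
\<close>
lemma hs_norm_right_invariant_le:
  assumes rep: "unitary_matrix_rep K1 d lam"
    and kc: "\<And>k0 k. k0 \<in> SO \<Longrightarrow> k \<in> SO \<Longrightarrow> kern r k0 k = c k0" and cD: "\<And>k0. k0 \<in> SO \<Longrightarrow> norm (c k0) \<le> D"
  shows "fourier_hs_norm \<mu> f r d lam \<le> ennreal (sqrt (real d) * D)"
  unfolding fourier_hs_norm_def
proof (rule hs_norm_le[OF refl])
  let ?H = "H_space \<mu> d lam" and ?ip = "H_inner \<mu> d"
  let ?E = "SOME E. orthonormal_basis ?H ?ip E"
  let ?A = "group_fourier \<mu> ?H ?ip f (T_rep r)"
  have E: "?E \<subseteq> ?H" "\<And>e e'. e \<in> ?E \<Longrightarrow> e' \<in> ?E \<Longrightarrow> ?ip e e' = (if e = e' then 1 else 0)"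
    using H_space_basis[OF rep] unfolding orthonormal_basis_def by blast+
  have EL: "e \<in> L2 d" if "e \<in> ?E" for e using E(1) that by (auto simp: H_space_iff)
  have D0: "D \<ge> 0" using cD[OF SO_one] norm_ge_zero order_trans by blast
  show "0 \<le> sqrt (real d) * D" using D0 by simp
  show "0 \<le> Re (?ip (?A e) (?A e))" if "e \<in> ?E" for e
    using group_fourier_eq(1)[OF rep subsetD[OF E(1) that], of r] by (intro sip.ip_nonneg) (simp add: H_space_iff)
  define m where "m = (\<lambda>e i. LINT k|\<mu>. vec_index (e k :: complex Matrix.vec) i)"
  have term_le: "Re (?ip (?A e) (?A e)) \<le> real d * (D\<^sup>2 * (\<Sum>i<d. (cmod (m e i))\<^sup>2))" if e: "e \<in> ?E" for e
  proof -
    have eH: "e \<in> ?H" using E(1) e by blast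
    define A where "A = kernel_op d (kern r) e"
    have AL: "A \<in> L2 d" unfolding A_def by (rule kernel_op(2)[OF continuous_on_kern EL[OF e]])
    have Ai: "vec_index (A k0) i = c k0 * m e i" if "k0 \<in> SO" "i < d" for k0 i
    proof -
      have "vec_index (A k0) i = (LINT k|\<mu>. kern r k0 k * vec_index (e k) i)" using that by (simp add: A_def kernel_op_def)
      also have "\<dots> = (LINT k|\<mu>. c k0 * vec_index (e k) i)"
        using kc that by (intro Bochner_Integration.integral_cong refl) (simp add: space_mu)
      finally show ?thesis by (simp add: m_def)
    qed
    have "?ip (?A e) (?A e) = ?ip A A" unfolding A_def by (rule group_fourier_eq(3)[OF rep eH])
    also have "\<dots> = of_real (real d * (\<Sum>i<d. (LINT k|\<mu>. (cmod (vec_index (A k) i))\<^sup>2)))"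
      unfolding H_inner_sum[OF AL AL] by (simp add: complex_norm_square[symmetric] integral_complex_of_real del: of_real_power)
    finally have "Re (?ip (?A e) (?A e)) = real d * (\<Sum>i<d. (LINT k|\<mu>. (cmod (vec_index (A k) i))\<^sup>2))" by simp
    also have "\<dots> \<le> real d * (\<Sum>i<d. D\<^sup>2 * (cmod (m e i))\<^sup>2)"
    proof (intro mult_left_mono sum_mono)
      fix i assume i: "i \<in> {..<d}"
      have "(LINT k|\<mu>. (cmod (vec_index (A k) i))\<^sup>2) \<le> (LINT k|\<mu>. D\<^sup>2 * (cmod (m e i))\<^sup>2)"
      proof (rule integral_mono)
        fix k assume "k \<in> space \<mu>"
        then have k: "k \<in> SO" by (simp add: space_mu)
        show "(cmod (vec_index (A k) i))\<^sup>2 \<le> D\<^sup>2 * (cmod (m e i))\<^sup>2"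
          using cD[OF k] i Ai[OF k, of i] by (auto simp: norm_mult power_mult_distrib intro!: mult_right_mono power_mono)
      qed (use L2_component[OF AL] i in auto)
      then show "(LINT k|\<mu>. (cmod (vec_index (A k) i))\<^sup>2) \<le> D\<^sup>2 * (cmod (m e i))\<^sup>2" using prob_space by simp
    qed simp
    finally show ?thesis by (simp add: sum_distrib_left)
  qed
  fix F assume F: "finite F" "F \<subseteq> ?E"
  have bess: "(\<Sum>e\<in>F. (cmod (m e i))\<^sup>2) \<le> 1 / real d" if i: "i < d" for i
  proof -
    \<comment> \<open>The inner product with this constant function is \<open>d\<close> times the conjugate mean of component \<open>i\<close>.\<close>
    define w where "w = (\<lambda>k::'n sqmat. unit_vec d i :: complex Matrix.vec)"
    have wj: "vec_index (w k) j = (if j = i then 1 else 0)" if "j < d" for k j using that i by (simp add: w_def)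
    have w: "w \<in> L2 d" unfolding L2_def using wj by (auto simp: w_def)
    have "?ip w e = of_nat d * cnj (m e i)" if "e \<in> F" for e
    proof -
      have e: "e \<in> L2 d" using EL F that by blast
      have "?ip w e = of_nat d * (\<Sum>j<d. (LINT k|\<mu>. vec_index (w k) j * cnj (vec_index (e k) j)))" by (rule H_inner_sum[OF w e])
      also have "(\<Sum>j<d. (LINT k|\<mu>. vec_index (w k) j * cnj (vec_index (e k) j))) = (\<Sum>j<d. if j = i then cnj (m e j) else 0)"
        by (intro sum.cong refl) (auto simp: wj m_def)
      finally show ?thesis using i by simp
    qed
    then have "(\<Sum>e\<in>F. (cmod (?ip w e))\<^sup>2) = (real d)\<^sup>2 * (\<Sum>e\<in>F. (cmod (m e i))\<^sup>2)"
      by (simp add: norm_mult power_mult_distrib sum_distrib_left)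
    moreover have "(\<Sum>e\<in>F. (cmod (?ip w e))\<^sup>2) \<le> Re (?ip w w)"
    proof (rule sip.bessel[OF F(1) _ _ w])
      show "F \<subseteq> L2 d" using F(2) EL by blast
      show "?ip e e' = (if e = e' then 1 else 0)" if "e \<in> F" "e' \<in> F" for e e'
        by (rule E(2)[OF subsetD[OF F(2) that(1)] subsetD[OF F(2) that(2)]])
    qed
    moreover have "?ip w w = of_nat d"
    proof -
      have "?ip w w = of_nat d * (\<Sum>j<d. if j = i then 1 else 0)"
        unfolding H_inner_sum[OF w w] using prob_space
        by (intro arg_cong[where f = "\<lambda>z. of_nat d * z"] sum.cong refl) (auto simp: wj)
      then show ?thesis using i by simp
    qed
    ultimately have "(real d)\<^sup>2 * (\<Sum>e\<in>F. (cmod (m e i))\<^sup>2) \<le> real d" by simp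
    then show ?thesis using i by (simp add: field_simps power2_eq_square)
  qed
  have "(\<Sum>e\<in>F. Re (?ip (?A e) (?A e))) \<le> (\<Sum>e\<in>F. real d * (D\<^sup>2 * (\<Sum>i<d. (cmod (m e i))\<^sup>2)))"
    using F term_le by (intro sum_mono) auto
  also have "\<dots> = real d * (D\<^sup>2 * (\<Sum>i<d. \<Sum>e\<in>F. (cmod (m e i))\<^sup>2))"
  proof -
    have "(\<Sum>e\<in>F. real d * (D\<^sup>2 * S e)) = real d * (D\<^sup>2 * (\<Sum>e\<in>F. S e))" for S
      by (simp add: sum_distrib_left)
    then show ?thesis by (simp only: sum.swap[of _ "{..<d}" F])
  qed
  also have "\<dots> \<le> real d * (D\<^sup>2 * (\<Sum>i<d. 1 / real d))"
    using bess by (intro mult_left_mono sum_mono) auto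
  also have "\<dots> \<le> real d * D\<^sup>2" by (cases "d = 0") auto
  finally show "(\<Sum>e\<in>F. Re (?ip (?A e) (?A e))) \<le> (sqrt (real d) * D)\<^sup>2" by (simp add: power_mult_distrib)
qed

end

section \<open>Uniqueness and existence on the motion group\<close>

context motion_kernel
begin

lemma integrable_kernel_tensor:
  assumes \<psi>: "\<psi> \<in> L2 d" and \<phi>: "\<phi> \<in> L2 d"
  shows "integrable (\<mu> \<Otimes>\<^sub>M \<mu>) (\<lambda>(k0, k). kern r k0 k * (\<psi> k \<bullet>c \<phi> k0))"
proof (rule Bochner_Integration.integrable_bound[OF integrable_mult_right[OF integrable_norm[OF integrable_tensor[OF \<psi> \<phi>]], of "integral\<^sup>L lborel dom"]])
  show "(\<lambda>(k0, k). kern r k0 k * (\<psi> k \<bullet>c \<phi> k0)) \<in> borel_measurable (\<mu> \<Otimes>\<^sub>M \<mu>)"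
    using borel_measurable_times[OF borel_measurable_on_pair[OF continuous_on_kern] borel_measurable_integrable[OF integrable_tensor[OF \<psi> \<phi>]]]
    by (simp add: case_prod_unfold)
  show "AE p in \<mu> \<Otimes>\<^sub>M \<mu>. norm (case p of (k0, k) \<Rightarrow> kern r k0 k * (\<psi> k \<bullet>c \<phi> k0))
      \<le> norm (integral\<^sup>L lborel dom * norm (\<psi> (snd p) \<bullet>c \<phi> (fst p)))"
  proof (rule AE_I2, clarify)
    fix k0 k assume "(k0, k) \<in> space (\<mu> \<Otimes>\<^sub>M \<mu>)"
    then have "norm (kern r k0 k) \<le> integral\<^sup>L lborel dom" by (intro kern_bound) (auto simp: space_pair_measure space_mu)
    then show "norm (kern r k0 k * (\<psi> k \<bullet>c \<phi> k0)) \<le> norm (integral\<^sup>L lborel dom * norm (\<psi> (snd (k0, k)) \<bullet>c \<phi> (fst (k0, k))))"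
      by (auto simp: norm_mult intro!: order_trans[OF mult_right_mono abs_ge_self])
  qed
qed

text \<open>
  For each \<open>e\<close> of the basis \<open>E\<close>, the coefficient \<open>\<langle>M\<^sub>r e, \<phi>\<rangle>\<close> inherits the decay of the Hilbert--Schmidt
  norm by the Cauchy--Schwarz inequality and is therefore zero for all \<open>r\<close>. So the image of \<open>\<phi>\<close> under
  the adjoint kernel is orthogonal to \<open>E\<close>, hence null, and being continuous it is zero everywhere.
\<close>
lemma adjoint_kernel_orthogonal:
  fixes \<theta> :: "real \<Rightarrow> real"
  assumes nn: "\<And>r. r \<ge> 0 \<Longrightarrow> \<theta> r \<ge> 0" and loc: "\<And>R. \<theta> absolutely_integrable_on {0..R}"
    and inf: "(\<integral>\<^sup>+r\<in>{0..}. ennreal (\<theta> r / (1 + r\<^sup>2)) \<partial>lebesgue) = \<infinity>"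
    and irr: "irreducible_unitary_rep K1 d lam" and C: "C > 0"
    and bound: "\<And>r. r > 0 \<Longrightarrow> fourier_hs_norm \<mu> f r d lam \<le> ennreal (C * exp (- \<theta> r))"
    and cov: "covariant K1 d lam \<phi>" and i: "i < d" and k: "k \<in> SO"
  shows "(LINT k0|\<mu>. cnj (kern r k0 k) * vec_index (\<phi> k0) i) = 0"
proof -
  have rep: "unitary_matrix_rep K1 d lam" and d: "d > 0" using irr by (auto simp: irreducible_unitary_rep_def)
  let ?H = "H_space \<mu> d lam" and ?ip = "H_inner \<mu> d"
  define E where "E = (SOME E. orthonormal_basis ?H ?ip E)"
  have E: "orthonormal_basis ?H ?ip E" unfolding E_def by (rule H_space_basis[OF rep])
  have sub: "\<psi> \<in> L2 d" if "\<psi> \<in> ?H" for \<psi> using that by (simp add: H_space_iff)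
  have \<phi>L: "\<phi> \<in> L2 d"
  proof (rule L2I[where G = "\<lambda>i k. vec_index (\<phi> k) i"])
    fix j assume j: "j < d"
    have c: "continuous_on SO (\<lambda>k. vec_index (\<phi> k) j)" using cov j by (simp add: covariant_def)
    show "(\<lambda>k. vec_index (\<phi> k) j) \<in> borel_measurable \<mu>" by (rule measurable_mu_continuous_on[OF c])
    have "integrable \<mu> (\<lambda>k. complex_of_real ((cmod (vec_index (\<phi> k) j))\<^sup>2))"
      by (intro integrable_continuous_on continuous_intros c)
    then show "integrable \<mu> (\<lambda>k. (cmod (vec_index (\<phi> k) j))\<^sup>2)" by (simp only: complex_of_real_integrable_eq)
  qed (use cov in \<open>auto simp: covariant_def\<close>)
  have \<phi>H: "\<phi> \<in> ?H" using \<phi>L cov by (auto simp: H_space_iff covariant_def)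
  have zero: "(LINT k0|\<mu>. LINT k|\<mu>. kern r k0 k * (e k \<bullet>c \<phi> k0)) = 0" if e: "e \<in> E" for e r
  proof -
    have eH: "e \<in> ?H" using E e by (auto simp: orthonormal_basis_def)
    obtain w :: "('n sqmat \<times> 'n sqmat) \<times> 'n rvec \<Rightarrow> complex" and s where
      w: "integrable ((\<mu> \<Otimes>\<^sub>M \<mu>) \<Otimes>\<^sub>M lborel) w" and s: "s \<in> borel_measurable ((\<mu> \<Otimes>\<^sub>M \<mu>) \<Otimes>\<^sub>M lborel)"
      and sb: "\<And>p. \<bar>s p\<bar> \<le> \<bar>R\<bar>"
      and eq: "\<And>r. (LINT k0|\<mu>. LINT k|\<mu>. kern r k0 k * (e k \<bullet>c \<phi> k0))
        = (LINT p|((\<mu> \<Otimes>\<^sub>M \<mu>) \<Otimes>\<^sub>M lborel). exp (\<i> * of_real (r * s p)) * w p)"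
      using kernel_integral_as_fourier_integral[OF integrable_tensor[OF sub[OF eH] \<phi>L]] by auto
    have "(LINT p|((\<mu> \<Otimes>\<^sub>M \<mu>) \<Otimes>\<^sub>M lborel). exp (\<i> * of_real (r * s p)) * w p) = 0"
    proof (rule fourier_laplace_zero[OF w s sb nn loc _ inf])
      fix r :: real assume r: "r > 0"
      let ?A = "group_fourier \<mu> ?H ?ip f (T_rep r)"
      note gf = group_fourier_eq[OF rep eH, where r = r]
      have "Re (?ip (?A e) (?A e)) \<le> (C * exp (- \<theta> r))\<^sup>2"
        by (rule hs_norm_ge[OF E_def bound[OF r, unfolded fourier_hs_norm_def] _ e])
          (use C sip.ip_nonneg[OF sub[OF gf(1)]] in auto)
      then have "Re (?ip (?A e) (?A e)) * Re (?ip \<phi> \<phi>) \<le> (C * exp (- \<theta> r))\<^sup>2 * Re (?ip \<phi> \<phi>)"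
        by (intro mult_right_mono sip.ip_nonneg \<phi>L)
      then have "(cmod (?ip (?A e) \<phi>))\<^sup>2 \<le> (C * exp (- \<theta> r))\<^sup>2 * Re (?ip \<phi> \<phi>)"
        using sip.cauchy_schwarz[OF sub[OF gf(1)] \<phi>L] by linarith
      also have "\<dots> = (sqrt (Re (?ip \<phi> \<phi>)) * (C * exp (- \<theta> r)))\<^sup>2"
        using sip.ip_nonneg[OF \<phi>L] by (simp add: power_mult_distrib)
      finally have "cmod (?ip (?A e) \<phi>) \<le> sqrt (Re (?ip \<phi> \<phi>)) * (C * exp (- \<theta> r))"
        by (rule power2_le_imp_le) (use C sip.ip_nonneg[OF \<phi>L] in auto)
      then have "real d * cmod (LINT k0|\<mu>. LINT k|\<mu>. kern r k0 k * (e k \<bullet>c \<phi> k0)) \<le> sqrt (Re (?ip \<phi> \<phi>)) * (C * exp (- \<theta> r))"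
        unfolding gf(2)[OF \<phi>H] by (simp add: norm_mult)
      moreover have "1 * cmod (LINT k0|\<mu>. LINT k|\<mu>. kern r k0 k * (e k \<bullet>c \<phi> k0)) \<le> real d * cmod (LINT k0|\<mu>. LINT k|\<mu>. kern r k0 k * (e k \<bullet>c \<phi> k0))"
        using d by (intro mult_right_mono) auto
      ultimately show "cmod (LINT p|((\<mu> \<Otimes>\<^sub>M \<mu>) \<Otimes>\<^sub>M lborel). exp (\<i> * of_real (r * s p)) * w p) \<le> (sqrt (Re (?ip \<phi> \<phi>)) * C) * exp (- \<theta> r)"
        unfolding eq[symmetric] by (simp add: mult.assoc)
    qed
    then show ?thesis using eq by simp
  qed
  \<comment> \<open>The kernel of the adjoint operator.\<close>
  define N where "N = (\<lambda>k k0. cnj (kern r k0 k))"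
  have cN: "continuous_on (SO \<times> SO) (\<lambda>p. N (fst p) (snd p))"
    unfolding N_def
    by (intro continuous_intros continuous_on_compose2[OF continuous_on_kern[of r], of _ "\<lambda>p. (snd p, fst p)", simplified]) auto
  have Ninv: "N (u ** k0) (u ** k) = N k0 k" if "u \<in> K1" for u k0 k
    using kern_left_mult[OF that] by (simp add: N_def)
  define \<omega> where "\<omega> = kernel_op d N \<phi>"
  have \<omega>H: "\<omega> \<in> ?H" unfolding \<omega>_def by (rule kernel_op_covariant[OF cN Ninv rep \<phi>H])
  have "?ip \<omega> e = 0" if e: "e \<in> E" for e
  proof -
    have eL: "e \<in> L2 d" using E e sub by (auto simp: orthonormal_basis_def)
    have "?ip \<omega> e = of_nat d * (LINT k|\<mu>. LINT k0|\<mu>. N k k0 * (\<phi> k0 \<bullet>c e k))"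
      unfolding \<omega>_def by (rule kernel_op_inner[OF cN \<phi>L eL, symmetric])
    also have "(LINT k|\<mu>. LINT k0|\<mu>. N k k0 * (\<phi> k0 \<bullet>c e k)) = (LINT k|\<mu>. cnj (LINT k0|\<mu>. kern r k0 k * (e k \<bullet>c \<phi> k0)))"
    proof (rule Bochner_Integration.integral_cong[OF refl])
      fix k assume "k \<in> space \<mu>"
      then have k: "k \<in> SO" by (simp add: space_mu)
      have "(LINT k0|\<mu>. N k k0 * (\<phi> k0 \<bullet>c e k)) = (LINT k0|\<mu>. cnj (kern r k0 k * (e k \<bullet>c \<phi> k0)))"
        using k eL \<phi>L by (intro Bochner_Integration.integral_cong refl)
          (auto simp: N_def space_mu L2_def cscalar_prod_sum[of _ d] mult.commute)
      then show "(LINT k0|\<mu>. N k k0 * (\<phi> k0 \<bullet>c e k)) = cnj (LINT k0|\<mu>. kern r k0 k * (e k \<bullet>c \<phi> k0))"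
        by (simp only: Bochner_Integration.integral_cnj)
    qed
    also have "\<dots> = cnj (LINT k|\<mu>. LINT k0|\<mu>. kern r k0 k * (e k \<bullet>c \<phi> k0))"
      by (rule Bochner_Integration.integral_cnj)
    also have "(LINT k|\<mu>. LINT k0|\<mu>. kern r k0 k * (e k \<bullet>c \<phi> k0)) = (LINT k0|\<mu>. LINT k|\<mu>. kern r k0 k * (e k \<bullet>c \<phi> k0))"
      by (rule PP.Fubini_integral[OF integrable_kernel_tensor[OF eL \<phi>L]])
    finally show ?thesis using zero[OF e] by simp
  qed
  then have "?ip \<omega> \<omega> = 0" using E \<omega>H by (auto simp: orthonormal_basis_def)
  moreover have \<omega>L: "\<omega> \<in> L2 d" by (rule sub[OF \<omega>H])
  moreover have "?ip \<omega> \<omega> = of_real (real d * (\<Sum>i<d. (LINT k|\<mu>. (cmod (vec_index (\<omega> k) i))\<^sup>2)))"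
    unfolding H_inner_sum[OF \<omega>L \<omega>L] by (simp add: complex_norm_square[symmetric] integral_complex_of_real del: of_real_power)
  ultimately have "(\<Sum>i<d. (LINT k|\<mu>. (cmod (vec_index (\<omega> k) i))\<^sup>2)) = 0" using d by (simp del: of_real_sum)
  then have "(LINT k|\<mu>. (cmod (vec_index (\<omega> k) i))\<^sup>2) = 0"
    using i by (subst (asm) sum_nonneg_eq_0_iff) auto
  then have "AE k in \<mu>. (cmod (vec_index (\<omega> k) i))\<^sup>2 = 0"
    using integral_nonneg_eq_0_iff_AE[OF L2_component(2)[OF \<omega>L i]] by simp
  then have "AE k in \<mu>. vec_index (\<omega> k) i = 0" by simp
  from AE_zero_imp_zero[OF _ this k] have "vec_index (\<omega> k) i = 0"
    using kernel_op(1)[OF cN \<phi>L i] by (simp add: \<omega>_def)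
  then show ?thesis using i by (simp add: \<omega>_def kernel_op_def N_def)
qed

end

lemma prod_concat:
  fixes F :: "'i \<Rightarrow> 'c::comm_monoid_mult" and m n :: nat
  shows "(\<Prod>s<m. F (a s)) * (\<Prod>s<n. F (b s)) = (\<Prod>s<m+n. F (if s < m then a s else b (s - m)))"
  by (induction n) (auto simp: mult.assoc[symmetric])

context motion_kernel
begin

text \<open>
  The functions orthogonal to all \<open>M\<^sub>r(\<cdot>, k)\<close> form a linear space \<open>Z\<close>; it contains all monomials in
  the matrix entries, which separate the points of the group.
\<close>
lemma kernel_vanishes:
  assumes orth: "\<And>d lam \<phi> i k. irreducible_unitary_rep K1 d lam \<Longrightarrow> covariant K1 d lam \<phi> \<Longrightarrow> i < d \<Longrightarrow> k \<in> SO \<Longrightarrow>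
     (LINT k0|\<mu>. cnj (kern r k0 k) * vec_index (\<phi> k0) i) = 0"
    and k0: "k0 \<in> SO" and k: "k \<in> SO"
  shows "kern r k0 k = 0"
proof -
  have ck: "continuous_on SO (\<lambda>k0. cnj (kern r k0 k))" if "k \<in> SO" for k
    using that by (intro continuous_intros continuous_on_compose2[OF continuous_on_kern[of r], of SO "\<lambda>k0. (k0, k)", simplified]) auto
  define Z where "Z = {q. continuous_on SO q \<and> (\<forall>k\<in>SO. (LINT k0|\<mu>. cnj (kern r k0 k) * q k0) = 0)}"
  have Zi: "integrable \<mu> (\<lambda>k0. cnj (kern r k0 k) * q k0)" if "q \<in> Z" "k \<in> SO" for q k
    using that by (intro integrable_continuous_on continuous_on_mult ck) (auto simp: Z_def)
  define mon where "mon = (\<lambda>m (a :: nat \<Rightarrow> 'n \<times> 'n) (k :: 'n sqmat). \<Prod>s<m. vec_nth (vec_nth k (fst (a s))) (snd (a s)))"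
  have monZ: "(\<lambda>k. complex_of_real (mon m a k)) \<in> Z" for m a
    unfolding mon_def
  proof (rule monomials_by_irreducibles[where Z = Z])
    show "g \<in> Z" if f: "f \<in> Z" and eq: "\<And>k. k \<in> SO \<Longrightarrow> f k = g k" for f g
    proof -
      have "continuous_on SO g" using f eq by (auto simp: Z_def intro: continuous_on_eq)
      moreover have "(LINT k0|\<mu>. cnj (kern r k0 k) * g k0) = (LINT k0|\<mu>. cnj (kern r k0 k) * f k0)" for k
        using eq by (intro Bochner_Integration.integral_cong refl) (simp add: space_mu)
      ultimately show ?thesis using f by (simp add: Z_def)
    qed
    show "(\<lambda>_. 0) \<in> Z" by (simp add: Z_def)
    show "(\<lambda>k. f k + g k) \<in> Z" if "f \<in> Z" "g \<in> Z" for f g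
    proof -
      have "(LINT k0|\<mu>. cnj (kern r k0 k) * (f k0 + g k0)) = 0" if "k \<in> SO" for k
        using Zi[OF \<open>f \<in> Z\<close> that] Zi[OF \<open>g \<in> Z\<close> that] \<open>f \<in> Z\<close> \<open>g \<in> Z\<close> that by (simp add: distrib_left Z_def)
      then show ?thesis using that by (auto simp: Z_def intro!: continuous_intros)
    qed
    show "(\<lambda>k. c * f k) \<in> Z" if "f \<in> Z" for c f
      using that by (auto simp: Z_def mult.left_commute[of _ c] intro!: continuous_intros)
    show "(\<lambda>k. vec_index (\<phi> k) i) \<in> Z" if "irreducible_unitary_rep K1 d lam" "covariant K1 d lam \<phi>" "i < d" for d lam \<phi> i
      using that orth[OF that] by (simp add: Z_def covariant_def)
  qed
  define A where "A = {mon m a | m a. True}"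
  have Ac: "continuous_on S a" if "a \<in> A" for a S
    using that unfolding A_def mon_def by (auto intro!: continuous_intros)
  have "AE k0 in \<mu>. cnj (kern r k0 k) = 0"
  proof (rule AE_zero_if_orthogonal_to_separating_family[OF compact_SO ck[OF k], where A = A])
    show "integrable \<mu> (\<lambda>k0. cnj (kern r k0 k))" by (rule integrable_continuous_on[OF ck[OF k]])
    show "(\<lambda>_. 1) \<in> A" unfolding A_def by (auto simp: mon_def fun_eq_iff intro!: exI[of _ 0])
    show "(\<lambda>x. a x * b x) \<in> fspan A" if ab: "a \<in> A" "b \<in> A" for a b
    proof -
      obtain m a' n b' where eq: "a = mon m a'" "b = mon n b'" using ab unfolding A_def by auto
      have "(\<lambda>x. a x * b x) = mon (m + n) (\<lambda>s. if s < m then a' s else b' (s - m))"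
        unfolding eq mon_def
        using prod_concat[where F = "\<lambda>p. vec_nth (vec_nth (_ :: 'n sqmat) (fst p)) (snd p)"] by (intro ext) blast
      then have "(\<lambda>x. a x * b x) \<in> A" unfolding A_def by blast
      then show ?thesis using fspan_scale_base[of "\<lambda>x. a x * b x" A 1] by simp
    qed
    show "\<exists>a\<in>A. a x \<noteq> a y" if xy: "x \<noteq> y" for x y :: "'n sqmat"
    proof -
      obtain i j where ij: "vec_nth (vec_nth x i) j \<noteq> vec_nth (vec_nth y i) j" using xy by (metis Finite_Cartesian_Product.vec_eq_iff)
      have "mon 1 (\<lambda>_. (i, j)) \<in> A" unfolding A_def by blast
      then show ?thesis using ij by (intro bexI[of _ "mon 1 (\<lambda>_. (i, j))"]) (auto simp: mon_def)
    qed
    show "(LINT k0|\<mu>. of_real (a k0) * cnj (kern r k0 k)) = 0" if aA: "a \<in> A" for a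
    proof -
      obtain m a' where "a = mon m a'" using aA unfolding A_def by blast
      then show ?thesis using monZ[of m a'] k by (simp add: Z_def mult.commute)
    qed
  qed (use Ac measurable_mu_continuous_on in \<open>auto simp: space_mu\<close>)
  from AE_zero_imp_zero[OF ck[OF k] this k0] show ?thesis by simp
qed

text \<open>
  A rotation takes \<open>\<xi>\<^sub>r\<close> to any prescribed frequency \<open>\<eta>\<close> of norm \<open>r\<close>, so the kernels contain all values
  of the Euclidean Fourier transforms of the functions \<open>f(\<cdot>, k)\<close>.
\<close>
lemma vanishes_if_kernels_vanish:
  assumes n: "CARD('n) \<ge> 2" and zero: "\<And>r k0 k. k0 \<in> SO \<Longrightarrow> k \<in> SO \<Longrightarrow> kern r k0 k = 0" and k: "k \<in> SO"
  shows "f (x, k) = 0"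
proof (rule fourier_transform_injective[of "\<lambda>x. f (x, k)" R])
  show "continuous_on UNIV (\<lambda>x. f (x, k))"
    using k by (intro continuous_on_compose2[OF cont_f] continuous_intros) auto
  show "f (x, k) = 0" if "R < norm x" for x using supp_f[OF k that] .
  fix \<eta> :: "'n rvec"
  have "norm (xi (norm \<eta>) :: 'n rvec) = norm \<eta>" by (simp add: norm_xi)
  then obtain F where F: "orthogonal_transformation F" "Determinants.det (matrix F) = 1" "F (xi (norm \<eta>)) = \<eta>"
    using rotation_exists[OF n] by metis
  define h where "h = tp (matrix F)"
  have "matrix F \<in> SO" using F by (simp add: SO_iff orthogonal_transformation_matrix)
  then have h: "h \<in> SO" unfolding h_def by (rule SO_transpose)
  have "tp h *v xi (norm \<eta>) = \<eta>"
    using F matrix_works[of F "xi (norm \<eta>)"] by (simp add: h_def orthogonal_transformation_def linear_matrix_vector_mul_eq)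
  moreover have "kern (norm \<eta>) h (h ** k) = 0" by (intro zero h SO_mult k)
  ultimately show "(LINT x|lborel. f (x, k) * exp (\<i> * of_real (\<eta> \<bullet> x))) = 0"
    by (simp add: kern_def phase_def SO_cancel[OF h])
qed

end

lemma Cc_motion_bounds:
  fixes f :: "'n::{finite,linorder} rvec \<times> 'n sqmat \<Rightarrow> complex"
  assumes f: "f \<in> Cc_motion"
  shows "\<exists>R B. continuous_on (UNIV \<times> SO) f \<and> (\<forall>x. \<forall>k\<in>SO. norm x > R \<longrightarrow> f (x, k) = 0) \<and>
    (\<forall>x. \<forall>k\<in>SO. norm (f (x, k)) \<le> B)"
proof -
  define S where "S = closure {p \<in> UNIV \<times> (SO :: 'n sqmat set). f p \<noteq> 0}"
  have cf: "continuous_on (UNIV \<times> SO) f" and S: "compact S"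
    using f by (auto simp: Cc_motion_def motion_group_def S_def)
  have "closed ((UNIV :: 'n rvec set) \<times> (SO :: 'n sqmat set))"
    by (intro closed_Times closed_UNIV compact_imp_closed compact_SO)
  then have "S \<subseteq> UNIV \<times> SO" unfolding S_def by (intro closure_minimal) auto
  then have "bounded (f ` S)" by (intro compact_imp_bounded compact_continuous_image S continuous_on_subset[OF cf])
  then obtain B where B: "\<And>p. p \<in> S \<Longrightarrow> norm (f p) \<le> B" by (auto simp: bounded_iff)
  obtain R where R: "\<And>p. p \<in> S \<Longrightarrow> norm p \<le> R"
    using compact_imp_bounded[OF S] by (auto simp: bounded_iff)
  have inS: "(x, k) \<in> S" if "k \<in> SO" "f (x, k) \<noteq> 0" for x k
    unfolding S_def using that by (intro subsetD[OF closure_subset]) auto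
  have "f (x, k) = 0" if "k \<in> SO" "R < norm x" for x k
    using R[OF inS[OF that(1)]] that(2) norm_fst_le[of x k] by force
  moreover have "norm (f (x, k)) \<le> max B 0" if "k \<in> SO" for x k
    using B[OF inS[OF that]] by (cases "f (x, k) = 0") (auto simp: le_max_iff_disj)
  ultimately show ?thesis using cf by (intro exI[of _ R] exI[of _ "max B 0"]) blast
qed

theorem theorem3p1:
  fixes \<mu> :: "'n::{finite,linorder} sqmat measure"
  assumes "CARD('n) \<ge> 2"
    and "normalized_haar_measure SO \<mu>"
  shows
    "(\<forall>(\<theta> :: real \<Rightarrow> real) (f :: 'n rvec \<times> 'n sqmat \<Rightarrow> complex).
        (\<forall>r\<ge>0. \<theta> r \<ge> 0) \<and>
        (\<forall>R. \<theta> absolutely_integrable_on {0..R}) \<and>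
        f \<in> Cc_motion \<and>
        (\<forall>d lam. irreducible_unitary_rep (K1 :: 'n sqmat set) d lam \<longrightarrow>
           (\<exists>C>0. \<forall>r>0. fourier_hs_norm \<mu> f r d lam \<le> ennreal (C * exp (- \<theta> r)))) \<and>
        (\<integral>\<^sup>+r\<in>{0..}. ennreal (\<theta> r / (1 + r\<^sup>2)) \<partial>lebesgue) = \<infinity>
        \<longrightarrow> (\<forall>p\<in>carrier motion_group. f p = 0))
     \<and>
     (\<forall>\<theta> :: real \<Rightarrow> real.
        (\<forall>r\<ge>0. \<theta> r \<ge> 0) \<and>
        mono_on {0..} \<theta> \<and>
        (\<integral>\<^sup>+r\<in>{0..}. ennreal (\<theta> r / (1 + r\<^sup>2)) \<partial>lebesgue) < \<infinity>
        \<longrightarrow> (\<exists>f :: 'n rvec \<times> 'n sqmat \<Rightarrow> complex.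
              f \<in> Cc_motion \<and>
              (\<exists>p\<in>carrier motion_group. f p \<noteq> 0) \<and>
              (\<forall>d lam. irreducible_unitary_rep (K1 :: 'n sqmat set) d lam \<longrightarrow>
                 (\<exists>C>0. \<forall>r>0. fourier_hs_norm \<mu> f r d lam \<le> ennreal (C * exp (- \<theta> r))))))"
proof (intro conjI allI impI; elim conjE)
  fix \<theta> :: "real \<Rightarrow> real" and f :: "'n rvec \<times> 'n sqmat \<Rightarrow> complex"
  assume nn: "\<forall>r\<ge>0. \<theta> r \<ge> 0" and loc: "\<forall>R. \<theta> absolutely_integrable_on {0..R}" and f: "f \<in> Cc_motion"
    and decay: "\<forall>d lam. irreducible_unitary_rep (K1 :: 'n sqmat set) d lam \<longrightarrow>
           (\<exists>C>0. \<forall>r>0. fourier_hs_norm \<mu> f r d lam \<le> ennreal (C * exp (- \<theta> r)))"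
    and inf: "(\<integral>\<^sup>+r\<in>{0..}. ennreal (\<theta> r / (1 + r\<^sup>2)) \<partial>lebesgue) = \<infinity>"
  obtain R B where cf: "continuous_on (UNIV \<times> SO) f" and supp: "\<forall>x. \<forall>k\<in>SO. norm x > R \<longrightarrow> f (x, k) = 0"
    and bnd: "\<forall>x. \<forall>k\<in>SO. norm (f (x, k)) \<le> B"
    using Cc_motion_bounds[OF f] by blast
  interpret motion_kernel \<mu> f B R by unfold_locales (use assms cf supp bnd in auto)
  have "kern r k0 k = 0" if k: "k0 \<in> SO" "k \<in> SO" for r k0 k
  proof (rule kernel_vanishes[OF _ k])
    fix d lam \<phi> i and k :: "'n sqmat"
    assume irr: "irreducible_unitary_rep (K1 :: 'n sqmat set) d lam" and cov: "covariant K1 d lam \<phi>" and i: "i < d" and k: "k \<in> SO"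
    obtain C where "C > 0" "\<And>r. r > 0 \<Longrightarrow> fourier_hs_norm \<mu> f r d lam \<le> ennreal (C * exp (- \<theta> r))"
      using decay irr by blast
    then show "(LINT k0|\<mu>. cnj (kern r k0 k) * vec_index (\<phi> k0) i) = 0"
      using nn loc by (intro adjoint_kernel_orthogonal[OF _ _ inf irr _ _ cov i k]) auto
  qed
  then have "f (x, k) = 0" if "k \<in> SO" for x k
    using vanishes_if_kernels_vanish[OF assms(1) _ that] by blast
  then show "\<forall>p\<in>carrier motion_group. f p = 0" by (auto simp: motion_group_def)
next
  fix \<theta> :: "real \<Rightarrow> real"
  assume nn: "\<forall>r\<ge>0. \<theta> r \<ge> 0" and mono: "mono_on {0..} \<theta>"
    and fin: "(\<integral>\<^sup>+r\<in>{0..}. ennreal (\<theta> r / (1 + r\<^sup>2)) \<partial>lebesgue) < \<infinity>"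
  obtain g :: "'n rvec \<Rightarrow> real" and R L B C x0 where g: "bump R L B g" and x0: "g x0 \<noteq> 0" and C: "C > 0"
    and decay: "\<And>\<eta>. norm (fourier g \<eta>) \<le> C * exp (- \<theta> (norm \<eta>))"
    using bump_with_prescribed_decay[OF _ mono fin] nn by blast
  define f where "f = (\<lambda>p :: 'n rvec \<times> 'n sqmat. complex_of_real (g (fst p)))"
  have gc: "continuous_on UNIV g" by (rule bump_continuous[OF g])
  have cf: "continuous_on S f" for S
    unfolding f_def by (intro continuous_intros continuous_on_compose2[OF gc]) auto
  have g0: "g x = 0" if "norm x > R" for x using g that by (auto simp: bump_def)
  have f0: "f (x, k) = 0" if "R < norm x" for x k using g0[OF that] by (simp add: f_def)
  have fB: "norm (f (x, k)) \<le> B" for x k using g by (simp add: f_def bump_def)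
  interpret motion_kernel \<mu> f B R
    by unfold_locales (rule assms(2) cf fB f0 | assumption)+
  have "f \<in> Cc_motion"
  proof -
    have "{p \<in> carrier motion_group. f p \<noteq> 0} \<subseteq> cball 0 R \<times> SO"
      using g0 by (auto simp: motion_group_def f_def not_less[symmetric])
    then have "bounded {p \<in> carrier motion_group. f p \<noteq> 0}"
      by (rule bounded_subset[rotated]) (intro bounded_Times bounded_cball compact_imp_bounded compact_SO)
    then show ?thesis using cf by (auto simp: Cc_motion_def compact_closure)
  qed
  moreover have "\<exists>p\<in>carrier motion_group. f p \<noteq> 0"
    using x0 SO_one by (intro bexI[of _ "(x0, idm)"]) (auto simp: f_def motion_group_def)
  moreover have "\<exists>C>0. \<forall>r>0. fourier_hs_norm \<mu> f r d lam \<le> ennreal (C * exp (- \<theta> r))"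
    if irr: "irreducible_unitary_rep (K1 :: 'n sqmat set) d lam" for d lam
  proof (intro exI[of _ "sqrt (real d) * C"] conjI allI impI)
    have rep: "unitary_matrix_rep (K1 :: 'n sqmat set) d lam" and d: "d > 0" using irr by (auto simp: irreducible_unitary_rep_def)
    show "sqrt (real d) * C > 0" using C d by simp
    fix r :: real assume r: "r > 0"
    have "fourier_hs_norm \<mu> f r d lam \<le> ennreal (sqrt (real d) * (C * exp (- \<theta> r)))"
    proof (rule hs_norm_right_invariant_le[OF rep])
      show "kern r k0 k = fourier g (tp k0 *v xi r)" for k0 k
        unfolding kern_def fourier_def phase_def by (simp add: f_def)
      show "norm (fourier g (tp k0 *v xi r)) \<le> C * exp (- \<theta> r)" if "k0 \<in> SO" for k0
      proof -
        have "norm (tp k0 *v xi r) = r"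
          using r unfolding SO_norm[OF SO_transpose[OF that]] norm_xi by simp
        then show ?thesis using decay[of "tp k0 *v xi r"] by (simp only:)
      qed
    qed
    then show "fourier_hs_norm \<mu> f r d lam \<le> ennreal (sqrt (real d) * C * exp (- \<theta> r))" by (simp add: mult.assoc)
  qed
  ultimately show "\<exists>f :: 'n rvec \<times> 'n sqmat \<Rightarrow> complex.
              f \<in> Cc_motion \<and>
              (\<exists>p\<in>carrier motion_group. f p \<noteq> 0) \<and>
              (\<forall>d lam. irreducible_unitary_rep (K1 :: 'n sqmat set) d lam \<longrightarrow>
                 (\<exists>C>0. \<forall>r>0. fourier_hs_norm \<mu> f r d lam \<le> ennreal (C * exp (- \<theta> r))))"
    by (intro exI[of _ f]) simp
qed

end
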